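(* Let $(\mathcal M,g)$ be a closed connected Riemannian manifold of dimension $n$, and let $p\in\{1,\dots,n\}$. Assume that $\varphi(\alpha,t)=\phi(\pi(\alpha))$ for some positive smooth function $\phi$ on $\mathcal M$, that $A(\alpha,t)$ is independent of $t$, and that for every $(x,t)\in\mathcal M\times\mathbb R$ and $\alpha\in T_x^*\mathcal M$, $$\Bigl(D_\alpha^2\bigl[(A(\cdot,t))(v,v)\bigr]\Bigr)(\beta,\beta)\le0,\qquad\forall(\beta,v)\in T_x^*\mathcal M\times T_x\mathcal M .$$ Then every $\mathcal C$-subsolution $\underline u\in C^2(\mathcal M)$ to the general $p$-Hessian equation is a pseudo-solution to the general $p$-Hessian equation.
   Context: Notation. $\sigma_p(\mu)=\sum_{1\le j_1<\dots<j_p\le n}\mu_{j_1}\cdots\mu_{j_p}$ for $\mu\in\mathbb R^n$; $\Gamma_p=\{\mu\in\mathbb R^n:\sigma_q(\mu)>0\ \forall q\in\{1,\dots,p\}\}$, with closure $\overline\Gamma_p$; $\mathbf 1_n=(1,\dots,1)^T$; $\mathrm B_R(0)$ is the open ball in $\mathbb R^n$; sums of sets are Minkowski sums. "Closed" means compact without boundary. $\pi:T^*\mathcal M\to\mathcal M$ is the projection. $A$ is a smooth map assigning to each $(\alpha,t)\in T^*\mathcal M\times\mathbb R$ a symmetric bilinear form $A(\alpha,t)$ on $T_{\pi(\alpha)}\mathcal M$, with components $A_{jk}(\alpha,t)$ in local coordinates; $\varphi(\alpha,t)$ is a positive smooth function on $T^*\mathcal M\times\mathbb R$. For $u\in C^2(\mathcal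 M)$, $\mathrm du$ is its differential, $\nabla^2u$ (components $\nabla_{jk}u$) its Hessian for the Levi-Civita connection, and $A(\mathrm du,u)$ is the tensor field $x\mapsto A(\mathrm du(x),u(x))$. For a symmetric $(0,2)$-tensor field $B$, $\lambda(g^{-1}B)(x)\in\mathbb R^n$ is the vector of eigenvalues, in non-decreasing order, of the matrix product $(g^{jk}(x))(B_{jk}(x))$ in any local coordinates, where $(g^{jk})=(g_{jk})^{-1}$. $|\alpha|_g=(g^{jk}\alpha_j\alpha_k)^{1/2}$. Repeated indices are summed. For $\psi\in C^2(T_x^*\mathcal M)$, $D_\alpha[\psi](\beta)$ and $D^2_\alpha[\psi](\beta,\gamma)$ denote the first and second (Fréchet) derivatives of $\psi$ at $\alpha$ on the vector space $T_x^*\mathcal M$; $(A(\cdot,t))(v,v)$ and $A_{jk}(\cdot,t)$ are here regarded as functions on $T_x^*\mathcal M$. The general $p$-Hessian equation for $u\in C^2(\mathcal M)$ is: for all $x\in\mathcal M$, $$\sigma_p^{1/p}\bigl(\lambda(g^{-1}(A(\mathrm du,u)+\nabla^2u))(x)\bigr)=\varphi(\mathrm du(x),u(x)),\qquad \lambda(g^{-1}(A(\mathrm du,u)+\nabla^2u))(x)\in\Gamma_p .$$ A solution is a $u$ satisfying both requirements. When $\varphi(\alpha,t)=\phi(\pi(\alpha))$, $\underline u\in C^2(\mathcal M)$ is a $\mathcal C$-subsolution if there exist positive constants $\delta$ and $R$, depending only on $\mathcal M,g,n,p,A,\phi,\underline u$, such that for any $x\in\mathcal M$ $$\bigl\{\mu\in\Gamma_p:\sigma_p^{1/p}(\mu)=\phi(x)\bigr\}\cap\Bigl(\bigl\{\lambda\bigl(g^{-1}(A(\mathrm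 d\underline u,\underline u)+\nabla^2\underline u)\bigr)(x)-\delta\mathbf 1_n\bigr\}+\Gamma_n\Bigr)\subset \mathrm B_R(0).$$ For a solution $u$ and $x\in\mathcal M$, in local coordinates, $F^{jk}_{u,x}$ is the partial derivative with respect to $b_{jk}$ of the function of the real $n\times n$ matrix $\mathbf B=(b_{jk})$ given by $\sigma_p^{1/p}$ of the eigenvalues of $\frac12(g^{jk}(x))(\mathbf B+\mathbf B^T)$, evaluated at $\mathbf B=\bigl(A_{jk}(\mathrm du,u)+\nabla_{jk}u\bigr)(x)$. $\lambda_1$ of a matrix denotes its minimum eigenvalue. A function $\underline u\in C^2(\mathcal M)$ is a pseudo-solution to the general $p$-Hessian equation if it satisfies both: (1) Pseudo-subsolution condition: for any $C\in[0,+\infty)$ there exist constants $\delta_1>0$ and $M_1\ge0$, depending only on $\mathcal M,g,n,p,A,\varphi,\underline u,C$, such that for any solution $u\in C^2(\mathcal M)$ with $\max_{\mathcal M}|u|+\max_{\mathcal M}|\mathrm du|_g\le C$ and any $x\in\mathcal M$ (in local coordinates at $x$), $$F^{jk}_{u,x}\nabla_{jk}(\underline u-u)(x)+F^{jk}_{u,x}\Bigl(D_{\mathrm du(x)}\bigl[A_{jk}(\cdot,u(x))\bigr]\Bigr)\bigl(\mathrm d(\underline u-u)(x)\bigr)\ge\delta_1F^{jk}_{u,x}g_{jk}(x)-M_1\lambda_1\bigl((F^{jk}_{u,x})(g_{jk}(x))\bigr)-M_1 .$$ (2) Pseudo-supersolution condition: there exist constants $\delta_2>0$ and $M_2\ge0$,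 depending only on $\mathcal M,g,n,p,A,\varphi,\underline u$, such that for any solution $u\in C^2(\mathcal M)$ and any $x\in\mathcal M$ with $\lambda(g^{-1}\nabla^2(u-\underline u))(x)+\delta_2\mathbf 1_n\in\overline\Gamma_n$ and $|\mathrm d(u-\underline u)(x)|_g\le\delta_2$, $$\sigma_n\bigl(\lambda(g^{-1}(\delta_2g+\nabla^2(u-\underline u)))(x)\bigr)\le M_2 .$$ *)

theory Defs
  imports "HOL-Analysis.Analysis"
begin

section \<open>Symmetric functions, cones, eigenvalues\<close>

text \<open>These synonyms avoid the sort constraint that the notation \<open>real^'n\<close> adds to \<open>'n\<close>.\<close>

type_synonym 'n rvec = "(real, 'n) vec"
type_synonym 'n rmat = "((real, 'n) vec, 'n) vec"

definition esym :: "nat \<Rightarrow> real^'n \<Rightarrow> real" where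
  "esym p \<mu> = (\<Sum>J | J \<subseteq> UNIV \<and> card J = p. \<Prod>j\<in>J. \<mu> $ j)"

definition Gamma_cone :: "nat \<Rightarrow> (real^'n) set" where
  "Gamma_cone p = {\<mu>. \<forall>q\<in>{1..p}. esym q \<mu> > 0}"

text \<open>The eigenvalues, in non-decreasing order, repeated according to their algebraic multiplicity
  (the roots of the characteristic polynomial).  Only meaningful if the characteristic polynomial
  splits over the reals, as it does for all the matrices considered below: each of them is a product
  of two symmetric matrices one of which is positive definite.\<close>

definition eigvals :: "'n::{finite,linorder} rmat \<Rightarrow> 'n rvec" where
  "eigvals B = (THE \<mu>. mono (\<lambda>i. \<mu> $ i) \<and> (\<forall>z. det (mat z - B) = (\<Prod>i\<in>UNIV. z - \<mu> $ i)))"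

definition min_eigval :: "real^'n^'n \<Rightarrow> real" where
  "min_eigval B = Min {z. \<exists>v. v \<noteq> 0 \<and> B *v v = z *\<^sub>R v}"


section \<open>Functions of class $C^k$ and smooth functions on open sets\<close>

fun Ck_on :: "nat \<Rightarrow> 'a::euclidean_space set \<Rightarrow> ('a \<Rightarrow> 'b::real_normed_vector) \<Rightarrow> bool" where
  "Ck_on 0 S f \<longleftrightarrow> continuous_on S f"
| "Ck_on (Suc k) S f \<longleftrightarrow> (\<forall>x\<in>S. f differentiable (at x)) \<and>
     (\<forall>v. Ck_on k S (\<lambda>x. frechet_derivative f (at x) v))"

definition smooth_on :: "'a::euclidean_space set \<Rightarrow> ('a \<Rightarrow> 'b::real_normed_vector) \<Rightarrow> bool" where
  "smooth_on S f \<longleftrightarrow> (\<forall>k. Ck_on k S f)"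

definition pd :: "'n \<Rightarrow> (real^'n \<Rightarrow> real) \<Rightarrow> real^'n \<Rightarrow> real" where
  "pd j f y = frechet_derivative f (at y) (axis j 1)"

text \<open>The second Frechet derivative of \<open>\<psi>\<close> at \<open>\<alpha>\<close>, applied to \<open>(\<beta>, \<gamma>)\<close>.\<close>

definition D2 :: "('a::real_normed_vector \<Rightarrow> real) \<Rightarrow> 'a \<Rightarrow> 'a \<Rightarrow> 'a \<Rightarrow> real" where
  "D2 \<psi> \<alpha> \<beta> \<gamma> = frechet_derivative (\<lambda>\<xi>. frechet_derivative \<psi> (at \<xi>) \<beta>) (at \<alpha>) \<gamma>"


section \<open>Manifolds\<close>

text \<open>A manifold \<open>\<M>\<close> of dimension \<open>CARD('n)\<close> is the type \<open>'m\<close> together with a smooth atlas.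
  A chart is a pair \<open>(U, \<phi>)\<close> of its domain and its coordinate map (irrelevant outside \<open>U\<close>).\<close>

type_synonym ('m, 'n) chart = "'m set \<times> ('m \<Rightarrow> real^'n)"

abbreviation chart_dom :: "('m, 'n) chart \<Rightarrow> 'm set" where
  "chart_dom c \<equiv> fst c"

abbreviation chart_map :: "('m, 'n) chart \<Rightarrow> 'm \<Rightarrow> real^'n" where
  "chart_map c \<equiv> snd c"

abbreviation chart_img :: "('m, 'n) chart \<Rightarrow> (real^'n) set" where
  "chart_img c \<equiv> chart_map c ` chart_dom c"

abbreviation chart_inv :: "('m, 'n) chart \<Rightarrow> real^'n \<Rightarrow> 'm" where
  "chart_inv c \<equiv> inv_into (chart_dom c) (chart_map c)"

definition smooth_atlas ::
  "('m::{t2_space,second_countable_topology}, 'n::finite) chart set \<Rightarrow> bool" where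
  "smooth_atlas \<A> \<longleftrightarrow>
     (\<Union>c\<in>\<A>. chart_dom c) = UNIV \<and>
     (\<forall>c\<in>\<A>. open (chart_dom c) \<and> open (chart_img c) \<and>
        homeomorphism (chart_dom c) (chart_img c) (chart_map c) (chart_inv c)) \<and>
     (\<forall>c\<in>\<A>. \<forall>d\<in>\<A>. smooth_on (chart_map c ` (chart_dom c \<inter> chart_dom d))
        (chart_map d \<circ> chart_inv c))"

text \<open>The Jacobian matrix at \<open>x\<close> of the change of coordinates from \<open>c\<close> to \<open>d\<close>.\<close>

definition jac :: "('m, 'n::finite) chart \<Rightarrow> ('m, 'n) chart \<Rightarrow> 'm \<Rightarrow> real^'n^'n" where
  "jac c d x = matrix (frechet_derivative (chart_map d \<circ> chart_inv c) (at (chart_map c x)))"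

definition C2_fun :: "('m, 'n::finite) chart set \<Rightarrow> ('m \<Rightarrow> real) \<Rightarrow> bool" where
  "C2_fun \<A> u \<longleftrightarrow> (\<forall>c\<in>\<A>. Ck_on 2 (chart_img c) (u \<circ> chart_inv c))"

definition smooth_fun :: "('m, 'n::finite) chart set \<Rightarrow> ('m \<Rightarrow> real) \<Rightarrow> bool" where
  "smooth_fun \<A> u \<longleftrightarrow> (\<forall>c\<in>\<A>. smooth_on (chart_img c) (u \<circ> chart_inv c))"

text \<open>Tensorial objects are given by their components in each chart \<open>c\<close>, subject to the usual
  transformation law.  With \<open>J = jac c d x\<close>, a covector at \<open>x\<close> with components \<open>\<xi>\<close> in \<open>d\<close> has
  components \<open>transpose J *v \<xi>\<close> in \<open>c\<close>, and a bilinear form with component matrix \<open>B\<close> in \<open>d\<close> has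
  component matrix \<open>transpose J ** B ** J\<close> in \<open>c\<close>.  Thus \<open>(c, x, \<xi>)\<close> stands for the point of the
  cotangent bundle over \<open>x\<close> whose components in \<open>c\<close> are \<open>\<xi>\<close>.\<close>

type_synonym ('m, 'n) field2 = "('m, 'n) chart \<Rightarrow> 'm \<Rightarrow> real^'n^'n"

definition riemannian_metric ::
  "('m::{t2_space,second_countable_topology}, 'n::finite) chart set \<Rightarrow> ('m, 'n) field2 \<Rightarrow> bool" where
  "riemannian_metric \<A> g \<longleftrightarrow>
     (\<forall>c\<in>\<A>. smooth_on (chart_img c) (\<lambda>y. g c (chart_inv c y))) \<and>
     (\<forall>c\<in>\<A>. \<forall>x\<in>chart_dom c. transpose (g c x) = g c x \<and> (\<forall>v. v \<noteq> 0 \<longrightarrow> v \<bullet> (g c x *v v) > 0)) \<and>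
     (\<forall>c\<in>\<A>. \<forall>d\<in>\<A>. \<forall>x\<in>chart_dom c \<inter> chart_dom d.
        g c x = transpose (jac c d x) ** g d x ** jac c d x)"

definition closed_connected_riemannian_manifold ::
  "('m::{t2_space,second_countable_topology}, 'n::finite) chart set \<Rightarrow> ('m, 'n) field2 \<Rightarrow> bool" where
  "closed_connected_riemannian_manifold \<A> g \<longleftrightarrow>
     compact (UNIV :: 'm set) \<and> connected (UNIV :: 'm set) \<and>
     smooth_atlas \<A> \<and> riemannian_metric \<A> g"

text \<open>The data \<open>A(\<alpha>, t)\<close> and \<open>\<phi>(\<alpha>, t)\<close>, where \<open>\<alpha>\<close> is the covector at \<open>x\<close> with components \<open>\<xi>\<close>
  in \<open>c\<close>, are written \<open>A c x \<xi> t\<close> (the matrix of components) and \<open>\<phi> c x \<xi> t\<close>.\<close>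

type_synonym ('m, 'n) bilin_data = "('m, 'n) chart \<Rightarrow> 'm \<Rightarrow> real^'n \<Rightarrow> real \<Rightarrow> real^'n^'n"
type_synonym ('m, 'n) scalar_data = "('m, 'n) chart \<Rightarrow> 'm \<Rightarrow> real^'n \<Rightarrow> real \<Rightarrow> real"

definition smooth_sym_bilin :: "('m, 'n::finite) chart set \<Rightarrow> ('m, 'n) bilin_data \<Rightarrow> bool" where
  "smooth_sym_bilin \<A> A \<longleftrightarrow>
     (\<forall>c\<in>\<A>. smooth_on (chart_img c \<times> UNIV \<times> UNIV) (\<lambda>(y, \<xi>, t). A c (chart_inv c y) \<xi> t)) \<and>
     (\<forall>c\<in>\<A>. \<forall>x\<in>chart_dom c. \<forall>\<xi> t. transpose (A c x \<xi> t) = A c x \<xi> t) \<and>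
     (\<forall>c\<in>\<A>. \<forall>d\<in>\<A>. \<forall>x\<in>chart_dom c \<inter> chart_dom d. \<forall>\<xi> t.
        A c x (transpose (jac c d x) *v \<xi>) t = transpose (jac c d x) ** A d x \<xi> t ** jac c d x)"

definition smooth_pos_scalar :: "('m, 'n::finite) chart set \<Rightarrow> ('m, 'n) scalar_data \<Rightarrow> bool" where
  "smooth_pos_scalar \<A> \<phi> \<longleftrightarrow>
     (\<forall>c\<in>\<A>. smooth_on (chart_img c \<times> UNIV \<times> UNIV) (\<lambda>(y, \<xi>, t). \<phi> c (chart_inv c y) \<xi> t)) \<and>
     (\<forall>c\<in>\<A>. \<forall>x\<in>chart_dom c. \<forall>\<xi> t. \<phi> c x \<xi> t > 0) \<and>
     (\<forall>c\<in>\<A>. \<forall>d\<in>\<A>. \<forall>x\<in>chart_dom c \<inter> chart_dom d. \<forall>\<xi> t.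
        \<phi> c x (transpose (jac c d x) *v \<xi>) t = \<phi> d x \<xi> t)"


section \<open>Differential, Hessian, norms and eigenvalues with respect to the metric\<close>

definition diff_form :: "('m, 'n::finite) chart \<Rightarrow> ('m \<Rightarrow> real) \<Rightarrow> 'm \<Rightarrow> real^'n" where
  "diff_form c u x = (\<chi> j. pd j (u \<circ> chart_inv c) (chart_map c x))"

definition christoffel ::
  "('m, 'n::finite) field2 \<Rightarrow> ('m, 'n) chart \<Rightarrow> 'm \<Rightarrow> 'n \<Rightarrow> 'n \<Rightarrow> 'n \<Rightarrow> real" where
  "christoffel g c x l j k =
     (let dg = (\<lambda>i a b. pd i (\<lambda>y. g c (chart_inv c y) $ a $ b) (chart_map c x))
      in (1/2) * (\<Sum>m\<in>UNIV. matrix_inv (g c x) $ l $ m * (dg j m k + dg k m j - dg m j k)))"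

definition hessian ::
  "('m, 'n::finite) field2 \<Rightarrow> ('m, 'n) chart \<Rightarrow> ('m \<Rightarrow> real) \<Rightarrow> 'm \<Rightarrow> real^'n^'n" where
  "hessian g c u x =
     (\<chi> j k. pd j (pd k (u \<circ> chart_inv c)) (chart_map c x)
        - (\<Sum>l\<in>UNIV. christoffel g c x l j k * diff_form c u x $ l))"

definition conorm :: "('m, 'n::finite) field2 \<Rightarrow> ('m, 'n) chart \<Rightarrow> 'm \<Rightarrow> real^'n \<Rightarrow> real" where
  "conorm g c x \<xi> = sqrt (\<Sum>j\<in>UNIV. \<Sum>k\<in>UNIV. matrix_inv (g c x) $ j $ k * \<xi> $ j * \<xi> $ k)"

definition lam ::
  "('m, 'n::{finite,linorder}) field2 \<Rightarrow> ('m, 'n) chart \<Rightarrow> 'm \<Rightarrow> 'n rmat \<Rightarrow> 'n rvec" where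
  "lam g c x B = eigvals (matrix_inv (g c x) ** B)"

text \<open>The components of \<open>A(du, u) + \<nabla>\<^sup>2 u\<close>.\<close>

definition Ahess ::
  "('m, 'n::finite) field2 \<Rightarrow> ('m, 'n) bilin_data \<Rightarrow> ('m, 'n) chart \<Rightarrow> ('m \<Rightarrow> real) \<Rightarrow> 'm \<Rightarrow> real^'n^'n"
  where
  "Ahess g A c u x = A c x (diff_form c u x) (u x) + hessian g c u x"


section \<open>The general $p$-Hessian equation\<close>

text \<open>Statements about a point in arbitrary local coordinates are quantified over all charts of the
  atlas around that point.\<close>

definition solution ::
  "('m, 'n::{finite,linorder}) chart set \<Rightarrow> ('m, 'n) field2 \<Rightarrow> nat \<Rightarrow> ('m, 'n) bilin_data
     \<Rightarrow> ('m, 'n) scalar_data \<Rightarrow> ('m \<Rightarrow> real) \<Rightarrow> bool" where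
  "solution \<A> g p A \<phi> u \<longleftrightarrow> C2_fun \<A> u \<and>
     (\<forall>c\<in>\<A>. \<forall>x\<in>chart_dom c.
        root p (esym p (lam g c x (Ahess g A c u x))) = \<phi> c x (diff_form c u x) (u x) \<and>
        lam g c x (Ahess g A c u x) \<in> Gamma_cone p)"

definition C_subsolution ::
  "('m, 'n::{finite,linorder}) chart set \<Rightarrow> ('m, 'n) field2 \<Rightarrow> nat \<Rightarrow> ('m, 'n) bilin_data
     \<Rightarrow> ('m \<Rightarrow> real) \<Rightarrow> ('m \<Rightarrow> real) \<Rightarrow> bool" where
  "C_subsolution \<A> g p A \<phi>\<^sub>0 w \<longleftrightarrow> C2_fun \<A> w \<and>
     (\<exists>\<delta>>0. \<exists>R>0. \<forall>c\<in>\<A>. \<forall>x\<in>chart_dom c.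
        {\<mu>. \<mu> \<in> Gamma_cone p \<and> root p (esym p \<mu>) = \<phi>\<^sub>0 x}
          \<inter> ({lam g c x (Ahess g A c w x) - \<delta> *\<^sub>R (\<chi> i. 1)} + Gamma_cone CARD('n))
        \<subseteq> ball 0 R)"

text \<open>The matrix \<open>F\<^sup>j\<^sup>k\<close>: partial derivatives with respect to the matrix entry \<open>b\<^sub>j\<^sub>k\<close>, i.e. in the
  direction of the matrix unit \<open>axis j (axis k 1)\<close>.\<close>

definition Fmat ::
  "('m, 'n::{finite,linorder}) field2 \<Rightarrow> nat \<Rightarrow> ('m, 'n) bilin_data \<Rightarrow> ('m, 'n) chart
     \<Rightarrow> ('m \<Rightarrow> real) \<Rightarrow> 'm \<Rightarrow> 'n rmat" where
  "Fmat g p A c u x =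
     (\<chi> j k. frechet_derivative
        (\<lambda>B. root p (esym p (eigvals ((1/2) *\<^sub>R (matrix_inv (g c x) ** (B + transpose B))))))
        (at (Ahess g A c u x)) (axis j (axis k 1)))"

definition contract :: "real^'n^'n \<Rightarrow> real^'n^'n \<Rightarrow> real" where
  "contract F B = (\<Sum>j\<in>UNIV. \<Sum>k\<in>UNIV. F $ j $ k * B $ j $ k)"

text \<open>The suprema are attained, as \<open>\<M>\<close> is compact; the second one runs over all points of \<open>\<M>\<close>
  and all charts around them.\<close>

definition C1_size ::
  "('m, 'n::finite) chart set \<Rightarrow> ('m, 'n) field2 \<Rightarrow> ('m \<Rightarrow> real) \<Rightarrow> real" where
  "C1_size \<A> g u = (SUP x. \<bar>u x\<bar>)
     + (SUP (c, x)\<in>(SIGMA c:\<A>. chart_dom c). conorm g c x (diff_form c u x))"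

definition pseudo_subsolution_cond ::
  "('m, 'n::{finite,linorder}) chart set \<Rightarrow> ('m, 'n) field2 \<Rightarrow> nat \<Rightarrow> ('m, 'n) bilin_data
     \<Rightarrow> ('m, 'n) scalar_data \<Rightarrow> ('m \<Rightarrow> real) \<Rightarrow> bool" where
  "pseudo_subsolution_cond \<A> g p A \<phi> w \<longleftrightarrow>
     (\<forall>C\<ge>0. \<exists>\<delta>\<^sub>1>0. \<exists>M\<^sub>1\<ge>0. \<forall>u. solution \<A> g p A \<phi> u \<and> C1_size \<A> g u \<le> C \<longrightarrow>
        (\<forall>c\<in>\<A>. \<forall>x\<in>chart_dom c.
           contract (Fmat g p A c u x) (hessian g c (\<lambda>z. w z - u z) x)
           + contract (Fmat g p A c u x)
               (\<chi> j k. frechet_derivative (\<lambda>\<xi>. A c x \<xi> (u x) $ j $ k) (at (diff_form c u x))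
                          (diff_form c (\<lambda>z. w z - u z) x))
           \<ge> \<delta>\<^sub>1 * contract (Fmat g p A c u x) (g c x)
              - M\<^sub>1 * min_eigval (Fmat g p A c u x ** g c x) - M\<^sub>1))"

definition pseudo_supersolution_cond ::
  "('m, 'n::{finite,linorder}) chart set \<Rightarrow> ('m, 'n) field2 \<Rightarrow> nat \<Rightarrow> ('m, 'n) bilin_data
     \<Rightarrow> ('m, 'n) scalar_data \<Rightarrow> ('m \<Rightarrow> real) \<Rightarrow> bool" where
  "pseudo_supersolution_cond \<A> g p A \<phi> w \<longleftrightarrow>
     (\<exists>\<delta>\<^sub>2>0. \<exists>M\<^sub>2\<ge>0. \<forall>u. solution \<A> g p A \<phi> u \<longrightarrow>
        (\<forall>c\<in>\<A>. \<forall>x\<in>chart_dom c.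
           lam g c x (hessian g c (\<lambda>z. u z - w z) x) + \<delta>\<^sub>2 *\<^sub>R (\<chi> i. 1) \<in> closure (Gamma_cone CARD('n)) \<and>
           conorm g c x (diff_form c (\<lambda>z. u z - w z) x) \<le> \<delta>\<^sub>2 \<longrightarrow>
           esym CARD('n) (lam g c x (\<delta>\<^sub>2 *\<^sub>R g c x + hessian g c (\<lambda>z. u z - w z) x)) \<le> M\<^sub>2))"

definition pseudo_solution ::
  "('m, 'n::{finite,linorder}) chart set \<Rightarrow> ('m, 'n) field2 \<Rightarrow> nat \<Rightarrow> ('m, 'n) bilin_data
     \<Rightarrow> ('m, 'n) scalar_data \<Rightarrow> ('m \<Rightarrow> real) \<Rightarrow> bool" where
  "pseudo_solution \<A> g p A \<phi> w \<longleftrightarrow> C2_fun \<A> w \<and>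
     pseudo_subsolution_cond \<A> g p A \<phi> w \<and> pseudo_supersolution_cond \<A> g p A \<phi> w"

end

theory Submission
  imports Defs "HOL-Computational_Algebra.Fundamental_Theorem_Algebra"
begin

text \<open>The two conditions on a pseudo-solution are inequalities at single points, up to the uniformity of
  their constants.  Fix a point and a chart; let \<open>G\<close> be the matrix of the metric, \<open>B\<^sub>u\<close> and \<open>B\<^sub>w\<close> the
  matrices of \<open>A(du) + \<nabla>\<^sup>2 u\<close> and \<open>A(dw) + \<nabla>\<^sup>2 w\<close> for a solution \<open>u\<close> and the \<open>\<C>\<close>-subsolution \<open>w\<close>, let
  \<open>f(B)\<close> be the \<open>p\<close>-th root of \<open>\<sigma>\<^sub>p\<close> of the eigenvalues of \<open>G\<inverse> B\<close>, and \<open>F\<close> its derivative at \<open>B\<^sub>u\<close>.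

  The analytic core is Garding's theory of the cone on which \<open>f\<close> is defined.  In an orthonormal frame,
  \<open>f\<close> is the \<open>p\<close>-th root of the sum \<open>E\<close> of the principal \<open>p\<close>-minors.  For \<open>B\<close> in the cone and every
  symmetric \<open>X\<close>, the polynomial \<open>t \<mapsto> E(X + t B)\<close> has only real roots (\<open>pcone_hyperbolic\<close>), and these are
  negative if \<open>X\<close> lies in the cone (\<open>pcone_direction_roots\<close>); both facts follow from the identity direction
  by moving the polynomial while its roots cannot cross a line (\<open>roots_stay_in_half_plane\<close>).  The inequality
  of the arithmetic and the geometric mean for these roots becomes \<open>\<langle>F, M\<rangle> \<ge> f(M)\<close> for all \<open>M\<close> in the cone
  (\<open>garding_inequality\<close>), while \<open>\<langle>F, B\<^sub>u\<rangle> = f(B\<^sub>u)\<close> by homogeneity.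

  For the first condition, let \<open>v\<close> be a unit eigenvector of \<open>F G\<close> for its least eigenvalue and put
  \<open>B' = B\<^sub>w - (\<delta>/2) G + N (G v)(G v)\<^sup>T\<close>.  If \<open>N\<close> is large, then \<open>B'\<close> lies in the cone and \<open>f(B') \<ge> f(B\<^sub>u)\<close>: otherwise
  adding a multiple of \<open>G\<close> would give an admissible matrix with exactly the value \<open>f(B\<^sub>u)\<close>, whose eigenvalues
  lie above those of the lowered subsolution and are therefore bounded by \<open>R\<close>, although one of them
  is about \<open>N\<close> (\<open>raised_subsolution_in_cone\<close>).  Hence \<open>\<langle>F, B'\<rangle> \<ge> f(B') \<ge> \<langle>F, B\<^sub>u\<rangle>\<close>, which is the required inequality
  for \<open>B\<^sub>w - B\<^sub>u\<close>, with \<open>N\<close> as the factor of the least eigenvalue.  By concavity, the linearisation of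
  \<open>A\<close> at \<open>du\<close> lies above \<open>A(dw)\<close>, and \<open>F\<close> is nonnegative on nonnegative forms.

  For the second condition, \<open>\<nabla>\<^sup>2(u - w) \<ge> - \<delta>\<^sub>2 G\<close> and the smallness of \<open>du - dw\<close> give \<open>B\<^sub>u \<ge> B\<^sub>w - \<delta>' G\<close> with
  \<open>\<delta>' < \<delta>\<close>.  By Weyl's monotonicity principle (\<open>eigvals_mono\<close>) the subsolution property again bounds the
  eigenvalues of \<open>B\<^sub>u\<close> by \<open>R\<close>, and thereby \<open>\<nabla>\<^sup>2(u - w)\<close> from above.

  Beyond this, only a lower bound for \<open>B\<^sub>w\<close> and the continuity of \<open>A\<close> near \<open>dw\<close> have to be uniform.  Both come
  from compactness: they are established near every point in one chart and carried to all the
  other charts by the tensorial transformation law of the Hessian (\<open>change_of_chart\<close>).\<close>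

section \<open>Principal minors\<close>

text \<open>Up to sign, these are the coefficients of the characteristic polynomial.  The expansion into principal
  minors makes sense over every commutative ring; real, complex and polynomial matrices are
  all needed below.\<close>

definition pminors :: "nat \<Rightarrow> 'a::comm_ring_1^'n^'n \<Rightarrow> 'a" where
  "pminors p M = (\<Sum>J | J \<subseteq> UNIV \<and> card J = p.
     \<Sum>\<sigma> | \<sigma> permutes J. of_int (sign \<sigma>) * (\<Prod>i\<in>J. M $ i $ \<sigma> i))"

text \<open>Every row of the determinant is split into the row of \<open>M\<close> and that of \<open>mat z\<close>.  If \<open>J\<close> is the set of rows
  taken from \<open>M\<close>, only the permutations of \<open>J\<close> survive.\<close>

lemma det_shift_eq_pminors:
  fixes M :: "'a::comm_ring_1^'n^'n"
  shows "det (mat z + M) = (\<Sum>q\<le>CARD('n). z ^ (CARD('n) - q) * pminors q M)"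
proof -
  have "det (mat z + M) = (\<Sum>\<sigma> | \<sigma> permutes UNIV. \<Sum>J\<in>Pow UNIV.
      of_int (sign \<sigma>) * ((\<Prod>i\<in>J. M $ i $ \<sigma> i) * (\<Prod>i\<in>UNIV - J. if i = \<sigma> i then z else 0)))"
    unfolding det_def
    by (simp add: mat_def prod_add sum_distrib_left add.commute[of "(if _ then _ else _)"])
  also have "\<dots> = (\<Sum>J\<in>Pow UNIV. \<Sum>\<sigma> | \<sigma> permutes (UNIV::'n set). 
      of_int (sign \<sigma>) * ((\<Prod>i\<in>J. M $ i $ \<sigma> i) * (\<Prod>i\<in>UNIV - J. if i = \<sigma> i then z else 0)))"
    by (rule sum.swap)
  also have "\<dots> = (\<Sum>J\<in>Pow UNIV. z ^ (CARD('n) - card J) *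
      (\<Sum>\<sigma> | \<sigma> permutes J. of_int (sign \<sigma>) * (\<Prod>i\<in>J. M $ i $ \<sigma> i)))"
  proof (rule sum.cong[OF refl])
    fix J :: "'n set"
    have "(\<Sum>\<sigma> | \<sigma> permutes (UNIV::'n set). 
        of_int (sign \<sigma>) * ((\<Prod>i\<in>J. M $ i $ \<sigma> i) * (\<Prod>i\<in>UNIV - J. if i = \<sigma> i then z else 0)))
      = (\<Sum>\<sigma> | \<sigma> permutes J. 
        of_int (sign \<sigma>) * ((\<Prod>i\<in>J. M $ i $ \<sigma> i) * (\<Prod>i\<in>UNIV - J. if i = \<sigma> i then z else 0)))"
    proof (rule sum.mono_neutral_right)
      show "finite {\<sigma>. \<sigma> permutes (UNIV::'n set)}" by (simp add: finite_permutations)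
      show "{\<sigma>. \<sigma> permutes J} \<subseteq> {\<sigma>. \<sigma> permutes UNIV}" by (auto intro: permutes_subset)
      show "\<forall>\<sigma>\<in>{\<sigma>. \<sigma> permutes UNIV} - {\<sigma>. \<sigma> permutes J}. of_int (sign \<sigma>) *
        ((\<Prod>i\<in>J. M $ i $ \<sigma> i) * (\<Prod>i\<in>UNIV - J. if i = \<sigma> i then z else 0)) = 0"
      proof
        fix \<sigma> :: "'n \<Rightarrow> 'n" assume "\<sigma> \<in> {\<sigma>. \<sigma> permutes UNIV} - {\<sigma>. \<sigma> permutes J}"
        then obtain i where "i \<notin> J" "\<sigma> i \<noteq> i"
          by (auto simp: permutes_def)
        then have "(\<Prod>i\<in>UNIV - J. if i = \<sigma> i then z else 0) = 0"
          by (intro prod_zero) (auto intro!: bexI[of _ i])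
        then show "of_int (sign \<sigma>) *
          ((\<Prod>i\<in>J. M $ i $ \<sigma> i) * (\<Prod>i\<in>UNIV - J. if i = \<sigma> i then z else 0)) = 0" by simp
      qed
    qed
    also have "\<dots> = (\<Sum>\<sigma> | \<sigma> permutes J. 
        z ^ (CARD('n) - card J) * (of_int (sign \<sigma>) * (\<Prod>i\<in>J. M $ i $ \<sigma> i)))"
    proof (rule sum.cong[OF refl])
      fix \<sigma> :: "'n \<Rightarrow> 'n" assume "\<sigma> \<in> {\<sigma>. \<sigma> permutes J}"
      then have "(\<Prod>i\<in>UNIV - J. if i = \<sigma> i then z else 0) = (\<Prod>i\<in>UNIV - J. z)"
        by (intro prod.cong) (auto simp: permutes_def)
      also have "\<dots> = z ^ (CARD('n) - card J)" by (simp add: card_Diff_subset)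
      finally show "of_int (sign \<sigma>) *
          ((\<Prod>i\<in>J. M $ i $ \<sigma> i) * (\<Prod>i\<in>UNIV - J. if i = \<sigma> i then z else 0)) =
          z ^ (CARD('n) - card J) * (of_int (sign \<sigma>) * (\<Prod>i\<in>J. M $ i $ \<sigma> i))"
        by (simp add: mult_ac)
    qed
    finally show "(\<Sum>\<sigma> | \<sigma> permutes (UNIV::'n set). 
        of_int (sign \<sigma>) * ((\<Prod>i\<in>J. M $ i $ \<sigma> i) * (\<Prod>i\<in>UNIV - J. if i = \<sigma> i then z else 0)))
      = z ^ (CARD('n) - card J) *
      (\<Sum>\<sigma> | \<sigma> permutes J. of_int (sign \<sigma>) * (\<Prod>i\<in>J. M $ i $ \<sigma> i))"
      by (simp add: sum_distrib_left)
  qed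
  also have "\<dots> = (\<Sum>q\<le>CARD('n). \<Sum>J\<in>{J\<in>Pow UNIV. card J = q}. z ^ (CARD('n) - card J) *
      (\<Sum>\<sigma> | \<sigma> permutes J. of_int (sign \<sigma>) * (\<Prod>i\<in>J. M $ i $ \<sigma> i)))"
    by (subst sum.group) (auto simp: card_mono)
  also have "\<dots> = (\<Sum>q\<le>CARD('n). z ^ (CARD('n) - q) * pminors q M)"
    unfolding pminors_def
    by (simp add: sum_distrib_left Pow_def)
  finally show ?thesis .
qed

lemma prod_shift_eq_esym:
  fixes \<mu> :: "real^'n" and z :: "'a::{real_algebra_1,comm_ring_1}"
  shows "(\<Prod>i\<in>UNIV. z + of_real (\<mu> $ i)) = (\<Sum>q\<le>CARD('n). z ^ (CARD('n) - q) * of_real (esym q \<mu>))"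
proof -
  have "(\<Prod>i\<in>UNIV. of_real (\<mu> $ i) + z)
      = (\<Sum>J\<in>Pow UNIV. z ^ (CARD('n) - card J) * of_real (\<Prod>i\<in>J. \<mu> $ i))"
    by (simp add: prod_add card_Diff_subset mult.commute)
  also have "\<dots> = (\<Sum>q\<le>CARD('n). \<Sum>J\<in>{J\<in>Pow UNIV. card J = q}.
      z ^ (CARD('n) - card J) * of_real (\<Prod>i\<in>J. \<mu> $ i))"
    by (subst sum.group) (auto simp: card_mono)
  also have "\<dots> = (\<Sum>q\<le>CARD('n). z ^ (CARD('n) - q) * of_real (esym q \<mu>))"
    unfolding esym_def by (simp add: sum_distrib_left Pow_def)
  finally show ?thesis by (simp add: add.commute)
qed

text \<open>Sums of principal minors are always compared through characteristic polynomials, in which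
  \<open>pminors q\<close> is the coefficient of \<open>z ^ (n - q)\<close>.\<close>

lemma top_coeffs_unique:
  fixes a b :: "nat \<Rightarrow> 'a::{idom,real_normed_div_algebra}"
  assumes "\<And>z. (\<Sum>q\<le>n. z ^ (n - q) * a q) = (\<Sum>q\<le>n. z ^ (n - q) * b q)" and "q \<le> n"
  shows "a q = b q"
proof -
  have rev: "(\<Sum>q\<le>n. z ^ (n - q) * c q) = (\<Sum>i\<le>n. c (n - i) * z ^ i)" for z and c :: "nat \<Rightarrow> 'a"
    by (rule sum.reindex_bij_witness[of _ "\<lambda>i. n - i" "\<lambda>i. n - i"]) (auto simp: mult.commute)
  have "\<forall>i\<le>n. a (n - i) = b (n - i)"
    using assms(1) unfolding rev polyfun_eq_coeffs[symmetric] by blast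
  with assms(2) show ?thesis by (metis diff_diff_cancel diff_le_self)
qed

lemma pminors_eq_esym_if_det_splits:
  fixes M :: "real^'n^'n" and \<mu> :: "real^'n"
  assumes "\<And>z. det (mat z - M) = (\<Prod>i\<in>UNIV. z - \<mu> $ i)" and "q \<le> CARD('n)"
  shows "pminors q M = esym q \<mu>"
proof (rule top_coeffs_unique[OF _ assms(2)])
  fix z :: real
  have "mat z + M = (\<chi> i. (-1) *s ((mat (-z) - M) $ i))"
    by (simp add: vec_eq_iff mat_def)
  then have "det (mat z + M) = (-1) ^ CARD('n) * det (mat (-z) - M)"
    using det_rows_mul[of "\<lambda>_. -1" "\<lambda>i. (mat (-z) - M) $ i"] by (simp del: vector_minus_component)
  also have "\<dots> = (\<Prod>i\<in>(UNIV::'n set). -1) * (\<Prod>i\<in>UNIV. - z - \<mu> $ i)"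
    unfolding assms(1) by simp
  also have "\<dots> = (\<Prod>i\<in>UNIV. z + \<mu> $ i)"
    by (subst prod.distrib[symmetric]) (simp add: add.commute)
  finally show "(\<Sum>q\<le>CARD('n). z ^ (CARD('n) - q) * pminors q M)
    = (\<Sum>q\<le>CARD('n). z ^ (CARD('n) - q) * esym q \<mu>)"
    unfolding det_shift_eq_pminors using prod_shift_eq_esym[of z \<mu>] by simp
qed

lemma pminors_0 [simp]: "pminors 0 M = 1"
proof -
  have "{J::'b set. J \<subseteq> UNIV \<and> card J = 0} = {{}}" by auto
  moreover have "{\<sigma>::'b \<Rightarrow> 'b. \<sigma> permutes {}} = {id}" by (auto simp: permutes_empty)
  ultimately show ?thesis by (simp add: pminors_def sign_id)
qed

lemma pminors_scale:
  "pminors p (\<chi> i j. z * M $ i $ j) = z ^ p * pminors p M"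
  unfolding pminors_def sum_distrib_left
  by (intro sum.cong refl) (auto simp: prod.distrib mult_ac)

lemma pminors_scaleR:
  fixes M :: "real^'n^'n"
  shows "pminors p (c *\<^sub>R M) = c ^ p * pminors p M"
  using pminors_scale[of p c M] by (simp add: scaleR_vec_def)

text \<open>The Taylor expansion of the characteristic polynomial at \<open>r\<close>.  Its coefficients are nonnegative for
  \<open>r \<ge> 0\<close>, so that adding such a multiple of the identity preserves positivity.\<close>

lemma pminors_shift:
  fixes M :: "'a::{real_normed_field}^'n^'n"
  assumes "p \<le> CARD('n)"
  shows "pminors p (mat r + M) =
    (\<Sum>q\<le>p. of_nat ((CARD('n) - q) choose (CARD('n) - p)) * r ^ (p - q) * pminors q M)"
proof (rule top_coeffs_unique[OF _ assms])
  fix z :: 'a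
  let ?n = "CARD('n)"
  have "(\<Sum>p\<le>?n. z ^ (?n - p) * pminors p (mat r + M)) = det (mat z + (mat r + M))"
    by (simp add: det_shift_eq_pminors)
  also have "mat z + (mat r + M) = mat (z + r) + M" by (simp add: vec_eq_iff mat_def)
  also have "det (mat (z + r) + M) = (\<Sum>q\<le>?n. (z + r) ^ (?n - q) * pminors q M)"
    by (simp add: det_shift_eq_pminors)
  also have "\<dots> = (\<Sum>q\<le>?n. \<Sum>p\<in>{q..?n}.
      z ^ (?n - p) * (of_nat ((?n - q) choose (?n - p)) * r ^ (p - q) * pminors q M))"
  proof (rule sum.cong[OF refl])
    fix q assume "q \<in> {..?n}"
    then have q: "q \<le> ?n" by simp
    have "(z + r) ^ (?n - q) = (\<Sum>k\<le>?n - q. of_nat ((?n - q) choose k) * z ^ k * r ^ (?n - q - k))"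
      by (rule binomial_ring)
    also have "\<dots> = (\<Sum>p\<in>{q..?n}. z ^ (?n - p) * (of_nat ((?n - q) choose (?n - p)) * r ^ (p - q)))"
      using q by (intro sum.reindex_bij_witness[of _ "\<lambda>p. ?n - p" "\<lambda>k. ?n - k"]) (auto simp: mult_ac diff_diff_eq add.commute)
    finally show "(z + r) ^ (?n - q) * pminors q M = (\<Sum>p\<in>{q..?n}.
      z ^ (?n - p) * (of_nat ((?n - q) choose (?n - p)) * r ^ (p - q) * pminors q M))"
      by (simp add: sum_distrib_right mult.assoc)
  qed
  also have "\<dots> = (\<Sum>p\<le>?n. \<Sum>q\<le>p.
      z ^ (?n - p) * (of_nat ((?n - q) choose (?n - p)) * r ^ (p - q) * pminors q M))"
    unfolding sum.Sigma[OF finite_atMost ballI[OF finite_atLeastAtMost]]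
      sum.Sigma[OF finite_atMost ballI[OF finite_atMost]]
    by (rule sum.reindex_bij_witness[of _ "\<lambda>(a,b). (b,a)" "\<lambda>(a,b). (b,a)"]) auto
  finally show "(\<Sum>p\<le>?n. z ^ (?n - p) * pminors p (mat r + M)) =
    (\<Sum>p\<le>?n. z ^ (?n - p) *
      (\<Sum>q\<le>p. of_nat ((?n - q) choose (?n - p)) * r ^ (p - q) * pminors q M))"
    by (simp add: sum_distrib_left)
qed

lemma matrix_plus_rdistrib: "(A + B) ** C = A ** C + B ** (C :: real^'k^'n)" for A :: "real^'n^'m"
  by (simp add: vec_eq_iff matrix_matrix_mult_def sum.distrib algebra_simps)

lemma matrix_minus_ldistrib: "A ** (B - C) = A ** B - A ** (C :: real^'k^'n)" for A :: "real^'n^'m"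
  by (simp add: vec_eq_iff matrix_matrix_mult_def sum_subtractf algebra_simps)

lemma matrix_minus_rdistrib: "(A - B) ** C = A ** C - B ** (C :: real^'k^'n)" for A :: "real^'n^'m"
  by (simp add: vec_eq_iff matrix_matrix_mult_def sum_subtractf algebra_simps)

lemma inner_matrix_mult_left: "x \<bullet> (A *v y) = (transpose A *v x) \<bullet> y" for A :: "real^'n^'m"
  by (metis dot_lmul_matrix transpose_matrix_vector)

lemma det_mat_minus_similar:
  fixes M P P' :: "real^'n^'n"
  assumes "P ** P' = mat 1"
  shows "det (mat z - P ** M ** P') = det (mat z - M)"
proof -
  have "P ** (mat z - M) ** P' = P ** mat z ** P' - P ** M ** P'"
    by (simp add: matrix_mul_assoc matrix_minus_ldistrib matrix_minus_rdistrib)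
  also have "P ** mat z ** P' = mat z"
  proof -
    have "mat z = z *\<^sub>R (mat 1 :: real^'n^'n)" by (simp add: vec_eq_iff mat_def)
    then show ?thesis using assms
      by (metis matrix_mul_rid matrix_scalar_ac scalar_matrix_assoc)
  qed
  finally have "det (mat z - P ** M ** P') = det P * det (mat z - M) * det P'"
    by (metis det_mul)
  also have "\<dots> = det (P ** P') * det (mat z - M)" by (simp add: det_mul)
  finally show ?thesis using assms by simp
qed


section \<open>The spectral theorem for real symmetric matrices\<close>

lemma linear_term_vanishes_if_quadratic_nonpos:
  fixes a b :: real
  assumes "\<And>t. 2 * t * a + t\<^sup>2 * b \<le> 0"
  shows "a = 0"
proof (rule ccontr)
  assume a: "a \<noteq> 0"
  define t where "t = a / (\<bar>b\<bar> + 1)"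
  have ta: "t * (\<bar>b\<bar> + 1) = a" by (simp add: t_def)
  have "t * t * (- b) \<le> t * t * \<bar>b\<bar>" by (intro mult_left_mono) auto
  moreover have "t * a = t * t * \<bar>b\<bar> + t * t" by (simp flip: ta add: algebra_simps)
  moreover have "t \<noteq> 0" using a by (simp add: t_def)
  then have "t * t > 0" by (auto simp: zero_less_mult_iff linorder_neq_iff)
  moreover have "t * t * \<bar>b\<bar> \<ge> 0" by simp
  ultimately show False using assms[of t] unfolding power2_eq_square by linarith
qed

text \<open>A maximiser of the Rayleigh quotient on the unit sphere of an invariant subspace is an
  eigenvector, and its orthogonal complement is again invariant.\<close>

lemma orthonormal_eigenbasis_of_invariant_subspace:
  fixes S :: "real^'n^'n"
  assumes S: "transpose S = S" and "subspace V" and "\<And>x. x \<in> V \<Longrightarrow> S *v x \<in> V"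
  shows "\<exists>B\<subseteq>V. finite B \<and> card B = dim V \<and> pairwise orthogonal B \<and>
    (\<forall>b\<in>B. norm b = 1 \<and> S *v b = (b \<bullet> (S *v b)) *\<^sub>R b)"
  using assms(2,3)
proof (induction "dim V" arbitrary: V)
  case 0
  then show ?case by (intro exI[of _ "{}"]) auto
next
  case (Suc d)
  have sym: "x \<bullet> (S *v y) = (S *v x) \<bullet> y" for x y
    using inner_matrix_mult_left[of x S y] S by simp
  have "V \<noteq> {0}" using Suc.hyps(2) by auto
  then obtain v where v: "v \<in> V" "v \<noteq> 0" using subspace_0[OF Suc.prems(1)] by blast
  then have "v /\<^sub>R norm v \<in> V \<inter> sphere 0 1"
    using Suc.prems(1) by (auto simp: subspace_scale)
  moreover have "compact (V \<inter> sphere 0 1)"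
    by (simp add: closed_subspace Suc.prems(1) closed_Int_compact)
  ultimately obtain e where e: "e \<in> V" "norm e = 1"
    and max: "\<And>x. x \<in> V \<Longrightarrow> norm x = 1 \<Longrightarrow> x \<bullet> (S *v x) \<le> e \<bullet> (S *v e)"
  proof -
    assume *: "v /\<^sub>R norm v \<in> V \<inter> sphere 0 1" "compact (V \<inter> sphere 0 1)"
      and that: "\<And>e. e \<in> V \<Longrightarrow> norm e = 1 \<Longrightarrow>
        (\<And>x. x \<in> V \<Longrightarrow> norm x = 1 \<Longrightarrow> x \<bullet> (S *v x) \<le> e \<bullet> (S *v e)) \<Longrightarrow> thesis"
    have "continuous_on (V \<inter> sphere 0 1) (\<lambda>x. x \<bullet> (S *v x))"
      by (intro continuous_intros)
    with *(1) obtain e where "e \<in> V \<inter> sphere 0 1"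
      "\<forall>x\<in>V \<inter> sphere 0 1. x \<bullet> (S *v x) \<le> e \<bullet> (S *v e)"
      using continuous_attains_sup[OF *(2)] by blast
    then show thesis by (intro that[of e]) auto
  qed
  define l where "l = e \<bullet> (S *v e)"
  have ee: "e \<bullet> e = 1" using e by (simp add: norm_eq_1)
  have ray: "x \<bullet> (S *v x) \<le> l * (x \<bullet> x)" if "x \<in> V" for x
  proof (cases "x = 0")
    case False
    have "(x /\<^sub>R norm x) \<bullet> (S *v (x /\<^sub>R norm x)) \<le> l"
      unfolding l_def using False that Suc.prems(1) by (intro max) (auto simp: subspace_scale)
    then have "(x \<bullet> (S *v x)) / (x \<bullet> x) \<le> l"
      by (simp add: matrix_vector_mult_scaleR field_simps flip: power2_norm_eq_inner power2_eq_square)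
    then show ?thesis using False by (simp add: field_simps)
  qed simp
  define r where "r = S *v e - l *\<^sub>R e"
  have rV: "r \<in> V" unfolding r_def
    by (intro subspace_diff subspace_scale Suc.prems e)
  \<comment> \<open>the first-order condition at the maximiser \<open>e\<close>, in the direction of its own residual \<open>r\<close>\<close>
  have "r \<bullet> r = 0"
  proof (rule linear_term_vanishes_if_quadratic_nonpos)
    fix t :: real
    have "(e + t *\<^sub>R r) \<bullet> (S *v (e + t *\<^sub>R r)) \<le> l * ((e + t *\<^sub>R r) \<bullet> (e + t *\<^sub>R r))"
      by (intro ray subspace_add subspace_scale Suc.prems e rV)
    moreover have e1: "(e + t *\<^sub>R r) \<bullet> (S *v (e + t *\<^sub>R r))
        = l + 2 * t * (r \<bullet> (S *v e)) + t\<^sup>2 * (r \<bullet> (S *v r))"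
      using sym[of e r] ee
      by (simp add: matrix_vector_right_distrib matrix_vector_mult_scaleR inner_add_left inner_add_right
        l_def[symmetric] inner_commute power2_eq_square algebra_simps)
    moreover have e2: "(e + t *\<^sub>R r) \<bullet> (e + t *\<^sub>R r) = 1 + 2 * t * (r \<bullet> e) + t\<^sup>2 * (r \<bullet> r)"
      using ee by (simp add: inner_add_left inner_add_right inner_commute power2_eq_square)
    ultimately have "l + 2 * t * (r \<bullet> (S *v e)) + t\<^sup>2 * (r \<bullet> (S *v r))
      \<le> l * (1 + 2 * t * (r \<bullet> e) + t\<^sup>2 * (r \<bullet> r))" by (simp only: e1 e2)
    moreover have rr: "r \<bullet> (S *v e) = r \<bullet> r + l * (r \<bullet> e)"
      unfolding r_def by (simp add: inner_diff_right)
    ultimately show "2 * t * (r \<bullet> r) + t\<^sup>2 * (r \<bullet> (S *v r) - l * (r \<bullet> r)) \<le> 0"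
      by (simp only: rr) (simp add: algebra_simps)
  qed
  then have Se: "S *v e = l *\<^sub>R e" by (simp add: r_def)
  define W where "W = {y \<in> V. \<forall>x\<in>span {e}. orthogonal x y}"
  have W: "W = {y \<in> V. e \<bullet> y = 0}"
    by (auto simp: W_def span_singleton orthogonal_def)
  have "dim W + dim (span {e}) = dim V"
    unfolding W_def using e Suc.prems(1) by (intro dim_subspace_orthogonal_to_vectors) (auto simp: span_minimal)
  moreover have "dim (span {e}) = 1" using e by (auto simp: dim_insert)
  ultimately have "d = dim W" using Suc.hyps(2) by simp
  moreover have "subspace W" using Suc.prems(1)
    by (auto simp: W subspace_def inner_add_right)
  moreover have "S *v x \<in> W" if "x \<in> W" for x
    using that Suc.prems(2) by (simp add: W sym Se)
  ultimately obtain B where B: "B \<subseteq> W" "finite B" "card B = dim W" "pairwise orthogonal B"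
    "\<forall>b\<in>B. norm b = 1 \<and> S *v b = (b \<bullet> (S *v b)) *\<^sub>R b"
    using Suc.hyps(1) by blast
  have "e \<notin> B" using B(1) ee by (auto simp: W)
  then show ?case
    using B e Se ee \<open>d = dim W\<close> Suc.hyps(2)
    by (intro exI[of _ "insert e B"])
      (auto simp: W pairwise_insert orthogonal_def inner_commute)
qed

text \<open>The entries of \<open>eigvals\<close> are indexed by the linearly ordered type \<open>'n\<close> and have to be sorted accordingly.\<close>

lemma monotone_enumeration_of_finite_set:
  fixes e :: "'n::{finite,linorder} \<Rightarrow> 'b" and f :: "'b \<Rightarrow> real"
  assumes e: "bij_betw e UNIV B"
  obtains h :: "'n \<Rightarrow> 'b" where "bij_betw h UNIV B" "mono (\<lambda>i. f (h i))"
proof -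
  have B: "finite B" "card B = CARD('n)"
    using bij_betw_finite[OF e] bij_betw_same_card[OF e] by auto
  define xs where "xs = sorted_list_of_set (UNIV :: 'n set)"
  have xs: "distinct xs" "set xs = UNIV" "sorted xs" "length xs = CARD('n)"
    unfolding xs_def by auto
  obtain bs0 where bs0: "set bs0 = B" "distinct bs0"
    using finite_distinct_list[OF B(1)] by blast
  define bs where "bs = sort_key f bs0"
  have bs: "set bs = B" "distinct bs" "sorted (map f bs)" "length bs = CARD('n)"
    using bs0 B by (auto simp: bs_def distinct_card)
  define pos where "pos i = (THE k. k < CARD('n) \<and> xs ! k = i)" for i
  have pos: "pos i < CARD('n)" "xs ! pos i = i" for i
  proof -
    have "\<exists>!k. k < CARD('n) \<and> xs ! k = i"
      using xs by (metis UNIV_I distinct_Ex1)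
    from theI'[OF this] show "pos i < CARD('n)" "xs ! pos i = i" by (auto simp: pos_def)
  qed
  have pos_mono: "pos i \<le> pos j" if "i \<le> j" for i j
    using that pos xs by (metis antisym linorder_not_le order_less_imp_le sorted_nth_mono)
  have "bij_betw pos UNIV {..<CARD('n)}"
  proof (rule bij_betw_imageI)
    show "inj pos" by (metis injI pos(2))
    then show "range pos = {..<CARD('n)}"
      by (intro card_subset_eq) (auto simp: pos(1) card_image)
  qed
  moreover have "bij_betw ((!) bs) {..<CARD('n)} B"
    using bs by (metis bij_betw_nth)
  ultimately have "bij_betw ((!) bs \<circ> pos) UNIV B" by (rule bij_betw_trans)
  moreover have "mono (\<lambda>i. f (((!) bs \<circ> pos) i))"
  proof (rule monoI)
    fix i j :: 'n assume "i \<le> j"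
    then show "f (((!) bs \<circ> pos) i) \<le> f (((!) bs \<circ> pos) j)"
      using sorted_nth_mono[OF bs(3) pos_mono] pos(1) bs(4) by simp
  qed
  ultimately show ?thesis using that by blast
qed

text \<open>Uniqueness in the definition of \<open>eigvals\<close>: both families list the roots of the same polynomial in
  increasing order.\<close>

lemma mono_family_determined_by_prod:
  fixes \<mu> \<nu> :: "'n::{finite,linorder} rvec"
  assumes "mono (\<lambda>i. \<mu> $ i)" "mono (\<lambda>i. \<nu> $ i)"
    and "\<And>z. (\<Prod>i\<in>UNIV. z - \<mu> $ i) = (\<Prod>i\<in>UNIV. z - \<nu> $ i)"
  shows "\<mu> = \<nu>"
proof -
  define xs where "xs = sorted_list_of_set (UNIV :: 'n set)"
  have xs: "distinct xs" "set xs = UNIV" "sorted xs"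
    unfolding xs_def by auto
  have roots: "proots (\<Prod>i\<in>UNIV. [:- (\<mu> $ i), 1:]) = mset (map (\<lambda>i. \<mu> $ i) xs)"
    for \<mu> :: "'n rvec"
    using xs by (subst proots_prod) (auto simp: sum_unfold_sum_mset mset_set_set[symmetric])
  have "(\<Prod>i\<in>UNIV. [:- (\<mu> $ i), 1:]) = (\<Prod>i\<in>UNIV. [:- (\<nu> $ i), 1:])"
    by (intro poly_ext) (use assms(3) in \<open>simp add: poly_prod\<close>)
  then have "mset (map (\<lambda>i. \<mu> $ i) xs) = mset (map (\<lambda>i. \<nu> $ i) xs)"
    by (metis roots)
  moreover have "sorted (map (\<lambda>i. \<mu> $ i) xs)" "sorted (map (\<lambda>i. \<nu> $ i) xs)"
    using assms xs by (auto intro!: sorted_wrt_mono_rel[of xs "(\<le>)"] simp: sorted_map mono_def)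
  ultimately have "map (\<lambda>i. \<mu> $ i) xs = map (\<lambda>i. \<nu> $ i) xs"
    by (metis properties_for_sort)
  then show ?thesis using xs by (auto simp: vec_eq_iff)
qed

definition diagm :: "real^'n \<Rightarrow> real^'n^'n" where
  "diagm \<mu> = (\<chi> i j. if i = j then \<mu> $ i else 0)"

lemma det_mat_minus_diagm: "det (mat z - diagm \<mu>) = (\<Prod>i\<in>UNIV. z - \<mu> $ i)"
  by (subst det_diagonal) (auto simp: diagm_def mat_def)

lemma eigvals_eqI:
  assumes "mono (\<lambda>i. \<mu> $ i)" "\<And>z. det (mat z - M) = (\<Prod>i\<in>UNIV. z - \<mu> $ i)"
  shows "eigvals M = \<mu>"
  unfolding eigvals_def using assms mono_family_determined_by_prod
  by (intro the_equality) auto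

theorem spectral_decomposition:
  fixes S :: "'n::{finite,linorder} rmat"
  assumes "transpose S = S"
  obtains U where "orthogonal_matrix U" "S = U ** diagm (eigvals S) ** transpose U"
    "mono (\<lambda>i. eigvals S $ i)" "\<And>z. det (mat z - S) = (\<Prod>i\<in>UNIV. z - eigvals S $ i)"
proof -
  obtain B :: "'n rvec set" where B: "finite B" "card B = CARD('n)" "pairwise orthogonal B"
    "\<forall>b\<in>B. norm b = 1 \<and> S *v b = (b \<bullet> (S *v b)) *\<^sub>R b"
    using orthonormal_eigenbasis_of_invariant_subspace[OF assms, of UNIV] by auto
  obtain e :: "'n \<Rightarrow> 'n rvec" where e: "bij_betw e UNIV B"
    using finite_same_card_bij[of "UNIV :: 'n set" B] B(1,2) by auto
  obtain h :: "'n \<Rightarrow> 'n rvec" where h: "bij_betw h UNIV B" "mono (\<lambda>i. h i \<bullet> (S *v h i))"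
    using monotone_enumeration_of_finite_set[OF e, of "\<lambda>b. b \<bullet> (S *v b)"] by blast
  define U :: "'n rmat" where "U = transpose (\<chi> i. h i)"
  define \<mu> where "\<mu> = (\<chi> i. h i \<bullet> (S *v h i))"
  have hB: "h i \<in> B" for i using h(1) by (auto simp: bij_betw_def)
  have col: "column j U = h j" for j
    by (simp add: U_def row_def)
  have U: "orthogonal_matrix U"
    unfolding orthogonal_matrix_orthonormal_columns col
    using B(3,4) hB h(1) by (metis bij_betw_def injD pairwise_def)
  have "S ** U = U ** diagm \<mu>"
  proof -
    have "column j (S ** U) = column j (U ** diagm \<mu>)" for j
    proof -
      have "column j (S ** U) = S *v h j"
        by (simp flip: col add: column_def matrix_matrix_mult_def matrix_vector_mult_def)
      also have "\<dots> = \<mu> $ j *\<^sub>R h j" using B(4) hB by (simp add: \<mu>_def)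
      also have "\<dots> = column j (U ** diagm \<mu>)"
        by (simp flip: col add: column_def matrix_matrix_mult_def diagm_def vec_eq_iff
            if_distrib cong: if_cong)
      finally show ?thesis .
    qed
    then show ?thesis by (simp add: column_def vec_eq_iff)
  qed
  then have S: "S = U ** diagm \<mu> ** transpose U"
    using U by (metis matrix_mul_assoc matrix_mul_rid orthogonal_matrix_def)
  have det: "det (mat z - S) = (\<Prod>i\<in>UNIV. z - \<mu> $ i)" for z
    unfolding S using U
    by (subst det_mat_minus_similar) (auto simp: orthogonal_matrix_def det_mat_minus_diagm)
  have mono: "mono (\<lambda>i. \<mu> $ i)" using h(2) by (simp add: \<mu>_def)
  have "eigvals S = \<mu>" by (rule eigvals_eqI[OF mono det])
  from that[of U, unfolded this] U S det mono show ?thesis by blast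
qed

lemma quadratic_form_in_eigenframe:
  "x \<bullet> ((U ** diagm \<mu> ** transpose U) *v x) = (\<Sum>i\<in>UNIV. \<mu> $ i * ((transpose U *v x) $ i)\<^sup>2)"
proof -
  have "x \<bullet> ((U ** diagm \<mu> ** transpose U) *v x) = (transpose U *v x) \<bullet> (diagm \<mu> *v (transpose U *v x))"
    using inner_matrix_mult_left[of x U] by (simp only: matrix_vector_mul_assoc[symmetric])
  also have "\<dots> = (\<Sum>i\<in>UNIV. \<mu> $ i * ((transpose U *v x) $ i)\<^sup>2)"
    by (simp add: inner_vec_def matrix_vector_mult_def diagm_def if_distrib[of "\<lambda>a. a * _"]
      power2_eq_square mult_ac cong: if_cong)
  finally show ?thesis .
qed

lemma inner_orthogonal_matrix:
  fixes U :: "real^'n^'n"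
  assumes "orthogonal_matrix U"
  shows "(transpose U *v x) \<bullet> (transpose U *v y) = x \<bullet> y"
proof -
  have "(transpose U *v x) \<bullet> (transpose U *v y) = x \<bullet> (U *v (transpose U *v y))"
    by (simp only: inner_matrix_mult_left)
  also have "\<dots> = x \<bullet> y"
    using assms by (simp only: matrix_vector_mul_assoc orthogonal_matrix_def matrix_vector_mul_lid)
  finally show ?thesis .
qed

text \<open>Weyl's monotonicity principle.  The vectors spanned by the eigenvectors of the first matrix
  with index at least \<open>k\<close> and those spanned by the eigenvectors of the second one with index at most
  \<open>k\<close> have a common nonzero element, being cut out by only \<open>n - 1\<close> linear equations altogether.\<close>

theorem eigvals_mono:
  fixes S T :: "'n::{finite,linorder} rmat"
  assumes "transpose S = S" "transpose T = T" and le: "\<And>x. x \<bullet> (S *v x) \<le> x \<bullet> (T *v x)"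
  shows "eigvals S $ k \<le> eigvals T $ k"
proof -
  obtain U where U: "orthogonal_matrix U" "S = U ** diagm (eigvals S) ** transpose U"
    "mono (\<lambda>i. eigvals S $ i)" using spectral_decomposition[OF assms(1)] .
  obtain V where V: "orthogonal_matrix V" "T = V ** diagm (eigvals T) ** transpose V"
    "mono (\<lambda>i. eigvals T $ i)" using spectral_decomposition[OF assms(2)] .
  define f :: "'n rvec \<Rightarrow> 'n rvec" where
    "f x = (\<chi> i. if i < k then (transpose U *v x) $ i
      else if i > k then (transpose V *v x) $ i else 0)" for x
  have "linear f"
    by (auto intro!: linearI simp: f_def vec_eq_iff algebra_simps)
  moreover have "\<not> surj f"
  proof
    assume "surj f"
    then obtain x where "f x = axis k 1" by (metis surj_def)
    then have "f x $ k = 1" by simp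
    then show False by (simp add: f_def)
  qed
  ultimately have "\<not> inj f" using linear_injective_imp_surjective by blast
  then obtain x where x: "f x = 0" "x \<noteq> 0"
    using linear_injective_0[OF \<open>linear f\<close>] by blast
  have U0: "(transpose U *v x) $ i = 0" if "i < k" for i
    using x(1) that by (simp add: f_def vec_eq_iff split: if_splits)
  have V0: "(transpose V *v x) $ i = 0" if "i > k" for i
  proof -
    have "f x $ i = 0" by (simp add: x(1))
    then show ?thesis using that by (simp add: f_def not_less_iff_gr_or_eq order_less_imp_not_less split: if_splits)
  qed
  have "eigvals S $ k * (x \<bullet> x) = (\<Sum>i\<in>UNIV. eigvals S $ k * ((transpose U *v x) $ i)\<^sup>2)"
    unfolding inner_orthogonal_matrix[OF U(1), of x x, symmetric]
    by (simp add: inner_vec_def sum_distrib_left power2_eq_square)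
  also have "\<dots> \<le> x \<bullet> (S *v x)"
    unfolding quadratic_form_in_eigenframe[of x U "eigvals S", folded U(2)]
  proof (intro sum_mono)
    fix i
    show "eigvals S $ k * ((transpose U *v x) $ i)\<^sup>2 \<le> eigvals S $ i * ((transpose U *v x) $ i)\<^sup>2"
      using U0[of i] U(3) by (cases "i < k") (auto intro!: mult_right_mono simp: mono_def)
  qed
  also have "\<dots> \<le> x \<bullet> (T *v x)" by (rule le)
  also have "\<dots> \<le> (\<Sum>i\<in>UNIV. eigvals T $ k * ((transpose V *v x) $ i)\<^sup>2)"
    unfolding quadratic_form_in_eigenframe[of x V "eigvals T", folded V(2)]
  proof (intro sum_mono)
    fix i
    show "eigvals T $ i * ((transpose V *v x) $ i)\<^sup>2 \<le> eigvals T $ k * ((transpose V *v x) $ i)\<^sup>2"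
      using V0[of i] V(3) by (cases "i > k") (auto intro!: mult_right_mono simp: mono_def)
  qed
  also have "\<dots> = eigvals T $ k * (x \<bullet> x)"
    unfolding inner_orthogonal_matrix[OF V(1), of x x, symmetric]
    by (simp add: inner_vec_def sum_distrib_left power2_eq_square)
  finally show ?thesis using x(2) by simp
qed

lemma quadratic_form_le_some_eigval:
  fixes S :: "'n::{finite,linorder} rmat"
  assumes "transpose S = S" and "x \<bullet> x = 1"
  shows "\<exists>k. x \<bullet> (S *v x) \<le> eigvals S $ k"
proof (rule ccontr)
  assume *: "\<not> ?thesis"
  obtain U where U: "orthogonal_matrix U" "S = U ** diagm (eigvals S) ** transpose U"
    using spectral_decomposition[OF assms(1)] by metis
  let ?c = "x \<bullet> (S *v x)"
  define y where "y = transpose U *v x"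
  have y: "(\<Sum>i\<in>UNIV. (y $ i)\<^sup>2) = 1"
    using inner_orthogonal_matrix[OF U(1), of x x] assms(2)
    by (simp add: y_def inner_vec_def power2_eq_square)
  have "y \<noteq> 0" using y by auto
  then obtain k where k: "y $ k \<noteq> 0" by (auto simp: vec_eq_iff)
  have "eigvals S $ k * (y $ k)\<^sup>2 < ?c * (y $ k)\<^sup>2"
    using * k by (intro mult_strict_right_mono) (auto simp: not_le)
  moreover have "eigvals S $ i * (y $ i)\<^sup>2 \<le> ?c * (y $ i)\<^sup>2" for i
    using * by (intro mult_right_mono) (auto simp: not_le less_imp_le)
  ultimately have less: "(\<Sum>i\<in>UNIV. eigvals S $ i * (y $ i)\<^sup>2) < (\<Sum>i\<in>UNIV. ?c * (y $ i)\<^sup>2)"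
    by (intro sum_strict_mono_ex1) auto
  have "?c = (\<Sum>i\<in>UNIV. eigvals S $ i * (y $ i)\<^sup>2)"
    unfolding y_def using quadratic_form_in_eigenframe[of x U "eigvals S", folded U(2)] .
  also have "\<dots> < (\<Sum>i\<in>UNIV. ?c * (y $ i)\<^sup>2)"
    by (rule less)
  also have "\<dots> = ?c" using y by (simp flip: sum_distrib_left)
  finally show False by simp
qed

lemma pminors_eq_esym_eigvals:
  fixes S :: "'n::{finite,linorder} rmat"
  assumes "transpose S = S" "q \<le> CARD('n)"
  shows "pminors q S = esym q (eigvals S)"
  using pminors_eq_esym_if_det_splits[OF _ assms(2)] spectral_decomposition[OF assms(1)] by metis

section \<open>Polynomials whose roots lie in a half plane\<close>

lemma poly_pderiv_prod_linear:
  fixes A :: "complex multiset"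
  assumes "z \<notin># A"
  shows "poly (pderiv (\<Prod>a\<in>#A. [:- a, 1:])) z
    = poly (\<Prod>a\<in>#A. [:- a, 1:]) z * (\<Sum>a\<in>#A. 1 / (z - a))"
  using assms
proof (induction A)
  case (add x A)
  define P where "P = (\<Prod>a\<in>#A. [:- a, 1:])"
  have "poly (pderiv ([:- x, 1:] * P)) z = (z - x) * poly (pderiv P) z + poly P z"
    by (simp only: pderiv_mult) (simp add: pderiv_pCons algebra_simps)
  moreover have "poly (pderiv P) z = poly P z * (\<Sum>a\<in>#A. 1 / (z - a))"
    using add by (simp add: P_def)
  moreover have "z \<noteq> x" using add.prems by auto
  moreover have "poly ([:- x, 1:] * P) z = (z - x) * poly P z" by (simp only: poly_mult) simp
  ultimately show ?case
    by (simp only: image_mset_add_mset prod_mset.add_mset sum_mset.add_mset P_def[symmetric])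
      (simp add: field_simps)
qed simp

lemma poly_prod_mset: "poly (\<Prod>a\<in>#A. f a) z = (\<Prod>a\<in>#A. poly (f a) z)"
  by (induction A) auto

lemma complex_poly_factorization:
  fixes f :: "complex poly"
  assumes "f \<noteq> 0"
  obtains A where "size A = degree f" "f = smult (lead_coeff f) (\<Prod>a\<in>#A. [:- a, 1:])"
    "\<And>z. poly f z = lead_coeff f * (\<Prod>a\<in>#A. z - a)" "\<And>a. a \<in># A \<Longrightarrow> poly f a = 0"
proof -
  from alg_closed_imp_factorization[OF assms] obtain A
    where A: "size A = degree f" "f = smult (lead_coeff f) (\<Prod>a\<in>#A. [:- a, 1:])"
    by (elim exE conjE)
  have val: "poly f z = lead_coeff f * (\<Prod>a\<in>#A. z - a)" for z
    by (subst A(2)) (simp add: poly_prod_mset)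
  have "poly f a = 0" if "a \<in># A" for a
    unfolding val using that by auto
  with A val that show ?thesis by metis
qed

text \<open>The logarithmic derivative is a sum of terms \<open>1 / (z - a)\<close>, which have negative imaginary part
  when \<open>z\<close> lies above every root \<open>a\<close>.\<close>

lemma pderiv_roots_in_lower_half_plane:
  fixes f :: "complex poly"
  assumes "degree f \<ge> 1" and roots: "\<And>z. poly f z = 0 \<Longrightarrow> Im z < 0"
    and "poly (pderiv f) z = 0"
  shows "Im z < 0"
proof (rule ccontr)
  assume "\<not> Im z < 0"
  have "f \<noteq> 0" using assms(1) by auto
  from complex_poly_factorization[OF this] obtain A
    where A: "size A = degree f" "f = smult (lead_coeff f) (\<Prod>a\<in>#A. [:- a, 1:])"
      "\<And>a. a \<in># A \<Longrightarrow> poly f a = 0"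
    by metis
  have Im_neg: "Im a < 0" if "a \<in># A" for a
    using roots A(3) that by blast
  then have z: "z \<notin># A" using \<open>\<not> Im z < 0\<close> by auto
  have "Im (1 / (z - a)) < 0" if "a \<in># A" for a
  proof -
    have "Im a < Im z" using Im_neg[OF that] \<open>\<not> Im z < 0\<close> by linarith
    then show ?thesis
      by (simp add: Im_divide divide_neg_pos sum_power2_gt_zero_iff)
  qed
  then have "A \<noteq> {#} \<Longrightarrow> Im (\<Sum>a\<in>#A. 1 / (z - a)) < 0"
  proof (induction A)
    case (add x A)
    then show ?case by (cases "A = {#}") (auto intro: add_neg_neg)
  qed simp
  then have "(\<Sum>a\<in>#A. 1 / (z - a)) \<noteq> 0" using A(1) assms(1) by force
  moreover have "poly (\<Prod>a\<in>#A. [:- a, 1:]) z \<noteq> 0" using z by (auto simp: poly_prod_mset)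
  ultimately have "poly (pderiv f) z \<noteq> 0"
    using \<open>f \<noteq> 0\<close> by (subst A(2)) (simp add: pderiv_smult poly_pderiv_prod_linear[OF z])
  with assms(3) show False by simp
qed

text \<open>The coefficients are, up to factorials, the values at \<open>0\<close> of the derivatives, whose roots remain in the
  open lower half plane.\<close>

lemma coeff_nonzero_if_roots_in_lower_half_plane:
  fixes f :: "complex poly"
  assumes "\<And>z. poly f z = 0 \<Longrightarrow> Im z < 0" "k \<le> degree f"
  shows "coeff f k \<noteq> 0"
  using assms
proof (induction k arbitrary: f)
  case 0
  then show ?case by (metis less_irrefl poly_0_coeff_0 zero_complex.simps(2))
next
  case (Suc k)
  have "coeff (pderiv f) k \<noteq> 0"
  proof (rule Suc.IH)
    show "Im z < 0" if "poly (pderiv f) z = 0" for z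
      using pderiv_roots_in_lower_half_plane[of f z] Suc.prems that by simp
    show "k \<le> degree (pderiv f)" using Suc.prems(2) by (simp add: degree_pderiv)
  qed
  then show ?case by (simp add: coeff_pderiv)
qed

text \<open>Every linear factor satisfies \<open>cmod (z - a) \<ge> L z - L a \<ge> L z\<close>.\<close>

lemma norm_poly_ge_if_roots_in_half_plane:
  fixes f :: "complex poly" and L :: "complex \<Rightarrow> real"
  assumes L: "linear L" "\<And>z. L z \<le> cmod z"
    and "f \<noteq> 0" and roots: "\<And>a. poly f a = 0 \<Longrightarrow> L a < 0" and "L z \<ge> 0"
  shows "cmod (lead_coeff f) * L z ^ degree f \<le> cmod (poly f z)"
proof -
  from complex_poly_factorization[OF assms(3)] obtain A
    where A: "size A = degree f" "\<And>z. poly f z = lead_coeff f * (\<Prod>a\<in>#A. z - a)"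
      "\<And>a. a \<in># A \<Longrightarrow> poly f a = 0"
    by metis
  have "L a < 0" if "a \<in># A" for a
    using roots A(3) that by blast
  then have "L z \<le> cmod (z - a)" if "a \<in># A" for a
    using L(2)[of "z - a"] that by (fastforce simp: linear_diff[OF L(1)])
  then have "L z ^ size A \<le> cmod (\<Prod>a\<in>#A. z - a)"
    using \<open>L z \<ge> 0\<close>
    by (induction A) (auto simp: norm_mult intro!: mult_mono)
  then show ?thesis
    unfolding A(2)[of z] norm_mult A(1) by (intro mult_left_mono) auto
qed

text \<open>The roots of a polynomial cannot cross a line on which the polynomial never vanishes: the
  parameters for which all roots lie on one side form an open set because the roots
  stay bounded, and a closed set because of the lower bound on the other side.\<close>

lemma roots_stay_in_half_plane:
  fixes q :: "real \<Rightarrow> complex poly" and L :: "complex \<Rightarrow> real"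
  assumes L: "linear L" "\<And>z. L z \<le> cmod z"
    and deg: "\<And>\<tau>. degree (q \<tau>) \<le> p" "\<And>\<tau>. coeff (q \<tau>) p = c" "c \<noteq> 0"
    and cont: "\<And>k. continuous_on {0..1} (\<lambda>\<tau>. coeff (q \<tau>) k)"
    and line: "\<And>\<tau> z. \<tau> \<in> {0..1} \<Longrightarrow> L z = 0 \<Longrightarrow> poly (q \<tau>) z \<noteq> 0"
    and start: "\<And>z. poly (q 0) z = 0 \<Longrightarrow> L z < 0"
    and \<tau>: "\<tau> \<in> {0..1}" "poly (q \<tau>) z = 0"
  shows "L z < 0"
proof -
  have degp: "degree (q \<tau>) = p" for \<tau>
    using deg(1)[of \<tau>] le_degree[of "q \<tau>" p] deg(2,3) by (simp add: le_antisym)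
  have contL: "continuous_on A L" for A
    using L(1) linear_continuous_on linear_conv_bounded_linear by blast
  have poly: "poly (q \<tau>) z = (\<Sum>k\<le>p. coeff (q \<tau>) k * z ^ k)" for \<tau> z
    by (simp add: poly_altdef degp)
  define T where "T = {\<tau>\<in>{0..1}. \<forall>z. poly (q \<tau>) z = 0 \<longrightarrow> L z < 0}"
  have "T = {0..1} \<inter> (\<Inter>z\<in>{z. L z > 0}. {\<tau>\<in>{0..1}. cmod c * L z ^ p \<le> cmod (poly (q \<tau>) z)})"
    (is "_ = ?T'")
  proof (intro equalityI subsetI)
    fix \<tau> assume t: "\<tau> \<in> T"
    have "cmod c * L z ^ p \<le> cmod (poly (q \<tau>) z)" if "L z > 0" for z
      using norm_poly_ge_if_roots_in_half_plane[OF L, of "q \<tau>" z] t that deg(2)[of \<tau>] deg(3)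
      by (force simp: T_def degp)
    then show "\<tau> \<in> ?T'" using t by (auto simp: T_def)
  next
    fix \<tau> assume t: "\<tau> \<in> ?T'"
    have "L z < 0" if "poly (q \<tau>) z = 0" for z
    proof (rule ccontr)
      assume "\<not> L z < 0"
      moreover have "L z \<noteq> 0" using line[of \<tau> z] that t by auto
      ultimately have "L z > 0" by simp
      then have "cmod c * L z ^ p \<le> 0" using t that by force
      moreover have "cmod c * L z ^ p > 0" using \<open>L z > 0\<close> deg(3) by simp
      ultimately show False by simp
    qed
    then show "\<tau> \<in> T" using t by (auto simp: T_def)
  qed
  moreover have "closed {\<tau>\<in>{0..1}. cmod c * L z ^ p \<le> cmod (poly (q \<tau>) z)}" for z
    unfolding poly
    by (intro continuous_closed_preimage_constant continuous_on_closed_Collect_le continuous_intros cont closed_atLeastAtMost) 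
  ultimately have "closed T" by auto
  then have closedin: "closedin (top_of_set {0..1}) T"
    by (auto simp: T_def intro: closed_subset)
  have "\<exists>a. \<forall>\<tau>\<in>{0..1}. cmod (coeff (q \<tau>) k) \<le> a" for k
    using compact_imp_bounded[OF compact_continuous_image[OF cont[of k]]]
    by (auto simp: bounded_iff)
  then obtain a where a: "\<And>k \<tau>. \<tau> \<in> {0..1} \<Longrightarrow> cmod (coeff (q \<tau>) k) \<le> a k" by metis
  \<comment> \<open>Cauchy's bound for the roots, uniform in \<open>\<tau>\<close>\<close>
  define R where "R = 1 + (\<Sum>k<p. a k) / cmod c"
  have R: "cmod z \<le> R" if t: "\<tau> \<in> {0..1}" "poly (q \<tau>) z = 0" for \<tau> z
  proof (rule ccontr)
    assume "\<not> cmod z \<le> R"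
    have a0: "a k \<ge> 0" for k using a[OF t(1), of k] norm_ge_zero order_trans by blast
    then have "R \<ge> 1" by (auto simp: R_def intro!: divide_nonneg_nonneg sum_nonneg)
    then have z1: "cmod z \<ge> 1" using \<open>\<not> cmod z \<le> R\<close> by simp
    have "p \<noteq> 0"
    proof
      assume "p = 0"
      then have "poly (q \<tau>) z = c" using deg(2) by (simp add: poly)
      with t(2) deg(3) show False by simp
    qed
    have "0 = (\<Sum>k<p. coeff (q \<tau>) k * z ^ k) + c * z ^ p"
      using t(2) deg(2) by (simp add: poly lessThan_Suc_atMost[symmetric])
    then have "cmod c * cmod z ^ p = cmod (\<Sum>k<p. coeff (q \<tau>) k * z ^ k)"
      by (metis add_eq_0_iff norm_minus_cancel norm_mult norm_power)
    also have "\<dots> \<le> (\<Sum>k<p. a k * cmod z ^ (p - 1))"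
    proof (rule sum_norm_le)
      fix k assume "k \<in> {..<p}"
      then have "cmod z ^ k \<le> cmod z ^ (p - 1)" by (intro power_increasing z1) auto
      then show "cmod (coeff (q \<tau>) k * z ^ k) \<le> a k * cmod z ^ (p - 1)"
        using a[OF t(1)] a0 by (auto simp: norm_mult norm_power intro!: mult_mono)
    qed
    finally have "cmod c * cmod z * cmod z ^ (p - 1) \<le> (\<Sum>k<p. a k) * cmod z ^ (p - 1)"
      using \<open>p \<noteq> 0\<close> by (simp add: sum_distrib_right power_eq_if mult.assoc)
    moreover have "cmod z ^ (p - 1) > 0" using z1 by (intro zero_less_power) linarith
    ultimately have "cmod c * cmod z \<le> (\<Sum>k<p. a k)" by (rule mult_right_le_imp_le)
    then have "cmod z \<le> (\<Sum>k<p. a k) / cmod c" using deg(3) by (simp add: field_simps)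
    then show False using \<open>\<not> cmod z \<le> R\<close> by (simp add: R_def)
  qed
  define K where "K = {y \<in> {0..1} \<times> cball 0 R. L (snd y) \<ge> 0 \<and> poly (q (fst y)) (snd y) = 0}"
  have "continuous_on ({0..1} \<times> cball 0 R) (\<lambda>y. poly (q (fst y)) (snd y))"
    unfolding poly
    by (intro continuous_intros continuous_on_compose2[OF cont] ) auto
  then have "closed {y \<in> {0..1} \<times> cball 0 R. poly (q (fst y)) (snd y) = 0}"
    by (intro continuous_closed_preimage_constant closed_Times) auto
  moreover have "closed {y :: real \<times> complex. L (snd y) \<ge> 0}"
    by (intro closed_Collect_le continuous_intros continuous_on_compose2[OF contL[of UNIV]]) auto
  ultimately have "closed ({y \<in> {0..1} \<times> cball 0 R. poly (q (fst y)) (snd y) = 0} \<inter> {y. L (snd y) \<ge> 0})"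
    by (rule closed_Int)
  also have "{y \<in> {0..1} \<times> cball 0 R. poly (q (fst y)) (snd y) = 0} \<inter> {y. L (snd y) \<ge> 0} = K"
    by (auto simp: K_def)
  finally have "closed K" .
  moreover have "compact ({0..1::real} \<times> cball (0::complex) R)" by (intro compact_Times) auto
  ultimately have "compact K"
    using closed_Int_compact[of K "{0..1} \<times> cball 0 R"] by (simp add: K_def inf.absorb1 Collect_conj_eq)
  then have "closed (fst ` K)"
    by (intro compact_imp_closed compact_continuous_image continuous_intros)
  moreover have "fst ` K = {0..1} - T"
  proof (intro equalityI subsetI)
    fix \<tau> assume "\<tau> \<in> fst ` K"
    then show "\<tau> \<in> {0..1} - T" by (force simp: K_def T_def)
  next
    fix \<tau> assume "\<tau> \<in> {0..1} - T"
    then obtain z where "\<tau> \<in> {0..1}" "poly (q \<tau>) z = 0" "\<not> L z < 0" by (auto simp: T_def)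
    then have "(\<tau>, z) \<in> K" using R by (auto simp: K_def)
    then show "\<tau> \<in> fst ` K" by force
  qed
  ultimately have "closedin (top_of_set {0..1}) ({0..1} - T)"
    by (auto intro: closed_subset)
  then have "openin (top_of_set {0..1}) T"
    by (auto simp: openin_closedin_eq T_def)
  moreover have "0 \<in> T" using start by (auto simp: T_def)
  ultimately have "T = {0..1}"
    using closedin connected_clopen[of "{0..1::real}"] by auto
  then show ?thesis using \<tau> by (auto simp: T_def)
qed

section \<open>Hyperbolicity of the sums of principal minors\<close>

definition cmat :: "real^'n^'n \<Rightarrow> complex^'n^'n" where
  "cmat M = (\<chi> i j. of_real (M $ i $ j))"

definition on_line :: "'a::comm_ring_1^'n^'n \<Rightarrow> 'a^'n^'n \<Rightarrow> 'a \<Rightarrow> 'a^'n^'n" where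
  "on_line C B t = (\<chi> i j. C $ i $ j + t * B $ i $ j)"

text \<open>The polynomial \<open>t \<mapsto> pminors p (C + t B)\<close>, obtained from \<open>pminors\<close> over the polynomial ring.\<close>

definition line_poly :: "nat \<Rightarrow> 'a::comm_ring_1^'n^'n \<Rightarrow> 'a^'n^'n \<Rightarrow> 'a poly" where
  "line_poly p C B = pminors p (\<chi> i j. [:C $ i $ j, B $ i $ j:])"

lemma pminors_cmat: "pminors p (cmat M) = of_real (pminors p M)"
  by (simp add: pminors_def cmat_def)

lemma cmat_add_mat: "mat (of_real r) + cmat M = cmat (mat r + M)"
  by (simp add: cmat_def mat_def vec_eq_iff)

lemma poly_line_poly: "poly (line_poly p C B) t = pminors p (on_line C B t)"
  by (simp add: line_poly_def pminors_def on_line_def poly_sum poly_prod algebra_simps)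

lemma degree_prod_linear_le:
  fixes a b :: "'i \<Rightarrow> 'a::comm_ring_1"
  shows "finite J \<Longrightarrow> degree (\<Prod>i\<in>J. [:a i, b i:]) \<le> card J"
proof (induction rule: finite_induct)
  case (insert x J)
  have "degree ([:a x, b x:] * (\<Prod>i\<in>J. [:a i, b i:])) \<le> degree [:a x, b x:] + degree (\<Prod>i\<in>J. [:a i, b i:])"
    by (rule degree_mult_le)
  also have "\<dots> \<le> 1 + card J" using insert.IH by (intro add_mono) auto
  finally show ?case using insert.hyps by (simp del: mult_pCons_left)
qed simp

lemma coeff_card_prod_linear:
  fixes a b :: "'i \<Rightarrow> 'a::comm_ring_1"
  shows "finite J \<Longrightarrow> coeff (\<Prod>i\<in>J. [:a i, b i:]) (card J) = (\<Prod>i\<in>J. b i)"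
proof (induction rule: finite_induct)
  case (insert x J)
  have "coeff (\<Prod>i\<in>J. [:a i, b i:]) (Suc (card J)) = 0"
    by (intro coeff_eq_0 le_imp_less_Suc degree_prod_linear_le insert.hyps)
  with insert show ?case by simp
qed simp

lemma degree_line_poly: "degree (line_poly p C B) \<le> p"
  unfolding line_poly_def pminors_def
proof (intro degree_sum_le; clarsimp simp: finite_permutations)
  fix J :: "'b set" and \<sigma>
  have "degree (of_int (sign \<sigma>) * (\<Prod>i\<in>J. [:C $ i $ \<sigma> i, B $ i $ \<sigma> i:]))
    \<le> degree (of_int (sign \<sigma>) :: 'a poly) + degree (\<Prod>i\<in>J. [:C $ i $ \<sigma> i, B $ i $ \<sigma> i:])"
    by (rule degree_mult_le)
  also have "\<dots> \<le> card J" using degree_prod_linear_le[of J] by simp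
  finally show "degree (of_int (sign \<sigma>) * (\<Prod>i\<in>J. [:C $ i $ \<sigma> i, B $ i $ \<sigma> i:])) \<le> card J" .
qed

lemma coeff_of_int_mult: "coeff (of_int k * f) j = of_int k * coeff f j"
  by (simp add: of_int_poly)

lemma coeff_line_poly: "coeff (line_poly p C B) p = pminors p B"
  unfolding line_poly_def pminors_def coeff_sum coeff_of_int_mult
  by (intro sum.cong refl) (auto simp: coeff_card_prod_linear)

lemma continuous_on_coeff_prod_linear:
  fixes a b :: "'i \<Rightarrow> 't::topological_space \<Rightarrow> 'a::real_normed_field"
  assumes "finite J" "\<And>i. i \<in> J \<Longrightarrow> continuous_on T (a i)" "\<And>i. i \<in> J \<Longrightarrow> continuous_on T (b i)"
  shows "continuous_on T (\<lambda>\<tau>. coeff (\<Prod>i\<in>J. [:a i \<tau>, b i \<tau>:]) k)"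
  using assms
proof (induction arbitrary: k rule: finite_induct)
  case (insert x J)
  then show ?case by (cases k) (auto intro!: continuous_intros)
qed simp

lemma continuous_on_coeff_line_poly:
  fixes C :: "'t::topological_space \<Rightarrow> 'a::real_normed_field^'n^'n"
  assumes "\<And>i j. continuous_on T (\<lambda>\<tau>. C \<tau> $ i $ j)"
  shows "continuous_on T (\<lambda>\<tau>. coeff (line_poly p (C \<tau>) B) k)"
  unfolding line_poly_def pminors_def coeff_sum coeff_of_int_mult
  by (intro continuous_intros) (auto intro!: continuous_on_coeff_prod_linear assms continuous_intros)

lemma tendsto_pminors:
  fixes M :: "'t \<Rightarrow> 'a::real_normed_field^'n^'n"
  assumes "\<And>i j. ((\<lambda>x. M x $ i $ j) \<longlongrightarrow> M0 $ i $ j) F"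
  shows "((\<lambda>x. pminors p (M x)) \<longlongrightarrow> pminors p M0) F"
  unfolding pminors_def by (intro tendsto_intros assms)

text \<open>Along the direction of the identity, \<open>pminors p\<close> is, up to a factor, a derivative of the
  characteristic polynomial, which has only real roots; so it has itself only real roots.\<close>

lemma pminors_nonreal_shift_nonzero:
  fixes M :: "'n::{finite,linorder} rmat"
  assumes M: "transpose M = M" and p: "p \<le> CARD('n)" and z: "Im z \<noteq> 0"
  shows "pminors p (mat z + cmat M) \<noteq> 0"
proof -
  have upper: "pminors p (mat z + cmat M) \<noteq> 0"
    if M: "transpose M = M" and z: "Im z > 0" for z and M :: "'n rmat"
  proof -
    let ?n = "CARD('n)"
    define \<mu> where "\<mu> = eigvals M"
    define D where "D = (\<Prod>i\<in>(UNIV::'n set). [:z + of_real (\<mu> $ i), 1:])"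
    have deg: "degree D = ?n"
      unfolding D_def by (subst degree_prod_eq_sum_degree) auto
    have poly: "poly D w = (\<Prod>i\<in>UNIV. (w + z) + of_real (\<mu> $ i))" for w
      by (simp add: D_def poly_prod algebra_simps)
    have "coeff D (?n - q) = pminors q (mat z + cmat M)" if "q \<le> ?n" for q
    proof (rule top_coeffs_unique[OF _ that])
      fix w :: complex
      have "(\<Sum>q\<le>?n. w ^ (?n - q) * coeff D (?n - q)) = (\<Sum>k\<le>?n. coeff D k * w ^ k)"
        by (rule sum.reindex_bij_witness[of _ "\<lambda>i. ?n - i" "\<lambda>i. ?n - i"]) (auto simp: mult.commute)
      also have "\<dots> = poly D w" by (simp add: poly_altdef deg)
      also have "\<dots> = (\<Sum>q\<le>?n. (w + z) ^ (?n - q) * pminors q (cmat M))"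
        unfolding poly prod_shift_eq_esym
        by (intro sum.cong refl) (simp add: pminors_cmat \<mu>_def pminors_eq_esym_eigvals[OF M])
      also have "\<dots> = det (mat (w + z) + cmat M)" by (simp add: det_shift_eq_pminors)
      also have "mat (w + z) + cmat M = mat w + (mat z + cmat M)"
        by (simp add: mat_def vec_eq_iff)
      finally show "(\<Sum>q\<le>?n. w ^ (?n - q) * coeff D (?n - q))
        = (\<Sum>q\<le>?n. w ^ (?n - q) * pminors q (mat z + cmat M))"
        by (simp add: det_shift_eq_pminors)
    qed
    moreover have "coeff D (?n - p) \<noteq> 0"
    proof (rule coeff_nonzero_if_roots_in_lower_half_plane)
      fix w assume "poly D w = 0"
      then obtain i where "(w + z) + of_real (\<mu> $ i) = 0" by (auto simp: poly)
      then have "Im ((w + z) + of_real (\<mu> $ i)) = 0" by simp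
      then show "Im w < 0" using z by simp
    qed (simp add: deg)
    ultimately show ?thesis using p by simp
  qed
  show ?thesis
  proof (cases "Im z > 0")
    case False
    have "mat z + cmat M = (\<chi> i j. (-1) * (mat (- z) + cmat (- M)) $ i $ j)"
      by (simp add: vec_eq_iff mat_def cmat_def)
    then have "pminors p (mat z + cmat M) = (-1) ^ p * pminors p (mat (- z) + cmat (- M))"
      by (simp only: pminors_scale)
    moreover have "transpose (- M) = - M" using M by (simp add: transpose_def vec_eq_iff)
    ultimately show ?thesis using upper[of "- M" "- z"] False z by simp
  qed (use upper M in blast)
qed

section \<open>Garding's cone and inequality\<close>

text \<open>The symmetric matrices whose eigenvalue vector lies in \<open>Gamma_cone p\<close>, described without eigenvalues.\<close>

definition pcone :: "nat \<Rightarrow> 'n::{finite,linorder} rmat set" where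
  "pcone p = {M. transpose M = M \<and> (\<forall>q\<in>{1..p}. pminors q M > 0)}"

lemma transpose_add_mat: "transpose M = M \<Longrightarrow> transpose (mat r + M) = mat r + (M :: 'a::monoid_add^'n^'n)"
  by (auto simp: transpose_def mat_def vec_eq_iff)

lemma pminors_shift_pos:
  fixes M :: "'n::{finite,linorder} rmat"
  assumes "p \<le> CARD('n)" "r \<ge> 0" and "\<And>q. q \<in> {1..p} \<Longrightarrow> pminors q M \<ge> 0"
    and "r > 0 \<or> pminors p M > 0"
  shows "pminors p (mat r + M) > 0"
proof -
  have M: "pminors q M \<ge> 0" if "q \<le> p" for q
    using assms(3)[of q] that by (cases "q = 0") auto
  have "(\<Sum>q\<le>p. of_nat ((CARD('n) - q) choose (CARD('n) - p)) * r ^ (p - q) * pminors q M) > 0"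
  proof (cases "r > 0")
    case True
    have "0 < (CARD('n) - 0) choose (CARD('n) - p)" by simp
    then have "0 < of_nat ((CARD('n) - 0) choose (CARD('n) - p)) * r ^ (p - 0) * pminors 0 M"
      using True by simp
    then show ?thesis
      by (intro sum_pos2[of _ 0]) (use assms(1,2) M in auto)
  next
    case False
    then show ?thesis
      by (intro sum_pos2[of _ p]) (use assms M in auto)
  qed
  then show ?thesis by (simp add: pminors_shift[OF assms(1)])
qed

lemma pcone_shift_strict:
  assumes "transpose M = M" "p \<le> CARD('n)" "r > 0" "\<And>q. q \<in> {1..p} \<Longrightarrow> pminors q M \<ge> 0"
  shows "mat r + (M :: 'n::{finite,linorder} rmat) \<in> pcone p"
  unfolding pcone_def using assms
  by (auto intro!: transpose_add_mat pminors_shift_pos)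

lemma pcone_shift:
  assumes "M \<in> pcone p" "p \<le> CARD('n)" "r \<ge> 0"
  shows "mat r + (M :: 'n::{finite,linorder} rmat) \<in> pcone p"
  unfolding pcone_def using assms
  by (auto simp: pcone_def less_imp_le intro!: transpose_add_mat pminors_shift_pos)

lemma pminors_zero: "1 \<le> q \<Longrightarrow> pminors q (0 :: real^'n^'n) = 0"
  using pminors_scaleR[of q 0 0] by (cases q) auto

lemma mat_in_pcone:
  assumes "p \<le> CARD('n)" "r > 0"
  shows "(mat r :: 'n::{finite,linorder} rmat) \<in> pcone p"
  using pcone_shift_strict[of 0 p r] assms by (auto simp: pminors_zero transpose_def vec_eq_iff)

lemma pcone_scale:
  assumes "M \<in> pcone p" "r > 0"
  shows "r *\<^sub>R M \<in> pcone p"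
  using assms by (auto simp: pcone_def pminors_scaleR transpose_scalar)

lemma pcone_pminors_pos: "M \<in> pcone p \<Longrightarrow> pminors p M > 0"
  by (cases "p = 0") (auto simp: pcone_def)

text \<open>The roots are real by hyperbolicity, and negative because adding nonnegative multiples of the identity
  does not lead out of the cone.\<close>

lemma pcone_identity_roots:
  fixes M :: "'n::{finite,linorder} rmat"
  assumes "M \<in> pcone p" "p \<le> CARD('n)" "pminors p (mat z + cmat M) = 0"
  shows "Im z = 0" "Re z < 0"
proof -
  show Im: "Im z = 0"
    using pminors_nonreal_shift_nonzero[of M p z] assms by (auto simp: pcone_def)
  then have "z = of_real (Re z)" by (simp add: complex_eq_iff)
  then have "pminors p (mat (Re z) + M) = 0"
    using assms(3) by (metis cmat_add_mat of_real_eq_0_iff pminors_cmat)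
  then show "Re z < 0"
    using pcone_pminors_pos[OF pcone_shift[OF assms(1,2)], of "Re z"] by force
qed

lemma cmat_combine: "on_line (cmat X) (cmat B) (of_real r) = cmat (X + r *\<^sub>R B)"
  by (simp add: on_line_def cmat_def vec_eq_iff)

lemma transpose_add_diff:
  "transpose (A + B) = transpose A + transpose (B :: real^'n^'m)"
  "transpose (A - B) = transpose A - transpose (B :: real^'n^'m)"
  by (simp_all add: transpose_def vec_eq_iff)

text \<open>Hyperbolicity in the direction of the identity passes to every direction \<open>B\<close> of the cone, by an argument
  of Garding.  For \<open>e > 0\<close> the polynomial \<open>t \<mapsto> pminors p (X + \<i> e + t B)\<close> has no real root.  When \<open>X\<close> is
  replaced by \<open>0\<close>, its roots are positive multiples of \<open>- \<i>\<close>, because \<open>B\<close> lies in the cone; hence its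
  roots lie in the lower half plane for \<open>X\<close> itself.  The resulting lower bound in the upper half plane
  survives the limit \<open>e \<rightarrow> 0\<close>.\<close>

lemma pcone_hyperbolic:
  fixes X B :: "'n::{finite,linorder} rmat"
  assumes X: "transpose X = X" and B: "B \<in> pcone p" and p: "p \<le> CARD('n)" and t: "Im t \<noteq> 0"
  shows "pminors p (on_line (cmat X) (cmat B) t) \<noteq> 0"
proof -
  have Bpos: "pminors p B > 0" and Bsym: "transpose B = B"
    using B pcone_pminors_pos by (auto simp: pcone_def)
  have linIm: "linear Im" by (rule linearI) auto
  have Im_le: "Im z \<le> cmod z" for z using abs_Im_le_cmod[of z] by linarith
  have upper: "pminors p (on_line (cmat X) (cmat B) t) \<noteq> 0"
    if X: "transpose X = X" and t: "Im t > 0" for X t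
  proof -
    have low: "pminors p B * Im t ^ p
        \<le> cmod (pminors p (on_line (mat (\<i> * of_real e) + cmat X) (cmat B) t))"
      if e: "e > 0" for e
    proof -
      define q where "q \<tau> = line_poly p (mat (\<i> * of_real e) + cmat (\<tau> *\<^sub>R X)) (cmat B)" for \<tau>
      have lead: "coeff (q \<tau>) p = of_real (pminors p B)" for \<tau>
        by (simp add: q_def coeff_line_poly pminors_cmat)
      have "Im z < 0" if z: "poly (q 1) z = 0" for z
      proof (rule roots_stay_in_half_plane[of Im q p "of_real (pminors p B)" 1 z])
        show "linear Im" by (rule linIm)
        show "Im z \<le> cmod z" for z by (rule Im_le)
        show "degree (q \<tau>) \<le> p" for \<tau> by (simp add: q_def degree_line_poly)
        show "coeff (q \<tau>) p = of_real (pminors p B)" for \<tau> by (rule lead)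
        show "of_real (pminors p B) \<noteq> (0::complex)" using Bpos by simp
        show "continuous_on {0..1} (\<lambda>\<tau>. coeff (q \<tau>) k)" for k
          unfolding q_def
          by (intro continuous_on_coeff_line_poly) (auto simp: cmat_def intro!: continuous_intros)
        show "poly (q \<tau>) z \<noteq> 0" if "Im z = 0" for \<tau> z
        proof -
          have "on_line (mat (\<i> * of_real e) + cmat (\<tau> *\<^sub>R X)) (cmat B) z
            = mat (\<i> * of_real e) + cmat (\<tau> *\<^sub>R X + Re z *\<^sub>R B)"
            using that by (simp add: on_line_def cmat_def vec_eq_iff complex_eq_iff)
          moreover have "transpose (\<tau> *\<^sub>R X + Re z *\<^sub>R B) = \<tau> *\<^sub>R X + Re z *\<^sub>R B"
            using X Bsym by (simp add: transpose_add_diff transpose_scalar)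
          ultimately show ?thesis unfolding q_def poly_line_poly
            using e by (simp add: pminors_nonreal_shift_nonzero[OF _ p])
        qed
        show "Im z < 0" if z: "poly (q 0) z = 0" for z
        proof -
          have q0: "pminors p (on_line (mat (\<i> * of_real e)) (cmat B) z) = 0"
          proof -
            have "cmat (0 *\<^sub>R X) = 0" by (simp add: cmat_def vec_eq_iff)
            then show ?thesis using z by (simp add: q_def poly_line_poly)
          qed
          have "z \<noteq> 0"
          proof
            assume "z = 0"
            then have "on_line (mat (\<i> * of_real e)) (cmat B) z = mat (\<i> * of_real e) + cmat 0"
              by (simp add: on_line_def cmat_def vec_eq_iff)
            moreover have "transpose (0::'n rmat) = 0" by (simp add: transpose_def vec_eq_iff)
            ultimately show False
              using q0 e pminors_nonreal_shift_nonzero[of "0::'n rmat" p "\<i> * of_real e"] p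
              by simp
          qed
          \<comment> \<open>by homogeneity, \<open>w\<close> is a root for the line through \<open>B\<close> parallel to the identity\<close>
          define w where "w = \<i> * of_real e / z"
          have "on_line (mat (\<i> * of_real e)) (cmat B) z = (\<chi> i j. z * (mat w + cmat B) $ i $ j)"
            using \<open>z \<noteq> 0\<close> by (simp add: on_line_def vec_eq_iff mat_def w_def distrib_left)
          then have "pminors p (mat w + cmat B) = 0"
            using q0 \<open>z \<noteq> 0\<close> by (simp only: pminors_scale) simp
          from pcone_identity_roots[OF B p this] have "Im w = 0" "Re w < 0" by auto
          then have "w = of_real (Re w)" by (simp add: complex_eq_iff)
          moreover have "z = \<i> * of_real e / w" using \<open>z \<noteq> 0\<close> e by (simp add: w_def)
          ultimately have "z = \<i> * of_real (e / Re w)" by (metis of_real_divide times_divide_eq_right)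
          then show "Im z < 0" using e \<open>Re w < 0\<close> by (simp add: divide_pos_neg)
        qed
      qed (use z in auto)
      moreover have "degree (q 1) = p"
        using degree_line_poly[of p "mat (\<i> * of_real e) + cmat (1 *\<^sub>R X)" "cmat B"]
          le_degree[of "q 1" p] lead[of 1] Bpos by (auto simp: q_def)
      moreover have "q 1 \<noteq> 0" using lead[of 1] Bpos by auto
      ultimately have "cmod (lead_coeff (q 1)) * Im t ^ degree (q 1) \<le> cmod (poly (q 1) t)"
        using t by (intro norm_poly_ge_if_roots_in_half_plane linIm Im_le) auto
      then show ?thesis
        using lead[of 1] Bpos \<open>degree (q 1) = p\<close> by (simp add: q_def poly_line_poly)
    qed
    have "((\<lambda>e. cmod (pminors p (on_line (mat (\<i> * of_real e) + cmat X) (cmat B) t)))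
        \<longlongrightarrow> cmod (pminors p (on_line (cmat X) (cmat B) t))) (at_right 0)"
    proof (intro tendsto_norm tendsto_pminors)
      fix i j
      have "((\<lambda>e. \<i> * of_real e) \<longlongrightarrow> \<i> * of_real 0) (at_right (0::real))" by (intro tendsto_intros)
      then show "((\<lambda>e. on_line (mat (\<i> * of_real e) + cmat X) (cmat B) t $ i $ j)
        \<longlongrightarrow> on_line (cmat X) (cmat B) t $ i $ j) (at_right 0)"
        by (cases "i = j") (auto simp: on_line_def mat_def intro!: tendsto_eq_intros)
    qed
    moreover have "eventually (\<lambda>e. pminors p B * Im t ^ p
        \<le> cmod (pminors p (on_line (mat (\<i> * of_real e) + cmat X) (cmat B) t))) (at_right 0)"
      by (rule eventually_mono[OF eventually_at_right_less]) (rule low)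
    ultimately have "pminors p B * Im t ^ p \<le> cmod (pminors p (on_line (cmat X) (cmat B) t))"
      by (intro tendsto_lowerbound[of _ _ "at_right (0::real)"]) auto
    moreover have "pminors p B * Im t ^ p > 0" using Bpos t by simp
    ultimately show ?thesis by auto
  qed
  show ?thesis
  proof (cases "Im t > 0")
    case False
    have "on_line (cmat X) (cmat B) t = (\<chi> i j. (-1) * on_line (cmat (- X)) (cmat B) (- t) $ i $ j)"
      by (simp add: vec_eq_iff on_line_def cmat_def)
    then have "pminors p (on_line (cmat X) (cmat B) t)
        = (-1) ^ p * pminors p (on_line (cmat (- X)) (cmat B) (- t))"
      by (simp only: pminors_scale)
    moreover have "transpose (- X) = - X" using X by (simp add: transpose_def vec_eq_iff)
    ultimately show ?thesis using upper[of "- X" "- t"] False t by simp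
  qed (use upper X in blast)
qed

lemma pcone_segment_to_identity:
  fixes M :: "'n::{finite,linorder} rmat"
  assumes "M \<in> pcone p" "p \<le> CARD('n)" "0 \<le> s" "s \<le> 1"
  shows "mat (1 - s) + s *\<^sub>R M \<in> pcone p"
proof (cases "s = 0")
  case True
  then show ?thesis using mat_in_pcone[of p 1] assms by simp
next
  case False
  then show ?thesis using assms by (intro pcone_shift pcone_scale) auto
qed

text \<open>Convexity of the cone in disguise: no point of the ray from one element of the cone in the
  direction of another is a zero, because this is so for the identity in place of the
  first element, and no root can reach the imaginary axis along the segment between the two.\<close>

lemma pcone_direction_roots:
  fixes M B :: "'n::{finite,linorder} rmat"
  assumes M: "M \<in> pcone p" and B: "B \<in> pcone p" and p: "p \<le> CARD('n)"
    and z: "pminors p (on_line (cmat M) (cmat B) z) = 0"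
  shows "Im z = 0" "Re z < 0"
proof -
  have sym: "transpose M = M" and Bpos: "pminors p B > 0" using M B pcone_pminors_pos by (auto simp: pcone_def)
  show "Im z = 0" using pcone_hyperbolic[OF sym B p, of z] z by auto
  define N where "N \<tau> = mat (1 - \<tau>) + \<tau> *\<^sub>R M" for \<tau>
  have N: "N \<tau> \<in> pcone p" if "\<tau> \<in> {0..1}" for \<tau>
    unfolding N_def using that by (intro pcone_segment_to_identity M p) auto
  define q where "q \<tau> = line_poly p (cmat (N \<tau>)) (cmat B)" for \<tau>
  have real: "Im w = 0" if "\<tau> \<in> {0..1}" "poly (q \<tau>) w = 0" for \<tau> w
    using pcone_hyperbolic[OF _ B p, of "N \<tau>" w] N[OF that(1)] that(2)
    by (auto simp: q_def poly_line_poly pcone_def)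
  show "Re z < 0"
  proof (rule roots_stay_in_half_plane[of Re q p "of_real (pminors p B)" 1 z])
    show "linear Re" by (rule linearI) auto
    show "Re z \<le> cmod z" for z by (rule complex_Re_le_cmod)
    show "degree (q \<tau>) \<le> p" for \<tau> by (simp add: q_def degree_line_poly)
    show "coeff (q \<tau>) p = of_real (pminors p B)" for \<tau>
      by (simp add: q_def coeff_line_poly pminors_cmat)
    show "of_real (pminors p B) \<noteq> (0::complex)" using Bpos by simp
    show "continuous_on {0..1} (\<lambda>\<tau>. coeff (q \<tau>) k)" for k
      unfolding q_def
    proof (intro continuous_on_coeff_line_poly)
      fix i j
      show "continuous_on {0..1} (\<lambda>\<tau>. cmat (N \<tau>) $ i $ j)"
        by (cases "i = j") (auto simp: cmat_def N_def mat_def intro!: continuous_intros)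
    qed
    show "poly (q \<tau>) w \<noteq> 0" if "\<tau> \<in> {0..1}" "Re w = 0" for \<tau> w
    proof
      assume 0: "poly (q \<tau>) w = 0"
      then have "w = of_real 0" using real[OF that(1)] that(2) by (simp add: complex_eq_iff)
      then have "pminors p (N \<tau>) = 0"
        using 0 unfolding q_def poly_line_poly by (simp only: cmat_combine pminors_cmat) simp
      then show False using pcone_pminors_pos[OF N[OF that(1)]] by simp
    qed
    show "Re w < 0" if "poly (q 0) w = 0" for w
    proof (rule ccontr)
      assume "\<not> Re w < 0"
      have "w = of_real (Re w)" using real[OF _ that] by (simp add: complex_eq_iff)
      then have "poly (q 0) w = of_real (pminors p (N 0 + Re w *\<^sub>R B))"
        unfolding q_def poly_line_poly by (metis cmat_combine pminors_cmat)
      with that have "pminors p (N 0 + Re w *\<^sub>R B) = 0" by simp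
      moreover have "N 0 + Re w *\<^sub>R B \<in> pcone p"
      proof (cases "Re w = 0")
        case True
        then show ?thesis using N[of 0] by simp
      next
        case False
        then have "mat 1 + Re w *\<^sub>R B \<in> pcone p"
          using \<open>\<not> Re w < 0\<close> by (intro pcone_shift pcone_scale B p) auto
        then show ?thesis by (simp add: N_def)
      qed
      ultimately show False using pcone_pminors_pos by force
    qed
    show "poly (q 1) z = 0"
      using z by (simp add: q_def poly_line_poly N_def)
  qed auto
qed

lemma poly_with_negative_roots:
  fixes f :: "complex poly"
  assumes "\<And>z. poly f z = 0 \<Longrightarrow> Im z = 0 \<and> Re z < 0" "degree f = p" "f \<noteq> 0"
  obtains r :: "nat \<Rightarrow> real" where "\<And>i. i < p \<Longrightarrow> r i > 0"
    "\<And>z. poly f z = lead_coeff f * (\<Prod>i<p. z + of_real (r i))"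
proof -
  from complex_poly_factorization[OF assms(3)] obtain A
    where A: "size A = degree f" "\<And>z. poly f z = lead_coeff f * (\<Prod>a\<in>#A. z - a)"
      "\<And>a. a \<in># A \<Longrightarrow> poly f a = 0"
    by metis
  obtain as where as: "mset as = A" using ex_mset by blast
  have len: "length as = p" using A(1) assms(2) as by auto
  define r where "r i = - Re (as ! i)" for i
  have root: "poly f (as ! i) = 0" if "i < p" for i
  proof -
    have "as ! i \<in># A" using that len as by (metis nth_mem set_mset_mset)
    then show ?thesis by (rule A(3))
  qed
  have r: "r i > 0" "as ! i = - of_real (r i)" if "i < p" for i
    using assms(1)[OF root[OF that]] by (auto simp: r_def complex_eq_iff)
  have "poly f z = lead_coeff f * (\<Prod>i<p. z + of_real (r i))" for z
  proof -
    have "(\<Prod>a\<in>#A. z - a) = prod_mset (mset (map (\<lambda>a. z - a) as))" by (simp add: as)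
    also have "\<dots> = prod_list (map (\<lambda>a. z - a) as)" by (rule prod_mset_prod_list)
    also have "\<dots> = (\<Prod>i<p. z - as ! i)"
      unfolding prod.list_conv_set_nth by (simp add: len atLeast0LessThan)
    also have "\<dots> = (\<Prod>i<p. z + of_real (r i))"
      by (intro prod.cong refl) (simp add: r(2))
    finally show ?thesis by (simp add: A(2))
  qed
  from that[OF r(1) this] show ?thesis .
qed

text \<open>The numbers \<open>- r i\<close> are the roots of \<open>t \<mapsto> pminors p (M + t B)\<close>; homogeneity turns this factorization into
  the one for \<open>B + s M\<close>.\<close>

lemma pcone_line_factorization:
  fixes M B :: "'n::{finite,linorder} rmat"
  assumes "M \<in> pcone p" "B \<in> pcone p" "p \<le> CARD('n)"
  obtains r :: "nat \<Rightarrow> real" where "\<And>i. i < p \<Longrightarrow> r i > 0"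
    "\<And>s. pminors p (B + s *\<^sub>R M) = pminors p B * (\<Prod>i<p. 1 + s * r i)"
    "pminors p M = pminors p B * (\<Prod>i<p. r i)"
proof -
  define f where "f = line_poly p (cmat M) (cmat B)"
  have Bpos: "pminors p B > 0" using assms pcone_pminors_pos by auto
  have lead: "coeff f p = of_real (pminors p B)" by (simp add: f_def coeff_line_poly pminors_cmat)
  have deg: "degree f = p"
    using degree_line_poly[of p "cmat M" "cmat B"] le_degree[of f p] lead Bpos by (auto simp: f_def)
  have "f \<noteq> 0" using lead Bpos by auto
  have "Im z = 0 \<and> Re z < 0" if "poly f z = 0" for z
    using pcone_direction_roots[OF assms, of z] that by (simp add: f_def poly_line_poly)
  then obtain r where r: "\<And>i. i < p \<Longrightarrow> r i > 0"
    "\<And>z. poly f z = lead_coeff f * (\<Prod>i<p. z + of_real (r i))"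
    using poly_with_negative_roots[of f p] deg \<open>f \<noteq> 0\<close> by metis
  have val: "pminors p (M + t *\<^sub>R B) = pminors p B * (\<Prod>i<p. t + r i)" for t
  proof -
    have "complex_of_real (pminors p (M + t *\<^sub>R B)) = poly f (of_real t)"
      by (simp only: f_def poly_line_poly cmat_combine pminors_cmat)
    also have "\<dots> = of_real (pminors p B * (\<Prod>i<p. t + r i))"
      by (simp add: r(2) deg lead)
    finally show ?thesis using of_real_eq_iff by blast
  qed
  have line: "pminors p (B + s *\<^sub>R M) = pminors p B * (\<Prod>i<p. 1 + s * r i)" for s
  proof (cases "s = 0")
    case False
    have "B + s *\<^sub>R M = s *\<^sub>R (M + (1 / s) *\<^sub>R B)" using False by (simp add: algebra_simps)
    then have "pminors p (B + s *\<^sub>R M) = s ^ p * (pminors p B * (\<Prod>i<p. 1 / s + r i))"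
      by (simp only: pminors_scaleR val)
    also have "s ^ p * (pminors p B * (\<Prod>i<p. 1 / s + r i)) = pminors p B * (\<Prod>i<p. s * (1 / s + r i))"
      by (simp add: prod.distrib)
    also have "(\<Prod>i<p. s * (1 / s + r i)) = (\<Prod>i<p. 1 + s * r i)"
      using False by (intro prod.cong refl) (simp add: field_simps)
    finally show ?thesis .
  qed simp
  have "pminors p M = pminors p B * (\<Prod>i<p. r i)" using val[of 0] by simp
  from that[OF r(1) line this] show ?thesis .
qed

lemma root_mean_le:
  fixes r :: "nat \<Rightarrow> real"
  assumes "1 \<le> p" "\<And>i. i < p \<Longrightarrow> r i > 0"
  shows "root p (\<Prod>i<p. r i) \<le> (\<Sum>i<p. r i) / p"
proof -
  have "(\<Prod>i<p. r i) powr (1 / card {..<p}) \<le> (\<Sum>i<p. r i / card {..<p})"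
    using assms by (intro arith_geom_mean) (auto simp: less_imp_le lessThan_empty_iff)
  moreover have "(\<Prod>i<p. r i) > 0" using assms by (intro prod_pos) auto
  then have "root p (\<Prod>i<p. r i) = (\<Prod>i<p. r i) powr (1 / p)"
    using assms(1) by (intro root_powr_inverse) auto
  moreover have "(\<Sum>i<p. r i / card {..<p}) = (\<Sum>i<p. r i) / p" by (simp add: sum_divide_distrib)
  ultimately show ?thesis by simp
qed

lemma DERIV_prod_one_plus:
  fixes r :: "nat \<Rightarrow> real"
  shows "((\<lambda>s. \<Prod>i<p. 1 + s * r i) has_real_derivative (\<Sum>i<p. r i)) (at 0)"
proof (induction p)
  case (Suc p)
  show ?case
    by (auto intro!: derivative_eq_intros Suc)
qed simp

text \<open>On the line through \<open>B\<close> in the direction \<open>M\<close>, the function \<open>pminors p\<close> splits into factors \<open>1 + s r i\<close> with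
  positive \<open>r i\<close>.  The derivative is given by the arithmetic mean of the \<open>r i\<close>, the value at \<open>M\<close> by their
  geometric mean.  The inequality expresses the concavity of the \<open>p\<close>-th root, a homogeneous function of degree one.\<close>

theorem garding_inequality:
  fixes M B :: "'n::{finite,linorder} rmat"
  assumes "M \<in> pcone p" "B \<in> pcone p" "p \<in> {1..CARD('n)}"
    and D: "((\<lambda>s. root p (pminors p (B + s *\<^sub>R M))) has_real_derivative D) (at 0)"
  shows "root p (pminors p M) \<le> D"
proof -
  obtain r :: "nat \<Rightarrow> real" where r: "\<And>i. i < p \<Longrightarrow> r i > 0"
    "\<And>s. pminors p (B + s *\<^sub>R M) = pminors p B * (\<Prod>i<p. 1 + s * r i)"
    "pminors p M = pminors p B * (\<Prod>i<p. r i)"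
    using pcone_line_factorization[OF assms(1,2)] assms(3) by auto
  have p: "1 \<le> p" using assms(3) by simp
  have Bpos: "pminors p B > 0" using assms pcone_pminors_pos by auto
  have "DERIV (root p) (\<Prod>i<p. 1 + 0 * r i) :> inverse (real p)"
    using DERIV_real_root[of p 1] p by simp
  from DERIV_chain2[OF this DERIV_prod_one_plus]
  have "((\<lambda>s. root p (\<Prod>i<p. 1 + s * r i)) has_real_derivative (\<Sum>i<p. r i) / p) (at 0)"
    by (simp add: divide_inverse mult.commute)
  from DERIV_cmult[OF this, of "root p (pminors p B)"]
  have "((\<lambda>s. root p (pminors p (B + s *\<^sub>R M))) has_real_derivative
      root p (pminors p B) * ((\<Sum>i<p. r i) / p)) (at 0)"
    by (simp only: r(2) real_root_mult)
  with D have "D = root p (pminors p B) * ((\<Sum>i<p. r i) / p)" by (rule DERIV_unique)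
  moreover have "root p (pminors p B) * root p (\<Prod>i<p. r i) \<le> root p (pminors p B) * ((\<Sum>i<p. r i) / p)"
    using Bpos p by (intro mult_left_mono root_mean_le r) auto
  ultimately show ?thesis by (simp only: r(3) real_root_mult)
qed

lemma coeff_prod_positive:
  fixes r :: "nat \<Rightarrow> real"
  assumes "\<And>i. i < p \<Longrightarrow> r i > 0" "k \<le> p"
  shows "coeff (\<Prod>i<p. [:r i, 1:]) k > 0"
  using assms
proof (induction p arbitrary: k)
  case (Suc p)
  have nonneg: "coeff (\<Prod>i<p. [:r i, 1:]) j \<ge> 0" for j
  proof (cases "j \<le> p")
    case True
    then show ?thesis using Suc by (simp add: less_imp_le)
  next
    case False
    then show ?thesis using degree_prod_linear_le[of "{..<p}" r "\<lambda>_. 1"] by (simp add: coeff_eq_0)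
  qed
  have eq: "(\<Prod>i<Suc p. [:r i, 1:]) = [:r p, 1:] * (\<Prod>i<p. [:r i, 1:])" by (simp add: mult.commute)
  have rp: "r p > 0" using Suc.prems by simp
  show ?case
  proof (cases k)
    case 0
    have "coeff (\<Prod>i<p. [:r i, 1:]) 0 > 0" using Suc by simp
    then show ?thesis unfolding eq using 0 rp by simp
  next
    case (Suc j)
    have "coeff (\<Prod>i<p. [:r i, 1:]) j > 0" using Suc.IH Suc.prems \<open>k = Suc j\<close> by simp
    then have "r p * coeff (\<Prod>i<p. [:r i, 1:]) k + coeff (\<Prod>i<p. [:r i, 1:]) j > 0"
      using nonneg rp by (intro add_nonneg_pos mult_nonneg_nonneg) auto
    then show ?thesis unfolding eq using Suc by simp
  qed
qed simp

text \<open>Membership in the cone is governed by \<open>pminors p\<close> alone, along the ray in the direction of the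
  identity: a polynomial with only negative roots has positive coefficients, and these are the
  lower sums of principal minors.\<close>

lemma in_pcone_if_positive_on_ray:
  fixes M :: "'n::{finite,linorder} rmat"
  assumes M: "transpose M = M" and p: "p \<le> CARD('n)"
    and pos: "\<And>s. s \<ge> 0 \<Longrightarrow> pminors p (mat s + M) > 0"
  shows "M \<in> pcone p"
proof -
  let ?n = "CARD('n)"
  define f where "f = line_poly p (cmat M) (cmat (mat 1))"
  define c where "c = pminors p (mat 1 :: 'n rmat)"
  have c: "c > 0" unfolding c_def using mat_in_pcone[OF p, of 1] pcone_pminors_pos by auto
  have lead: "coeff f p = of_real c" by (simp add: f_def coeff_line_poly pminors_cmat c_def)
  have deg: "degree f = p"
    using degree_line_poly[of p "cmat M" "cmat (mat 1)"] le_degree[of f p] lead c by (auto simp: f_def)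
  have "f \<noteq> 0" using lead c by auto
  have line: "poly f z = pminors p (mat z + cmat M)" for z
  proof -
    have "on_line (cmat M) (cmat (mat 1)) z = mat z + cmat M"
      by (simp add: on_line_def cmat_def mat_def vec_eq_iff)
    then show ?thesis by (simp add: f_def poly_line_poly)
  qed
  have real: "poly f (of_real s) = of_real (pminors p (mat s + M))" for s
    by (simp add: line cmat_add_mat pminors_cmat)
  have "Im z = 0 \<and> Re z < 0" if "poly f z = 0" for z
  proof -
    have Im: "Im z = 0"
      using pminors_nonreal_shift_nonzero[OF M p, of z] that by (auto simp: line)
    then have "z = of_real (Re z)" by (simp add: complex_eq_iff)
    then have "pminors p (mat (Re z) + M) = 0" using real that by (metis of_real_eq_0_iff)
    then have "Re z < 0" using pos[of "Re z"] by force
    with Im show ?thesis by simp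
  qed
  then obtain r where r: "\<And>i. i < p \<Longrightarrow> r i > 0"
    "\<And>z. poly f z = lead_coeff f * (\<Prod>i<p. z + of_real (r i))"
    using poly_with_negative_roots[of f p] deg \<open>f \<noteq> 0\<close> by metis
  define P where "P = (\<Prod>i<p. [:r i, 1:])"
  have degP: "degree P = p" unfolding P_def by (subst degree_prod_eq_sum_degree) auto
  have "of_nat ((?n - q) choose (?n - p)) * pminors q M = c * coeff P (p - q)" if "q \<le> p" for q
  proof (rule top_coeffs_unique[OF _ that])
    fix s :: real
    have "(\<Sum>q\<le>p. s ^ (p - q) * (of_nat ((?n - q) choose (?n - p)) * pminors q M))
      = pminors p (mat s + M)" by (simp add: pminors_shift[OF p] mult_ac)
    also have "\<dots> = c * (\<Prod>i<p. s + r i)"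
    proof -
      have "complex_of_real (pminors p (mat s + M)) = of_real (c * (\<Prod>i<p. s + r i))"
        by (simp add: real[symmetric] r(2) deg lead)
      then show ?thesis using of_real_eq_iff by blast
    qed
    also have "\<dots> = c * poly P s" by (simp add: P_def poly_prod add.commute)
    also have "poly P s = (\<Sum>k\<le>p. coeff P k * s ^ k)" by (simp add: poly_altdef degP)
    also have "\<dots> = (\<Sum>q\<le>p. coeff P (p - q) * s ^ (p - q))"
      by (rule sum.reindex_bij_witness[of _ "\<lambda>i. p - i" "\<lambda>i. p - i"]) auto
    finally show "(\<Sum>q\<le>p. s ^ (p - q) * (of_nat ((?n - q) choose (?n - p)) * pminors q M))
      = (\<Sum>q\<le>p. s ^ (p - q) * (c * coeff P (p - q)))"
      by (simp add: sum_distrib_left mult_ac)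
  qed
  moreover have "c * coeff P (p - q) > 0" for q
    unfolding P_def using c coeff_prod_positive[of p r "p - q"] r(1) by simp
  ultimately have "of_nat ((?n - q) choose (?n - p)) * pminors q M > 0" if "q \<le> p" for q
    using that by simp
  then have "pminors q M > 0" if "q \<le> p" for q
    using that by (force simp: zero_less_mult_iff)
  then show ?thesis using M by (auto simp: pcone_def)
qed

section \<open>Eigenvalue bounds from quadratic forms\<close>

lemma eigvals_add_mat:
  fixes S :: "'n::{finite,linorder} rmat"
  assumes "transpose S = S"
  shows "eigvals (mat c + S) $ k = c + eigvals S $ k"
proof -
  obtain U where U: "mono (\<lambda>i. eigvals S $ i)" "\<And>z. det (mat z - S) = (\<Prod>i\<in>UNIV. z - eigvals S $ i)"
    using spectral_decomposition[OF assms] by metis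
  have "eigvals (mat c + S) = (\<chi> i. c + eigvals S $ i)"
  proof (rule eigvals_eqI)
    show "mono (\<lambda>i. (\<chi> i. c + eigvals S $ i) $ i)" using U(1) by (simp add: mono_def)
    fix z
    have "mat z - (mat c + S) = mat (z - c) - S" by (simp add: mat_def vec_eq_iff)
    then show "det (mat z - (mat c + S)) = (\<Prod>i\<in>UNIV. z - (\<chi> i. c + eigvals S $ i) $ i)"
      using U(2)[of "z - c"] by (simp only: vec_lambda_beta diff_diff_eq)
  qed
  then show ?thesis by simp
qed

lemma eigvals_zero: "eigvals (0 :: 'n::{finite,linorder} rmat) = 0"
proof (rule eigvals_eqI)
  fix z :: real
  have "mat z - 0 = mat z - diagm (0 :: 'n rvec)" by (simp add: diagm_def vec_eq_iff)
  then show "det (mat z - (0 :: 'n rmat)) = (\<Prod>i\<in>UNIV. z - (0 :: 'n rvec) $ i)"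
    by (simp only: det_mat_minus_diagm)
qed (simp add: mono_def)

lemma eigvals_mat: "eigvals (mat c :: 'n::{finite,linorder} rmat) $ k = c"
  using eigvals_add_mat[of "0 :: 'n rmat" c k] by (simp add: eigvals_zero transpose_def vec_eq_iff)

lemma mat_mult_vec: "mat c *v x = c *\<^sub>R (x :: real^'n)"
proof -
  have "mat c = c *\<^sub>R (mat 1 :: real^'n^'n)" by (simp add: mat_def vec_eq_iff)
  then show ?thesis by (simp flip: scaleR_matrix_vector_assoc)
qed

lemma eigvals_ge:
  fixes S :: "'n::{finite,linorder} rmat"
  assumes "transpose S = S" "\<And>x. l * (x \<bullet> x) \<le> x \<bullet> (S *v x)"
  shows "l \<le> eigvals S $ k"
  using eigvals_mono[of "mat l" S k] assms by (simp add: eigvals_mat mat_mult_vec)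

lemma eigvals_le:
  fixes S :: "'n::{finite,linorder} rmat"
  assumes "transpose S = S" "\<And>x. x \<bullet> (S *v x) \<le> l * (x \<bullet> x)"
  shows "eigvals S $ k \<le> l"
  using eigvals_mono[of S "mat l" k] assms by (simp add: eigvals_mat mat_mult_vec)

lemma quadratic_form_bounds:
  fixes S :: "'n::{finite,linorder} rmat"
  assumes S: "transpose S = S"
  shows "(\<And>k. l \<le> eigvals S $ k) \<Longrightarrow> l * (x \<bullet> x) \<le> x \<bullet> (S *v x)"
    and "(\<And>k. eigvals S $ k \<le> l) \<Longrightarrow> x \<bullet> (S *v x) \<le> l * (x \<bullet> x)"
proof -
  obtain U where U: "orthogonal_matrix U" "S = U ** diagm (eigvals S) ** transpose U"
    using spectral_decomposition[OF S] by metis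
  have xx: "l * (x \<bullet> x) = (\<Sum>i\<in>UNIV. l * ((transpose U *v x) $ i)\<^sup>2)"
    unfolding inner_orthogonal_matrix[OF U(1), of x x, symmetric]
    by (simp add: inner_vec_def sum_distrib_left power2_eq_square)
  have xS: "x \<bullet> (S *v x) = (\<Sum>i\<in>UNIV. eigvals S $ i * ((transpose U *v x) $ i)\<^sup>2)"
    using quadratic_form_in_eigenframe[of x U "eigvals S", folded U(2)] .
  show "l * (x \<bullet> x) \<le> x \<bullet> (S *v x)" if "\<And>k. l \<le> eigvals S $ k"
    unfolding xx xS by (intro sum_mono mult_right_mono that) auto
  show "x \<bullet> (S *v x) \<le> l * (x \<bullet> x)" if "\<And>k. eigvals S $ k \<le> l"
    unfolding xx xS by (intro sum_mono mult_right_mono that) auto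
qed

section \<open>The positive cone of vectors\<close>

lemma esym_card: "esym CARD('n) (\<mu> :: real^'n) = (\<Prod>i\<in>UNIV. \<mu> $ i)"
proof -
  have "{J :: 'n set. J \<subseteq> UNIV \<and> card J = CARD('n)} = {UNIV}"
    using card_subset_eq[OF finite[of "UNIV :: 'n set"]] by blast
  then show ?thesis by (simp add: esym_def)
qed

lemma esym_nonneg: "(\<And>i. 0 \<le> \<mu> $ i) \<Longrightarrow> 0 \<le> esym q (\<mu> :: real^'n)"
  unfolding esym_def by (intro sum_nonneg prod_nonneg) auto

lemma positive_in_Gamma_card:
  fixes \<mu> :: "real^'n"
  assumes "\<And>i. \<mu> $ i > 0"
  shows "\<mu> \<in> Gamma_cone CARD('n)"
proof -
  have "esym q \<mu> > 0" if "q \<in> {1..CARD('n)}" for q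
    unfolding esym_def
  proof (rule sum_pos)
    from that have "q \<le> CARD('n)" by simp
    from obtain_subset_with_card_n[OF this] obtain J :: "'n set" where "J \<subseteq> UNIV" "card J = q"
      by metis
    then show "{J :: 'n set. J \<subseteq> UNIV \<and> card J = q} \<noteq> {}" by blast
  qed (auto intro!: prod_pos assms)
  then show ?thesis by (simp add: Gamma_cone_def)
qed

text \<open>All coefficients of the polynomial \<open>\<Prod>i. z + \<mu> $ i\<close> are positive, so it has no root \<open>z = - \<mu> $ k \<ge> 0\<close>.\<close>

lemma Gamma_card_positive:
  fixes \<mu> :: "real^'n"
  assumes "\<mu> \<in> Gamma_cone CARD('n)"
  shows "\<mu> $ k > 0"
proof (rule ccontr)
  assume neg: "\<not> \<mu> $ k > 0"
  define z where "z = - \<mu> $ k"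
  have z: "z \<ge> 0" using neg by (simp add: z_def)
  have e0: "esym 0 \<mu> = 1"
  proof -
    have "{J :: 'n set. J \<subseteq> UNIV \<and> card J = 0} = {{}}" by auto
    then show ?thesis by (simp add: esym_def)
  qed
  have pos: "esym q \<mu> > 0" if "q \<le> CARD('n)" for q
    using assms that e0 by (cases "q = 0") (auto simp: Gamma_cone_def)
  have "0 < (\<Sum>q\<le>CARD('n). z ^ (CARD('n) - q) * esym q \<mu>)"
    using pos z by (intro sum_pos2[of _ "CARD('n)"]) (auto simp: less_imp_le)
  also have "\<dots> = (\<Prod>i\<in>UNIV. z + \<mu> $ i)" using prod_shift_eq_esym[of z \<mu>] by simp
  also have "\<dots> = 0" by (auto intro!: bexI[of _ k] simp: z_def)
  finally show False by simp
qed

lemma closure_Gamma_card_nonneg: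
  fixes \<mu> :: "real^'n"
  assumes "\<mu> \<in> closure (Gamma_cone CARD('n))"
  shows "\<mu> $ k \<ge> 0"
proof -
  have "closure (Gamma_cone CARD('n)) \<subseteq> {\<mu> :: real^'n. 0 \<le> \<mu> $ k}"
    by (intro closure_minimal closed_Collect_le continuous_intros)
      (auto intro: less_imp_le Gamma_card_positive)
  then show ?thesis using assms by auto
qed

section \<open>Orthonormal frames for an inner product\<close>

text \<open>The bilinear form \<open>B\<close> in the frame formed by the columns of \<open>Q\<close>.\<close>

definition pullback :: "real^'n^'n \<Rightarrow> real^'n^'n \<Rightarrow> real^'n^'n" where
  "pullback Q B = transpose Q ** B ** Q"

definition pos_def :: "real^'n^'n \<Rightarrow> bool" where
  "pos_def G \<longleftrightarrow> transpose G = G \<and> (\<forall>v. v \<noteq> 0 \<longrightarrow> v \<bullet> (G *v v) > 0)"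

text \<open>Eigenvectors of \<open>G\<close>, rescaled by the inverse square roots of their eigenvalues.\<close>

lemma orthonormal_frame_exists:
  fixes G :: "'n::{finite,linorder} rmat"
  assumes "pos_def G"
  obtains Q where "pullback Q G = mat 1"
proof -
  have sym: "transpose G = G" using assms by (simp add: pos_def_def)
  obtain U where U: "orthogonal_matrix U" "G = U ** diagm (eigvals G) ** transpose U"
    using spectral_decomposition[OF sym] by metis
  define \<mu> where "\<mu> = eigvals G"
  have UU: "transpose U ** U = mat 1" using U(1) by (simp add: orthogonal_matrix_def)
  have pos: "\<mu> $ k > 0" for k
  proof -
    let ?u = "U *v axis k 1"
    have u: "transpose U *v ?u = axis k 1"
      by (simp only: matrix_vector_mul_assoc UU matrix_vector_mul_lid)
    then have "?u \<noteq> 0" by (metis axis_eq_0_iff matrix_vector_mult_0_right zero_neq_one)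
    then have "?u \<bullet> (G *v ?u) > 0" using assms by (simp add: pos_def_def)
    also have "?u \<bullet> (G *v ?u) = (\<Sum>i\<in>UNIV. \<mu> $ i * ((transpose U *v ?u) $ i)\<^sup>2)"
      using quadratic_form_in_eigenframe[of ?u U "eigvals G", folded U(2)] unfolding \<mu>_def .
    also have "\<dots> = (\<Sum>i\<in>UNIV. if i = k then \<mu> $ k else 0)"
      unfolding u by (intro sum.cong) (auto simp: axis_def)
    finally show ?thesis by simp
  qed
  define E where "E = diagm (\<chi> i. 1 / sqrt (\<mu> $ i))"
  define Q where "Q = U ** E"
  have E: "transpose E = E" by (auto simp: E_def diagm_def transpose_def vec_eq_iff)
  have "pullback Q G = E ** (transpose U ** U) ** diagm \<mu> ** (transpose U ** U) ** E"
    unfolding pullback_def Q_def matrix_transpose_mul E \<mu>_def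
    by (subst U(2)) (simp only: matrix_mul_assoc)
  also have "\<dots> = E ** diagm \<mu> ** E" by (simp add: UU)
  also have "\<dots> = mat 1"
  proof -
    have "1 / sqrt (\<mu> $ i) * \<mu> $ i * (1 / sqrt (\<mu> $ i)) = 1" for i
      using pos[of i] by (simp add: field_simps)
    then show ?thesis
      by (simp add: E_def diagm_def mat_def matrix_matrix_mult_def vec_eq_iff if_distrib[of "\<lambda>a. a * _"]
        if_distrib[of "\<lambda>a. _ * a"] cong: if_cong)
  qed
  finally show ?thesis using that by blast
qed

lemma frame_inverse:
  fixes G :: "real^'n^'n"
  assumes "pullback Q G = mat 1"
  shows "Q ** (transpose Q ** G) = mat 1" "matrix_inv G = Q ** transpose Q" "G ** (Q ** transpose Q) = mat 1"
proof -
  show 1: "Q ** (transpose Q ** G) = mat 1"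
    using assms matrix_left_right_inverse unfolding pullback_def by blast
  then have 2: "(Q ** transpose Q) ** G = mat 1" by (simp only: matrix_mul_assoc)
  then show 3: "G ** (Q ** transpose Q) = mat 1" using matrix_left_right_inverse by blast
  have "G ** matrix_inv G = mat 1"
    unfolding matrix_inv_def using someI_ex[of "\<lambda>A'. G ** A' = mat 1 \<and> A' ** G = mat 1"] 2 3 by blast
  moreover have "matrix_inv G = (Q ** transpose Q ** G) ** matrix_inv G" using 2 by simp
  then have "matrix_inv G = Q ** transpose Q ** (G ** matrix_inv G)" by (simp only: matrix_mul_assoc)
  ultimately show "matrix_inv G = Q ** transpose Q" by simp
qed

lemma pullback_linear:
  "pullback Q (A + B) = pullback Q A + pullback Q B"
  "pullback Q (A - B) = pullback Q A - pullback Q B"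
  "pullback Q (c *\<^sub>R A) = c *\<^sub>R pullback Q A"
  by (simp_all add: pullback_def matrix_add_ldistrib matrix_plus_rdistrib matrix_minus_ldistrib
    matrix_minus_rdistrib matrix_scalar_ac scalar_matrix_assoc[symmetric])

lemma transpose_pullback: "transpose B = B \<Longrightarrow> transpose (pullback Q B) = pullback Q B"
  by (simp add: pullback_def matrix_transpose_mul matrix_mul_assoc)

lemma quadratic_form_pullback: "x \<bullet> (pullback Q B *v x) = (Q *v x) \<bullet> (B *v (Q *v x))"
proof -
  have "x \<bullet> (pullback Q B *v x) = x \<bullet> (transpose Q *v (B *v (Q *v x)))"
    by (simp only: pullback_def matrix_vector_mul_assoc matrix_mul_assoc)
  then show ?thesis by (simp only: inner_matrix_mult_left[of x "transpose Q"] transpose_transpose)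
qed

text \<open>The two matrices are conjugate by \<open>Q\<close>.\<close>

lemma eigvals_frame:
  fixes G :: "'n::{finite,linorder} rmat"
  assumes Q: "pullback Q G = mat 1"
  shows "eigvals (matrix_inv G ** B) = eigvals (pullback Q B)"
proof -
  have "matrix_inv G ** B = Q ** (transpose Q ** B)" 
    by (simp only: frame_inverse(2)[OF Q] matrix_mul_assoc)
  also have "\<dots> = Q ** (transpose Q ** B) ** (Q ** (transpose Q ** G))"
    by (simp only: frame_inverse(1)[OF Q] matrix_mul_rid)
  also have "\<dots> = Q ** pullback Q B ** (transpose Q ** G)"
    by (simp only: pullback_def matrix_mul_assoc)
  finally have "det (mat z - matrix_inv G ** B) = det (mat z - pullback Q B)" for z
    using det_mat_minus_similar[OF frame_inverse(1)[OF Q]] by simp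
  then show ?thesis by (simp add: eigvals_def)
qed

lemma esym_eigvals_frame:
  fixes G :: "'n::{finite,linorder} rmat"
  assumes "pullback Q G = mat 1" "transpose B = B" "q \<le> CARD('n)"
  shows "esym q (eigvals (matrix_inv G ** B)) = pminors q (pullback Q B)"
  using assms pminors_eq_esym_eigvals[OF transpose_pullback[OF assms(2)] assms(3)]
  by (simp add: eigvals_frame)

lemma Gamma_cone_frame:
  fixes G :: "'n::{finite,linorder} rmat"
  assumes "pullback Q G = mat 1" "transpose B = B" "p \<le> CARD('n)"
  shows "eigvals (matrix_inv G ** B) \<in> Gamma_cone p \<longleftrightarrow> pullback Q B \<in> pcone p"
  using assms by (auto simp: Gamma_cone_def pcone_def esym_eigvals_frame transpose_pullback)

section \<open>The linearised operator\<close>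

text \<open>\<open>Fmat\<close> at a point, as a function of the matrices of the metric and of the bilinear form alone.\<close>

definition lin_op :: "'n::{finite,linorder} rmat \<Rightarrow> nat \<Rightarrow> 'n rmat \<Rightarrow> 'n rmat" where
  "lin_op G p B0 = (\<chi> j k. frechet_derivative
     (\<lambda>B. root p (esym p (eigvals ((1/2) *\<^sub>R (matrix_inv G ** (B + transpose B))))))
     (at B0) (axis j (axis k 1)))"

lemma contract_linear:
  "contract F (A + B) = contract F A + contract F B"
  "contract F (A - B) = contract F A - contract F B"
  "contract F (c *\<^sub>R A) = c * contract F A"
  by (simp_all add: contract_def algebra_simps sum.distrib sum_subtractf sum_distrib_left)

lemma matrix_unit_expansion:
  fixes H :: "real^'n^'m"
  shows "H = (\<Sum>j\<in>UNIV. \<Sum>k\<in>UNIV. H $ j $ k *\<^sub>R axis j (axis k 1))"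
proof -
  have "(\<Sum>j\<in>UNIV. \<Sum>k\<in>UNIV. H $ j $ k *\<^sub>R axis j (axis k (1::real))) $ a $ b
      = H $ a $ b" for a b
  proof -
    have "(\<Sum>j\<in>UNIV. \<Sum>k\<in>UNIV. H $ j $ k *\<^sub>R axis j (axis k (1::real))) $ a $ b
      = (\<Sum>j\<in>UNIV. if j = a then (\<Sum>k\<in>UNIV. if k = b then H $ a $ b else 0) else 0)"
      unfolding sum_component by (intro sum.cong refl) (auto simp: axis_def if_distrib cong: if_cong)
    then show ?thesis by simp
  qed
  then show ?thesis by (simp add: vec_eq_iff)
qed

lemma differentiable_pminors: "(\<lambda>M. pminors p (M :: real^'n^'n)) differentiable (at M)"
proof -
  have comp: "((\<lambda>M :: real^'n^'n. M $ i $ j) has_derivative (\<lambda>M. M $ i $ j)) (at M)" for i j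
    by (intro bounded_linear_imp_has_derivative bounded_linear_compose[OF bounded_linear_vec_nth bounded_linear_vec_nth])
  show ?thesis
    unfolding pminors_def differentiable_def
    by (rule exI, rule has_derivative_sum, rule has_derivative_sum, rule has_derivative_mult,
      rule has_derivative_const, rule has_derivative_prod, rule comp)
qed

text \<open>The eigenvalues enter only through the sum of principal minors, which is a polynomial in the entries of the
  symmetrised matrix; so the \<open>p\<close>-th root is differentiable where its value is positive.\<close>

lemma lin_op_has_derivative:
  fixes G :: "'n::{finite,linorder} rmat"
  assumes Q: "pullback Q G = mat 1" and p: "p \<in> {1..CARD('n)}" and sym: "transpose B0 = B0"
    and pos: "pminors p (pullback Q B0) > 0"
  shows "((\<lambda>s. root p (pminors p (pullback Q (B0 + s *\<^sub>R ((1/2) *\<^sub>R (H + transpose H))))))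
    has_real_derivative contract (lin_op G p B0) H) (at 0)"
proof -
  define \<Phi> where "\<Phi> B = root p (esym p (eigvals ((1/2) *\<^sub>R (matrix_inv G ** (B + transpose B)))))" for B
  define S where "S B = pullback Q ((1/2) *\<^sub>R (B + transpose B))" for B
  have \<Phi>: "\<Phi> B = root p (pminors p (S B))" for B
  proof -
    have "(1/2) *\<^sub>R (matrix_inv G ** (B + transpose B)) = matrix_inv G ** ((1/2) *\<^sub>R (B + transpose B))"
      by (simp only: matrix_scalar_ac scalar_matrix_assoc)
    moreover have "transpose ((1/2) *\<^sub>R (B + transpose B)) = (1/2) *\<^sub>R (B + transpose B)"
      by (simp add: transpose_scalar transpose_add_diff add.commute)
    ultimately show ?thesis unfolding \<Phi>_def S_def
      using esym_eigvals_frame[OF Q, of "(1/2) *\<^sub>R (B + transpose B)" p] p by simp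
  qed
  have S_lin: "linear S"
    by (rule linearI) (simp_all add: S_def pullback_linear transpose_add_diff transpose_scalar algebra_simps)
  have S0: "S B0 = pullback Q B0" by (simp add: S_def sym flip: scaleR_2)
  have "(\<lambda>M. pminors p M) differentiable (at (S B0))" by (rule differentiable_pminors)
  moreover have "(root p) differentiable (at (pminors p (S B0)))"
    using DERIV_real_root[of p "pminors p (S B0)"] p pos S0
    by (auto intro!: has_field_derivative_imp_has_derivative simp: differentiable_def)
  moreover have "S differentiable (at B0)" using S_lin
    by (metis differentiable_def linear_imp_has_derivative)
  ultimately have "(root p \<circ> ((\<lambda>M. pminors p M) \<circ> S)) differentiable (at B0)"
    by (intro differentiable_chain_at) (auto simp: o_def)
  also have "root p \<circ> ((\<lambda>M. pminors p M) \<circ> S) = \<Phi>" by (auto simp: \<Phi>)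
  finally have D: "(\<Phi> has_derivative frechet_derivative \<Phi> (at B0)) (at B0)"
    using frechet_derivative_works by blast
  then have lin: "linear (frechet_derivative \<Phi> (at B0))"
    using has_derivative_linear by blast
  have "frechet_derivative \<Phi> (at B0) H
      = (\<Sum>j\<in>UNIV. \<Sum>k\<in>UNIV. H $ j $ k * frechet_derivative \<Phi> (at B0) (axis j (axis k 1)))"
    by (subst matrix_unit_expansion[of H]) (simp add: linear_sum[OF lin] linear_scale[OF lin])
  also have "\<dots> = contract (lin_op G p B0) H"
    by (simp add: contract_def lin_op_def \<Phi>_def[abs_def] mult.commute)
  finally have val: "frechet_derivative \<Phi> (at B0) H = contract (lin_op G p B0) H" .
  have "((\<lambda>s. B0 + s *\<^sub>R H) has_derivative (\<lambda>s. s *\<^sub>R H)) (at 0)"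
    by (auto intro!: derivative_eq_intros)
  from has_derivative_compose[OF this, of \<Phi> "frechet_derivative \<Phi> (at B0)"] D
  have "((\<lambda>s. \<Phi> (B0 + s *\<^sub>R H)) has_derivative (\<lambda>s. frechet_derivative \<Phi> (at B0) (s *\<^sub>R H))) (at 0)"
    by simp
  then have "((\<lambda>s. \<Phi> (B0 + s *\<^sub>R H)) has_real_derivative contract (lin_op G p B0) H) (at 0)"
    by (rule has_derivative_imp_has_field_derivative) (simp add: linear_scale[OF lin] val)
  moreover have "\<Phi> (B0 + s *\<^sub>R H) = root p (pminors p (pullback Q (B0 + s *\<^sub>R ((1/2) *\<^sub>R (H + transpose H)))))" for s
  proof -
    have "(1/2) *\<^sub>R ((B0 + s *\<^sub>R H) + transpose (B0 + s *\<^sub>R H)) = B0 + s *\<^sub>R ((1/2) *\<^sub>R (H + transpose H))"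
      by (simp add: transpose_add_diff transpose_scalar sym vec_eq_iff field_simps)
    then show ?thesis by (simp add: \<Phi> S_def)
  qed
  ultimately show ?thesis by simp
qed

lemma lin_op_symmetric_direction:
  fixes G :: "'n::{finite,linorder} rmat"
  assumes Q: "pullback Q G = mat 1" and p: "p \<in> {1..CARD('n)}"
    and B: "transpose B = B" "pullback Q B \<in> pcone p" and H: "transpose H = H"
  shows "((\<lambda>s. root p (pminors p (pullback Q B + s *\<^sub>R pullback Q H)))
    has_real_derivative contract (lin_op G p B) H) (at 0)"
proof -
  have "(1/2) *\<^sub>R (H + transpose H) = H" by (simp add: H flip: scaleR_2)
  then show ?thesis
    using lin_op_has_derivative[OF Q p B(1) pcone_pminors_pos[OF B(2)], of H]
    by (simp add: pullback_linear)
qed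

lemma lin_op_ge_on_cone:
  fixes G :: "'n::{finite,linorder} rmat"
  assumes Q: "pullback Q G = mat 1" and p: "p \<in> {1..CARD('n)}"
    and B: "transpose B = B" "pullback Q B \<in> pcone p"
    and H: "transpose H = H" "pullback Q H \<in> pcone p"
  shows "root p (pminors p (pullback Q H)) \<le> contract (lin_op G p B) H"
  using garding_inequality[OF H(2) B(2) p lin_op_symmetric_direction[OF Q p B H(1)]] .

text \<open>Euler's identity for a function that is homogeneous of degree one.\<close>

lemma lin_op_euler:
  fixes G :: "'n::{finite,linorder} rmat"
  assumes Q: "pullback Q G = mat 1" and p: "p \<in> {1..CARD('n)}"
    and B: "transpose B = B" "pullback Q B \<in> pcone p"
  shows "contract (lin_op G p B) B = root p (pminors p (pullback Q B))"
proof -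
  let ?S = "pullback Q B"
  have eq: "root p (pminors p (?S + s *\<^sub>R ?S)) = (1 + s) * root p (pminors p ?S)" if "s > -1" for s
  proof -
    have "?S + s *\<^sub>R ?S = (1 + s) *\<^sub>R ?S" by (simp add: algebra_simps)
    then show ?thesis using that p
      by (simp add: pminors_scaleR real_root_mult real_root_power_cancel)
  qed
  have "((\<lambda>s. (1 + s) * root p (pminors p ?S)) has_real_derivative root p (pminors p ?S)) (at 0)"
    by (auto intro!: derivative_eq_intros)
  then have "((\<lambda>s. root p (pminors p (?S + s *\<^sub>R ?S))) has_real_derivative root p (pminors p ?S)) (at 0)"
    by (rule has_field_derivative_transform_within_open[of _ _ _ "{-1<..}"]) (auto simp: eq)
  with lin_op_symmetric_direction[OF Q p B B(1)] show ?thesis by (rule DERIV_unique)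
qed

lemma pcone_if_psd:
  fixes M :: "'n::{finite,linorder} rmat"
  assumes M: "transpose M = M" "\<And>x. 0 \<le> x \<bullet> (M *v x)" and p: "p \<le> CARD('n)"
  shows "q \<le> p \<Longrightarrow> pminors q M \<ge> 0" "r > 0 \<Longrightarrow> mat r + M \<in> pcone p"
proof -
  have eig: "0 \<le> eigvals M $ k" for k using eigvals_ge[of M 0 k] M by simp
  show nonneg: "pminors q M \<ge> 0" if "q \<le> p" for q
    using pminors_eq_esym_eigvals[OF M(1), of q] esym_nonneg[of "eigvals M" q, OF eig] that p by simp
  show "r > 0 \<Longrightarrow> mat r + M \<in> pcone p"
    using pcone_shift_strict[OF M(1) p] nonneg by simp
qed

text \<open>For every \<open>e > 0\<close>, the form \<open>K + e G\<close> is positive definite and hence lies in the cone, where the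
  derivative is nonnegative by Garding's inequality.\<close>

lemma lin_op_nonneg:
  fixes G :: "'n::{finite,linorder} rmat"
  assumes Q: "pullback Q G = mat 1" and G: "transpose G = G" and p: "p \<in> {1..CARD('n)}"
    and B: "transpose B = B" "pullback Q B \<in> pcone p"
    and K: "transpose K = K" "\<And>x. 0 \<le> x \<bullet> (K *v x)"
  shows "0 \<le> contract (lin_op G p B) K"
proof -
  have eps: "0 \<le> contract (lin_op G p B) K + e * contract (lin_op G p B) G" if "e > 0" for e
  proof -
    have "pullback Q (K + e *\<^sub>R G) = mat e + pullback Q K"
      by (simp add: pullback_linear Q) (simp add: mat_def vec_eq_iff)
    moreover have "mat e + pullback Q K \<in> pcone p"
      using p that by (intro pcone_if_psd transpose_pullback K) (auto simp: quadratic_form_pullback K)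
    moreover have "transpose (K + e *\<^sub>R G) = K + e *\<^sub>R G"
      by (simp add: transpose_add_diff transpose_scalar K G)
    ultimately have sym: "transpose (K + e *\<^sub>R G) = K + e *\<^sub>R G"
      and cone: "pullback Q (K + e *\<^sub>R G) \<in> pcone p" by simp_all
    have "0 \<le> root p (pminors p (pullback Q (K + e *\<^sub>R G)))"
      by (intro real_root_ge_zero less_imp_le pcone_pminors_pos[OF cone])
    also have "\<dots> \<le> contract (lin_op G p B) (K + e *\<^sub>R G)"
      by (rule lin_op_ge_on_cone[OF Q p B sym cone])
    finally show ?thesis by (simp add: contract_linear)
  qed
  have "((\<lambda>e. contract (lin_op G p B) K + e * contract (lin_op G p B) G) \<longlongrightarrow>
      contract (lin_op G p B) K + 0 * contract (lin_op G p B) G) (at_right 0)"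
    by (intro tendsto_intros)
  then have "((\<lambda>e. contract (lin_op G p B) K + e * contract (lin_op G p B) G) \<longlongrightarrow>
      contract (lin_op G p B) K) (at_right 0)" by simp
  moreover have "eventually (\<lambda>e. 0 \<le> contract (lin_op G p B) K + e * contract (lin_op G p B) G) (at_right (0::real))"
    by (rule eventually_mono[OF eventually_at_right_less]) (rule eps)
  ultimately show ?thesis by (intro tendsto_lowerbound[of _ _ "at_right (0::real)"]) auto
qed

text \<open>The differentiated function depends only on the symmetric part of its argument.\<close>

lemma lin_op_symmetric:
  fixes G :: "'n::{finite,linorder} rmat"
  assumes Q: "pullback Q G = mat 1" and p: "p \<in> {1..CARD('n)}"
    and B: "transpose B = B" "pullback Q B \<in> pcone p"
  shows "transpose (lin_op G p B) = lin_op G p B"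
proof -
  have "contract (lin_op G p B) (transpose H) = contract (lin_op G p B) H" for H
    using lin_op_has_derivative[OF Q p B(1) pcone_pminors_pos[OF B(2)], of H]
      lin_op_has_derivative[OF Q p B(1) pcone_pminors_pos[OF B(2)], of "transpose H"]
    by (simp add: add.commute) (metis DERIV_unique)
  moreover have "contract F (axis j (axis k 1)) = F $ j $ k" for F :: "'n rmat" and j k
  proof -
    have "contract F (axis j (axis k 1)) = (\<Sum>a\<in>UNIV. if a = j then (\<Sum>b\<in>UNIV. if b = k then F $ j $ k else 0) else 0)"
      unfolding contract_def by (intro sum.cong refl) (auto simp: axis_def if_distrib cong: if_cong)
    then show ?thesis by simp
  qed
  moreover have "transpose (axis j (axis k 1)) = (axis k (axis j 1) :: 'n rmat)" for j k
    by (auto simp: transpose_def axis_def vec_eq_iff)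
  ultimately have "lin_op G p B $ k $ j = lin_op G p B $ j $ k" for j k by metis
  then show ?thesis by (simp add: transpose_def vec_eq_iff)
qed

definition outer :: "real^'n \<Rightarrow> real^'n^'n" where
  "outer w = (\<chi> i j. w $ i * w $ j)"

lemma transpose_outer: "transpose (outer w) = outer w"
  by (simp add: outer_def transpose_def vec_eq_iff mult.commute)

lemma outer_mult_vec: "outer w *v x = (w \<bullet> x) *\<^sub>R w"
  by (simp add: outer_def matrix_vector_mult_def vec_eq_iff inner_vec_def sum_distrib_left mult_ac)

lemma contract_outer: "contract F (outer w) = w \<bullet> (F *v w)"
  by (simp add: contract_def outer_def matrix_vector_mult_def inner_vec_def sum_distrib_left mult_ac)

lemma pullback_outer: "pullback Q (outer w) = outer (transpose Q *v w)"
proof -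
  have "pullback Q (outer w) $ a $ b = outer (transpose Q *v w) $ a $ b" for a b
  proof -
    have "pullback Q (outer w) $ a $ b = (\<Sum>k\<in>UNIV. (\<Sum>i\<in>UNIV. Q $ i $ a * (w $ i * w $ k)) * Q $ k $ b)"
      by (simp add: pullback_def outer_def matrix_matrix_mult_def transpose_def)
    also have "\<dots> = (\<Sum>i\<in>UNIV. Q $ i $ a * w $ i) * (\<Sum>k\<in>UNIV. Q $ k $ b * w $ k)"
      by (simp add: sum_distrib_left sum_distrib_right mult_ac)
    also have "\<dots> = outer (transpose Q *v w) $ a $ b"
      by (simp add: outer_def matrix_vector_mult_def transpose_def del: transpose_matrix_vector)
    finally show ?thesis .
  qed
  then show ?thesis by (simp add: vec_eq_iff)
qed

text \<open>In an orthonormal frame for \<open>G\<close>, the product \<open>F ** G\<close> becomes a symmetric matrix, so that its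
  least eigenvalue exists; an eigenvector \<open>v\<close> yields the rank-one direction \<open>outer (G *v v)\<close> along which
  \<open>F\<close> takes this value.\<close>

lemma min_eigval_direction:
  fixes F G :: "'n::{finite,linorder} rmat"
  assumes Q: "pullback Q G = mat 1" and G: "pos_def G" and F: "transpose F = F"
  obtains v where "v \<bullet> (G *v v) = 1" "contract F (outer (G *v v)) = min_eigval (F ** G)"
proof -
  have Gsym: "transpose G = G" using G by (simp add: pos_def_def)
  define E where "E = {z. \<exists>v. v \<noteq> 0 \<and> (F ** G) *v v = z *\<^sub>R v}"
  define S where "S = pullback (G ** Q) F"
  have S: "transpose S = S" unfolding S_def by (rule transpose_pullback[OF F])
  obtain U where U: "\<And>z. det (mat z - S) = (\<Prod>i\<in>UNIV. z - eigvals S $ i)"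
    using spectral_decomposition[OF S] by metis
  have QS: "Q ** S ** (transpose Q ** G) = F ** G"
  proof -
    have "Q ** S ** (transpose Q ** G) = (Q ** (transpose Q ** G)) ** F ** G ** (Q ** (transpose Q ** G))"
      unfolding S_def pullback_def matrix_transpose_mul Gsym by (simp only: matrix_mul_assoc)
    then show ?thesis by (simp only: frame_inverse(1)[OF Q] matrix_mul_lid matrix_mul_rid)
  qed
  have det: "det (mat z - F ** G) = (\<Prod>i\<in>UNIV. z - eigvals S $ i)" for z
    using det_mat_minus_similar[OF frame_inverse(1)[OF Q], of z S] by (simp only: QS U)
  have E_iff: "z \<in> E \<longleftrightarrow> det (mat z - F ** G) = 0" for z
  proof -
    have "z \<in> E \<longleftrightarrow> (\<exists>v. v \<noteq> 0 \<and> (mat z - F ** G) *v v = 0)"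
      by (auto simp: E_def matrix_vector_mult_diff_rdistrib mat_mult_vec)
    also have "\<dots> \<longleftrightarrow> \<not> invertible (mat z - F ** G)"
      unfolding invertible_left_inverse matrix_left_invertible_ker by blast
    finally show ?thesis by (simp add: invertible_det_nz)
  qed
  have "E = range (\<lambda>i. eigvals S $ i)" by (auto simp: E_iff det)
  then have "finite E" "E \<noteq> {}" by auto
  then have "min_eigval (F ** G) \<in> E"
    unfolding min_eigval_def E_def[symmetric] by (rule Min_in)
  then obtain v where v: "v \<noteq> 0" "(F ** G) *v v = min_eigval (F ** G) *\<^sub>R v"
    by (auto simp: E_def)
  define c where "c = v \<bullet> (G *v v)"
  have c: "c > 0" using G v(1) by (simp add: pos_def_def c_def)
  define w where "w = (1 / sqrt c) *\<^sub>R v"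
  have w1: "w \<bullet> (G *v w) = 1"
    using c by (simp add: w_def matrix_vector_mult_scaleR c_def[symmetric] field_simps)
  have w2: "F *v (G *v w) = min_eigval (F ** G) *\<^sub>R w"
    using v(2) by (simp add: w_def matrix_vector_mult_scaleR matrix_vector_mul_assoc)
  have "contract F (outer (G *v w)) = min_eigval (F ** G) * (w \<bullet> (G *v w))"
    by (simp add: contract_outer w2 inner_commute)
  with w1 that[of w] show ?thesis by simp
qed

section \<open>Subsolutions at a point\<close>

lemma norm_component_less: "\<mu> \<in> ball 0 R \<Longrightarrow> \<mu> $ k < R" for \<mu> :: "real^'n"
  using component_le_norm_cart[of \<mu> k] by simp

lemma subsolution_bounds_eigvals:
  fixes \<nu> \<mu> :: "'n::{finite,linorder} rvec"
  assumes sub: "{\<mu>. \<mu> \<in> Gamma_cone p \<and> root p (esym p \<mu>) = \<phi>}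
      \<inter> ({\<nu> - \<delta> *\<^sub>R (\<chi> i. 1)} + Gamma_cone CARD('n)) \<subseteq> ball 0 R"
    and \<mu>: "\<mu> \<in> Gamma_cone p" "root p (esym p \<mu>) = \<phi>" "\<And>k. \<nu> $ k - \<delta> < \<mu> $ k"
  shows "\<mu> $ k < R"
proof -
  have "\<mu> = (\<nu> - \<delta> *\<^sub>R (\<chi> i. 1)) + (\<chi> i. \<mu> $ i - (\<nu> $ i - \<delta>))"
    by (simp add: vec_eq_iff)
  moreover have "(\<chi> i. \<mu> $ i - (\<nu> $ i - \<delta>)) \<in> Gamma_cone CARD('n)"
    using \<mu>(3) by (intro positive_in_Gamma_card) simp
  ultimately have "\<mu> \<in> {\<nu> - \<delta> *\<^sub>R (\<chi> i. 1)} + Gamma_cone CARD('n)"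
    unfolding set_plus_def by blast
  then show ?thesis using sub \<mu>(1,2) norm_component_less by blast
qed

lemma last_crossing:
  fixes h :: "real \<Rightarrow> real"
  assumes "continuous_on UNIV h" "h s1 < c" "\<And>s. s \<ge> s2 \<Longrightarrow> h s > c"
  obtains s where "s \<ge> s1" "h s = c" "\<And>t. t \<ge> s \<Longrightarrow> h t \<ge> c"
proof -
  define Z where "Z = {s. s1 \<le> s \<and> h s \<le> c}"
  have "closed Z" unfolding Z_def
    by (intro closed_Collect_conj closed_Collect_le continuous_intros assms(1))
  moreover have ne: "s1 \<in> Z" using assms(2) by (simp add: Z_def)
  moreover have bdd: "bdd_above Z"
  proof (rule bdd_aboveI[of _ s2])
    fix s assume "s \<in> Z"
    then have "\<not> h s > c" by (simp add: Z_def)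
    then show "s \<le> s2" using assms(3)[of s] by linarith
  qed
  ultimately have in_Z: "Sup Z \<in> Z" by (intro closed_contains_Sup) auto
  have above: "h t > c" if "t > Sup Z" for t
    using that cSup_upper[OF _ bdd, of t] cSup_upper[OF ne bdd] by (force simp: Z_def)
  have "(h \<longlongrightarrow> h (Sup Z)) (at_right (Sup Z))"
    using assms(1) by (simp add: continuous_on_eq_continuous_at isCont_def filterlim_at_split)
  moreover have "eventually (\<lambda>t. c \<le> h t) (at_right (Sup Z))"
    using above by (auto simp: eventually_at_filter less_imp_le)
  ultimately have "c \<le> h (Sup Z)" by (intro tendsto_lowerbound[of h _ "at_right (Sup Z)"]) auto
  with in_Z have "h (Sup Z) = c" "s1 \<le> Sup Z" by (auto simp: Z_def)
  moreover have "h t \<ge> c" if "t \<ge> Sup Z" for t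
    using above[of t] that \<open>h (Sup Z) = c\<close> by (cases "t = Sup Z") auto
  ultimately show ?thesis using that by blast
qed

lemma pminors_shift_ge_power:
  fixes M :: "'n::{finite,linorder} rmat"
  assumes "p \<le> CARD('n)" "r \<ge> 0" "\<And>q. q \<le> p \<Longrightarrow> pminors q M \<ge> 0"
  shows "r ^ p \<le> pminors p (mat r + M)"
proof -
  have "1 \<le> CARD('n) choose (CARD('n) - p)" using zero_less_binomial[of "CARD('n) - p" "CARD('n)"] by (simp add: Suc_le_eq)
  then have "1 * r ^ p \<le> real (CARD('n) choose (CARD('n) - p)) * r ^ p"
    using assms(2) by (intro mult_right_mono) auto
  then have "r ^ p \<le> real ((CARD('n) - 0) choose (CARD('n) - p)) * r ^ (p - 0) * pminors 0 M" by simp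
  also have "\<dots> \<le> (\<Sum>q\<le>p. real ((CARD('n) - q) choose (CARD('n) - p)) * r ^ (p - q) * pminors q M)"
    using assms by (intro member_le_sum[of 0 "{..p}"
      "\<lambda>q. real ((CARD('n) - q) choose (CARD('n) - p)) * r ^ (p - q) * pminors q M"]) auto
  finally show ?thesis by (simp add: pminors_shift[OF assms(1)])
qed

lemma continuous_on_pminors:
  fixes M :: "'t::topological_space \<Rightarrow> 'a::real_normed_field^'n^'n"
  assumes "\<And>i j. continuous_on T (\<lambda>x. M x $ i $ j)"
  shows "continuous_on T (\<lambda>x. pminors p (M x))"
  using assms unfolding continuous_on_def by (intro ballI tendsto_pminors) auto

text \<open>Raising a slightly lowered \<open>\<C>\<close>-subsolution sufficiently in a single direction yields an element of
  the cone with at least the prescribed value.  Otherwise a further multiple of the identity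
  would lead to an admissible matrix with exactly this value, whose eigenvalues are bounded by
  \<open>R\<close>, in contradiction to the value of its quadratic form in the chosen direction.\<close>

lemma raised_subsolution_in_cone:
  fixes S :: "'n::{finite,linorder} rmat"
  assumes p: "p \<in> {1..CARD('n)}" and \<phi>: "\<phi> > 0" and S: "transpose S = S"
    and e: "e \<bullet> e = 1" and \<delta>: "\<delta> > 0" and L: "\<And>x. - L * (x \<bullet> x) \<le> x \<bullet> (S *v x)"
    and sub: "{\<mu>. \<mu> \<in> Gamma_cone p \<and> root p (esym p \<mu>) = \<phi>}
      \<inter> ({eigvals S - \<delta> *\<^sub>R (\<chi> i. 1)} + Gamma_cone CARD('n)) \<subseteq> ball 0 R"
    and N: "N = R + L + \<delta>" "N \<ge> 0"
  defines "T \<equiv> S - mat (\<delta> / 2) + N *\<^sub>R outer e"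
  shows "T \<in> pcone p" "root p (pminors p T) \<ge> \<phi>"
proof -
  have pn: "p \<le> CARD('n)" "0 < p" using p by auto
  have T: "transpose T = T"
    by (simp add: T_def transpose_add_diff S transpose_outer transpose_scalar)
  have form: "x \<bullet> (T *v x) = x \<bullet> (S *v x) - \<delta> / 2 * (x \<bullet> x) + N * (e \<bullet> x)\<^sup>2" for x
    by (simp add: T_def matrix_vector_mult_add_rdistrib matrix_vector_mult_diff_rdistrib mat_mult_vec
      scaleR_matrix_vector_assoc[symmetric] outer_mult_vec inner_add_right inner_diff_right
      inner_commute power2_eq_square)
  have form_shift: "x \<bullet> ((mat s + T) *v x) = s * (x \<bullet> x) + x \<bullet> (T *v x)" for s x
    by (simp add: matrix_vector_mult_add_rdistrib mat_mult_vec inner_add_right)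
  define h where "h s = pminors p (mat s + T)" for s
  have cont: "continuous_on UNIV h"
    unfolding h_def
  proof (intro continuous_on_pminors)
    fix i j
    show "continuous_on UNIV (\<lambda>s. (mat s + T) $ i $ j)"
      by (cases "i = j") (auto simp: mat_def intro!: continuous_intros)
  qed
  \<comment> \<open>\<open>T\<close> becomes nonnegative after adding \<open>L + \<delta>\<close>; beyond that \<open>h\<close> grows like a power\<close>
  have large: "h s > \<phi> ^ p" if "s \<ge> L + \<delta> + \<phi> + 1" for s
  proof -
    define M where "M = mat (L + \<delta>) + T"
    have "0 \<le> x \<bullet> (M *v x)" for x
    proof -
      have "0 \<le> N * (e \<bullet> x)\<^sup>2" using N(2) by simp
      moreover have "0 \<le> \<delta> / 2 * (x \<bullet> x)" using \<delta> by simp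
      ultimately show ?thesis using L[of x]
        unfolding M_def form_shift form by (simp add: algebra_simps)
    qed
    then have "(s - (L + \<delta>)) ^ p \<le> pminors p (mat (s - (L + \<delta>)) + M)"
      using that \<phi> pn T by (intro pminors_shift_ge_power pcone_if_psd(1)[of _ p]) (auto simp: M_def transpose_add_mat)
    also have "mat (s - (L + \<delta>)) + M = mat s + T" by (simp add: M_def mat_def vec_eq_iff)
    finally have "(s - (L + \<delta>)) ^ p \<le> h s" by (simp add: h_def)
    moreover have "\<phi> ^ p < (s - (L + \<delta>)) ^ p"
      using that \<phi> pn by (intro power_strict_mono) auto
    ultimately show ?thesis by simp
  qed
  have key: "h s \<ge> \<phi> ^ p" if "s \<ge> 0" for s
  proof (rule ccontr)
    assume "\<not> h s \<ge> \<phi> ^ p"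
    then have "h s < \<phi> ^ p" by simp
    from last_crossing[OF cont this large] obtain s' where s': "s' \<ge> s" "h s' = \<phi> ^ p"
      "\<And>t. t \<ge> s' \<Longrightarrow> h t \<ge> \<phi> ^ p" by metis
    define M where "M = mat s' + T"
    have Msym: "transpose M = M" by (simp add: M_def transpose_add_mat T)
    have "M \<in> pcone p"
    proof (rule in_pcone_if_positive_on_ray[OF Msym pn(1)])
      fix t :: real assume "t \<ge> 0"
      have "mat t + M = mat (t + s') + T" by (simp add: M_def mat_def vec_eq_iff)
      then have "pminors p (mat t + M) = h (t + s')" by (simp add: h_def)
      also have "\<dots> \<ge> \<phi> ^ p" using \<open>t \<ge> 0\<close> by (intro s'(3)) simp
      finally show "pminors p (mat t + M) > 0" using \<phi> by (meson less_le_trans zero_less_power)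
    qed
    then have G: "eigvals M \<in> Gamma_cone p"
      using pn pminors_eq_esym_eigvals[OF Msym] by (auto simp: Gamma_cone_def pcone_def)
    have "esym p (eigvals M) = \<phi> ^ p"
      using s'(2) pn pminors_eq_esym_eigvals[OF Msym, of p] by (simp add: M_def h_def)
    then have val: "root p (esym p (eigvals M)) = \<phi>"
      using \<phi> pn by (simp only: real_root_power_cancel less_imp_le)
    have "eigvals S $ k - \<delta> < eigvals M $ k" for k
    proof -
      have "eigvals (mat (- \<delta> / 2) + S) $ k \<le> eigvals M $ k"
      proof (rule eigvals_mono)
        show "transpose (mat (- \<delta> / 2) + S) = mat (- \<delta> / 2) + S" by (simp add: transpose_add_mat S)
        show "x \<bullet> ((mat (- \<delta> / 2) + S) *v x) \<le> x \<bullet> (M *v x)" for x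
          using N(2) s'(1) \<open>s \<ge> 0\<close>
          by (simp add: M_def form_shift form) 
            (simp add: matrix_vector_mult_add_rdistrib mat_mult_vec inner_add_right inner_diff_right)
      qed (rule Msym)
      then show ?thesis using \<delta> by (simp add: eigvals_add_mat[OF S])
    qed
    then have less: "eigvals M $ k < R" for k
      using subsolution_bounds_eigvals[OF sub G val] by blast
    obtain k where "e \<bullet> (M *v e) \<le> eigvals M $ k"
      using quadratic_form_le_some_eigval[OF Msym e] by blast
    moreover have "e \<bullet> (M *v e) = s' + (e \<bullet> (S *v e) - \<delta> / 2 + N)"
      by (simp add: M_def form_shift form e)
    moreover have "e \<bullet> (S *v e) \<ge> - L" using L[of e] e by simp
    ultimately show False using less[of k] N(1) s'(1) \<open>s \<ge> 0\<close> \<delta> by simp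
  qed
  show "T \<in> pcone p"
  proof (rule in_pcone_if_positive_on_ray[OF T pn(1)])
    fix s :: real assume "s \<ge> 0"
    from key[OF this] show "pminors p (mat s + T) > 0"
      unfolding h_def using \<phi> by (meson less_le_trans zero_less_power)
  qed
  have "\<phi> ^ p \<le> pminors p T" using key[of 0] by (simp add: h_def)
  then have "root p (\<phi> ^ p) \<le> root p (pminors p T)" using pn by simp
  then show "root p (pminors p T) \<ge> \<phi>" using \<phi> pn by (simp add: real_root_power_cancel)
qed


text \<open>Let \<open>B'\<close> be \<open>Bw\<close>, lowered by \<open>\<delta> / 2\<close> and raised by \<open>N\<close> in the direction \<open>G v\<close> along which the linearised
  operator takes its least value.  Since \<open>B'\<close> lies in the cone with at least the value \<open>\<phi>\<close> of \<open>Bu\<close>,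
  Garding's inequality for \<open>B'\<close> and Euler's identity for \<open>Bu\<close> give
  \<open>contract F Bu = \<phi> \<le> contract F B'\<close>.  The rank-one term contributes \<open>N\<close> times the least eigenvalue.\<close>

theorem pointwise_subsolution_inequality:
  fixes G Bu Bw :: "'n::{finite,linorder} rmat"
  assumes G: "pos_def G" and p: "p \<in> {1..CARD('n)}"
    and Bu: "transpose Bu = Bu" "eigvals (matrix_inv G ** Bu) \<in> Gamma_cone p"
      "root p (esym p (eigvals (matrix_inv G ** Bu))) = \<phi>"
    and Bw: "transpose Bw = Bw" "\<And>x. - L * (x \<bullet> (G *v x)) \<le> x \<bullet> (Bw *v x)"
    and \<delta>: "\<delta> > 0" and N: "N = R + L + \<delta>" "N \<ge> 0"
    and sub: "{\<mu>. \<mu> \<in> Gamma_cone p \<and> root p (esym p \<mu>) = \<phi>}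
      \<inter> ({eigvals (matrix_inv G ** Bw) - \<delta> *\<^sub>R (\<chi> i. 1)} + Gamma_cone CARD('n)) \<subseteq> ball 0 R"
  shows "\<delta> / 2 * contract (lin_op G p Bu) G - N * min_eigval (lin_op G p Bu ** G)
    \<le> contract (lin_op G p Bu) (Bw - Bu)"
proof -
  obtain Q where Q: "pullback Q G = mat 1" using orthonormal_frame_exists[OF G] .
  have Gsym: "transpose G = G" using G by (simp add: pos_def_def)
  have pn: "p \<le> CARD('n)" using p by simp
  have cone: "pullback Q Bu \<in> pcone p" using Gamma_cone_frame[OF Q Bu(1) pn] Bu(2) by simp
  have val: "root p (pminors p (pullback Q Bu)) = \<phi>"
    using esym_eigvals_frame[OF Q Bu(1) pn] Bu(3) by simp
  then have \<phi>: "\<phi> > 0" using pcone_pminors_pos[OF cone] p by force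
  define F where "F = lin_op G p Bu"
  have Fsym: "transpose F = F" unfolding F_def by (rule lin_op_symmetric[OF Q p Bu(1) cone])
  obtain v where v: "v \<bullet> (G *v v) = 1" "contract F (outer (G *v v)) = min_eigval (F ** G)"
    using min_eigval_direction[OF Q G Fsym] .
  define e where "e = transpose Q *v (G *v v)"
  have e: "e \<bullet> e = 1"
  proof -
    have "e \<bullet> e = (G *v v) \<bullet> (Q *v (transpose Q *v (G *v v)))"
      unfolding e_def by (simp only: inner_matrix_mult_left[of "G *v v" Q])
    also have "Q *v (transpose Q *v (G *v v)) = (Q ** (transpose Q ** G)) *v v"
      by (simp only: matrix_vector_mul_assoc matrix_mul_assoc)
    finally show ?thesis using v(1) by (simp only: frame_inverse(1)[OF Q] matrix_vector_mul_lid inner_commute)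
  qed
  define B' where "B' = Bw - (\<delta> / 2) *\<^sub>R G + N *\<^sub>R outer (G *v v)"
  have pull_outer: "pullback Q (outer (G *v v)) = outer e"
    unfolding e_def by (rule pullback_outer)
  have "pullback Q B' = pullback Q Bw - mat (\<delta> / 2) + N *\<^sub>R outer e"
    by (simp add: B'_def pullback_linear pull_outer Q) (simp add: mat_def vec_eq_iff)
  moreover have "- L * (x \<bullet> x) \<le> x \<bullet> (pullback Q Bw *v x)" for x
  proof -
    have "x \<bullet> x = (Q *v x) \<bullet> (G *v (Q *v x))"
      using quadratic_form_pullback[of x Q G] by (simp add: Q)
    then show ?thesis using Bw(2)[of "Q *v x"] by (simp add: quadratic_form_pullback)
  qed
  ultimately have cone': "pullback Q B' \<in> pcone p" and val': "root p (pminors p (pullback Q B')) \<ge> \<phi>"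
    using raised_subsolution_in_cone[OF p \<phi> transpose_pullback[OF Bw(1)] e \<delta> _ _ N, of Q] sub
    by (simp_all add: eigvals_frame[OF Q])
  have B'sym: "transpose B' = B'"
    by (simp add: B'_def transpose_add_diff transpose_scalar Bw(1) Gsym transpose_outer)
  have "contract F Bu \<le> contract F B'"
    using lin_op_ge_on_cone[OF Q p Bu(1) cone B'sym cone'] val' lin_op_euler[OF Q p Bu(1) cone] val
    by (simp add: F_def)
  then show ?thesis unfolding F_def[symmetric] by (simp add: B'_def contract_linear v(2))
qed

theorem pointwise_linearised_monotone:
  fixes G Bu K :: "'n::{finite,linorder} rmat"
  assumes G: "pos_def G" and p: "p \<in> {1..CARD('n)}"
    and Bu: "transpose Bu = Bu" "eigvals (matrix_inv G ** Bu) \<in> Gamma_cone p"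
    and K: "transpose K = K" "\<And>x. 0 \<le> x \<bullet> (K *v x)"
  shows "0 \<le> contract (lin_op G p Bu) K"
proof -
  obtain Q where Q: "pullback Q G = mat 1" using orthonormal_frame_exists[OF G] .
  then show ?thesis
    using lin_op_nonneg[OF Q _ p Bu(1) _ K] Gamma_cone_frame[OF Q Bu(1), of p] Bu(2) p G
    by (simp add: pos_def_def)
qed

text \<open>As \<open>Bu \<ge> Bw - (\<epsilon> + \<delta>\<^sub>2) G\<close>, Weyl's principle places the eigenvalues of \<open>Bu\<close> in the set that the
  subsolution bounds by \<open>R\<close>; then \<open>H = Bu - Bw - E\<close> is bounded from above as well.\<close>

theorem pointwise_supersolution_bound:
  fixes G Bu Bw E H :: "'n::{finite,linorder} rmat"
  assumes G: "pos_def G" and p: "p \<in> {1..CARD('n)}"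
    and Bu: "Bu = Bw + E + H" "eigvals (matrix_inv G ** Bu) \<in> Gamma_cone p"
      "root p (esym p (eigvals (matrix_inv G ** Bu))) = \<phi>"
    and sym: "transpose Bw = Bw" "transpose E = E" "transpose H = H"
    and Bw: "\<And>x. - L * (x \<bullet> (G *v x)) \<le> x \<bullet> (Bw *v x)"
    and E: "\<And>x. - \<epsilon> * (x \<bullet> (G *v x)) \<le> x \<bullet> (E *v x)"
    and small: "\<epsilon> + \<delta>\<^sub>2 < \<delta>"
    and sub: "{\<mu>. \<mu> \<in> Gamma_cone p \<and> root p (esym p \<mu>) = \<phi>}
      \<inter> ({eigvals (matrix_inv G ** Bw) - \<delta> *\<^sub>R (\<chi> i. 1)} + Gamma_cone CARD('n)) \<subseteq> ball 0 R"
    and H: "eigvals (matrix_inv G ** H) + \<delta>\<^sub>2 *\<^sub>R (\<chi> i. 1) \<in> closure (Gamma_cone CARD('n))"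
  shows "esym CARD('n) (eigvals (matrix_inv G ** (\<delta>\<^sub>2 *\<^sub>R G + H))) \<le> \<bar>R + L + \<epsilon> + \<delta>\<^sub>2\<bar> ^ CARD('n)"
proof -
  obtain Q where Q: "pullback Q G = mat 1" using orthonormal_frame_exists[OF G] .
  have norm: "(Q *v x) \<bullet> (G *v (Q *v x)) = x \<bullet> x" for x
    using quadratic_form_pullback[of x Q G] by (simp add: Q)
  define Su Sw SE SH where "Su = pullback Q Bu" "Sw = pullback Q Bw" "SE = pullback Q E" "SH = pullback Q H"
  note S_defs = this
  have syms: "transpose Su = Su" "transpose Sw = Sw" "transpose SE = SE" "transpose SH = SH"
    by (simp_all add: S_defs Bu(1) sym transpose_pullback transpose_add_diff)
  have Su: "Su = Sw + SE + SH" by (simp add: S_defs Bu(1) pullback_linear)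
  have Sw_ge: "- L * (x \<bullet> x) \<le> x \<bullet> (Sw *v x)" for x
    using Bw[of "Q *v x"] by (simp add: S_defs quadratic_form_pullback norm)
  have SE_ge: "- \<epsilon> * (x \<bullet> x) \<le> x \<bullet> (SE *v x)" for x
    using E[of "Q *v x"] by (simp add: S_defs quadratic_form_pullback norm)
  have eigH: "0 \<le> eigvals SH $ k + \<delta>\<^sub>2" for k
    using closure_Gamma_card_nonneg[OF H, of k] by (simp add: eigvals_frame[OF Q] S_defs)
  have SH_ge: "- \<delta>\<^sub>2 * (x \<bullet> x) \<le> x \<bullet> (SH *v x)" for x
    by (rule quadratic_form_bounds(1)[OF syms(4)]) (use eigH in \<open>simp add: add.commute minus_le_iff\<close>, smt (verit) eigH)
  have "eigvals Sw $ k - \<delta> < eigvals Su $ k" for k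
  proof -
    have "eigvals (mat (- (\<epsilon> + \<delta>\<^sub>2)) + Sw) $ k \<le> eigvals Su $ k"
    proof (rule eigvals_mono)
      show "transpose (mat (- (\<epsilon> + \<delta>\<^sub>2)) + Sw) = mat (- (\<epsilon> + \<delta>\<^sub>2)) + Sw"
        by (rule transpose_add_mat) (rule syms)
      show "x \<bullet> ((mat (- (\<epsilon> + \<delta>\<^sub>2)) + Sw) *v x) \<le> x \<bullet> (Su *v x)" for x
        using SE_ge[of x] SH_ge[of x]
        by (simp add: Su matrix_vector_mult_add_rdistrib mat_mult_vec inner_add_right algebra_simps)
    qed (rule syms)
    then show ?thesis using small by (simp add: eigvals_add_mat[OF syms(2)])
  qed
  then have eigu: "eigvals Su $ k < R" for k
    using subsolution_bounds_eigvals[OF sub Bu(2,3)] by (simp add: eigvals_frame[OF Q] S_defs)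
  have Su_le: "x \<bullet> (Su *v x) \<le> R * (x \<bullet> x)" for x
    by (rule quadratic_form_bounds(2)[OF syms(1)]) (rule less_imp_le[OF eigu])
  have eig: "eigvals (matrix_inv G ** (\<delta>\<^sub>2 *\<^sub>R G + H)) $ k = \<delta>\<^sub>2 + eigvals SH $ k" for k
  proof -
    have "pullback Q (\<delta>\<^sub>2 *\<^sub>R G + H) = mat \<delta>\<^sub>2 + SH"
      by (simp add: pullback_linear Q S_defs) (simp add: mat_def vec_eq_iff)
    then show ?thesis by (simp add: eigvals_frame[OF Q] eigvals_add_mat[OF syms(4)])
  qed
  have "eigvals SH $ k \<le> R + L + \<epsilon>" for k
  proof (rule eigvals_le[OF syms(4)])
    show "x \<bullet> (SH *v x) \<le> (R + L + \<epsilon>) * (x \<bullet> x)" for x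
      using Su_le[of x] Sw_ge[of x] SE_ge[of x]
      by (simp add: Su matrix_vector_mult_add_rdistrib inner_add_right algebra_simps)
  qed
  then have "eigvals (matrix_inv G ** (\<delta>\<^sub>2 *\<^sub>R G + H)) $ k \<le> \<bar>R + L + \<epsilon> + \<delta>\<^sub>2\<bar>" for k
    unfolding eig by (smt (verit))
  moreover have "0 \<le> eigvals (matrix_inv G ** (\<delta>\<^sub>2 *\<^sub>R G + H)) $ k" for k
    unfolding eig using eigH[of k] by simp
  ultimately have "(\<Prod>k\<in>UNIV. eigvals (matrix_inv G ** (\<delta>\<^sub>2 *\<^sub>R G + H)) $ k)
    \<le> (\<Prod>k\<in>(UNIV :: 'n set). \<bar>R + L + \<epsilon> + \<delta>\<^sub>2\<bar>)"
    by (intro prod_mono) auto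
  then show ?thesis by (simp add: esym_card)
qed

section \<open>Second derivatives\<close>

lemma DERIV_along_line:
  fixes f :: "'a::real_normed_vector \<Rightarrow> real"
  assumes "(f has_derivative f') (at (x + s *\<^sub>R u))"
  shows "((\<lambda>s. f (x + s *\<^sub>R u)) has_real_derivative f' u) (at s)"
proof -
  have "((\<lambda>s. x + s *\<^sub>R u) has_derivative (\<lambda>s. s *\<^sub>R u)) (at s)"
    by (auto intro!: derivative_eq_intros)
  from has_derivative_compose[OF this assms]
  show ?thesis
    by (rule has_derivative_imp_has_field_derivative)
      (simp add: linear_scale[OF has_derivative_linear[OF assms]])
qed

text \<open>Two applications of the mean value theorem to the second difference of \<open>f\<close>.\<close>

lemma second_difference_mean_value:
  fixes f :: "'a::real_normed_vector \<Rightarrow> real"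
  assumes h: "h > 0"
    and f: "\<And>s t. 0 \<le> s \<Longrightarrow> s \<le> h \<Longrightarrow> 0 \<le> t \<Longrightarrow> t \<le> h \<Longrightarrow>
      (f has_derivative f' (x + s *\<^sub>R u + t *\<^sub>R v)) (at (x + s *\<^sub>R u + t *\<^sub>R v))"
    and f': "\<And>s t. 0 \<le> s \<Longrightarrow> s \<le> h \<Longrightarrow> 0 \<le> t \<Longrightarrow> t \<le> h \<Longrightarrow>
      ((\<lambda>y. f' y u) has_derivative f'' (x + s *\<^sub>R u + t *\<^sub>R v)) (at (x + s *\<^sub>R u + t *\<^sub>R v))"
  obtains s t where "0 \<le> s" "s \<le> h" "0 \<le> t" "t \<le> h"
    "f (x + h *\<^sub>R u + h *\<^sub>R v) - f (x + h *\<^sub>R u) - f (x + h *\<^sub>R v) + f x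
      = h * h * f'' (x + s *\<^sub>R u + t *\<^sub>R v) v"
proof -
  define \<phi> where "\<phi> s = f ((x + h *\<^sub>R v) + s *\<^sub>R u) - f (x + s *\<^sub>R u)" for s
  have "DERIV \<phi> s :> f' ((x + h *\<^sub>R v) + s *\<^sub>R u) u - f' (x + s *\<^sub>R u) u" if "0 \<le> s" "s \<le> h" for s
    unfolding \<phi>_def using f[OF that, of h] f[OF that, of 0] h
    by (intro DERIV_diff DERIV_along_line) (auto simp: add_ac)
  from MVT2[OF h this] obtain s where s: "0 < s" "s < h"
    "\<phi> h - \<phi> 0 = h * (f' ((x + h *\<^sub>R v) + s *\<^sub>R u) u - f' (x + s *\<^sub>R u) u)" by auto
  have "DERIV (\<lambda>t. f' ((x + s *\<^sub>R u) + t *\<^sub>R v) u) t :> f'' ((x + s *\<^sub>R u) + t *\<^sub>R v) v"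
    if "0 \<le> t" "t \<le> h" for t
    using f'[of s t] s that by (intro DERIV_along_line[of "\<lambda>y. f' y u"]) auto
  from MVT2[OF h this] obtain t where t: "0 < t" "t < h"
    "f' ((x + s *\<^sub>R u) + h *\<^sub>R v) u - f' ((x + s *\<^sub>R u) + 0 *\<^sub>R v) u
      = h * f'' ((x + s *\<^sub>R u) + t *\<^sub>R v) v" by auto
  have "f (x + h *\<^sub>R u + h *\<^sub>R v) - f (x + h *\<^sub>R u) - f (x + h *\<^sub>R v) + f x = \<phi> h - \<phi> 0"
    by (simp add: \<phi>_def add_ac)
  also have "\<dots> = h * h * f'' (x + s *\<^sub>R u + t *\<^sub>R v) v"
    using s(3) t(3) by (simp add: add_ac)
  finally show ?thesis using that[of s t] s t by simp
qed

text \<open>The second difference is symmetric in \<open>u\<close> and \<open>v\<close>, and its two mean value representations tend to the two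
  mixed derivatives.\<close>

lemma symmetric_second_derivative:
  fixes f :: "'a::real_normed_vector \<Rightarrow> real"
  assumes S: "open S" "x \<in> S"
    and f: "\<And>y. y \<in> S \<Longrightarrow> (f has_derivative f' y) (at y)"
    and f': "\<And>y w. y \<in> S \<Longrightarrow> ((\<lambda>y. f' y w) has_derivative f'' y w) (at y)"
    and cont: "\<And>w z. continuous_on S (\<lambda>y. f'' y w z)"
  shows "f'' x u v = f'' x v u"
proof (rule ccontr)
  assume "f'' x u v \<noteq> f'' x v u"
  define \<epsilon> where "\<epsilon> = \<bar>f'' x u v - f'' x v u\<bar> / 2"
  have \<epsilon>: "\<epsilon> > 0" using \<open>f'' x u v \<noteq> f'' x v u\<close> by (simp add: \<epsilon>_def)
  have lim: "((\<lambda>y. f'' y w z) \<longlongrightarrow> f'' x w z) (at x)" for w z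
    using cont[of w z] S by (simp add: continuous_on_eq_continuous_at isCont_def)
  have near: "\<exists>d>0. \<forall>y. dist y x < d \<longrightarrow> y \<in> S \<and> \<bar>f'' y w z - f'' x w z\<bar> < \<epsilon>" for w z
  proof -
    obtain d1 where d1: "d1 > 0" "\<And>y. y \<noteq> x \<Longrightarrow> dist y x < d1 \<Longrightarrow> dist (f'' y w z) (f'' x w z) < \<epsilon>"
      using lim[of w z] \<epsilon> unfolding tendsto_iff eventually_at by (metis UNIV_I)
    obtain d2 where d2: "d2 > 0" "ball x d2 \<subseteq> S" using S open_contains_ball by blast
    show ?thesis
    proof (intro exI[of _ "min d1 d2"] conjI allI impI)
      fix y assume "dist y x < min d1 d2"
      then show "y \<in> S" using d2 by (auto simp: dist_commute)
      show "\<bar>f'' y w z - f'' x w z\<bar> < \<epsilon>"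
        using d1(2)[of y] \<open>dist y x < min d1 d2\<close> \<epsilon> by (cases "y = x") (auto simp: dist_real_def)
    qed (use d1 d2 in auto)
  qed
  obtain d1 where d1: "d1 > 0" "\<And>y. dist y x < d1 \<Longrightarrow> y \<in> S \<and> \<bar>f'' y u v - f'' x u v\<bar> < \<epsilon>"
    using near[of u v] by blast
  obtain d2 where d2: "d2 > 0" "\<And>y. dist y x < d2 \<Longrightarrow> y \<in> S \<and> \<bar>f'' y v u - f'' x v u\<bar> < \<epsilon>"
    using near[of v u] by blast
  define d where "d = min d1 d2"
  define c where "c = norm u + norm v + 1"
  define h where "h = d / (2 * c)"
  have c: "c > 0" using norm_ge_zero[of u] norm_ge_zero[of v] unfolding c_def by linarith
  moreover have "d > 0" using d1 d2 by (simp add: d_def)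
  ultimately have h: "h > 0" "h * c < d" by (simp_all add: h_def)
  have close: "dist (x + s *\<^sub>R u + t *\<^sub>R v) x < d" if "0 \<le> s" "s \<le> h" "0 \<le> t" "t \<le> h" for s t
  proof -
    have "dist (x + s *\<^sub>R u + t *\<^sub>R v) x = norm (s *\<^sub>R u + t *\<^sub>R v)" by (simp add: dist_norm)
    also have "\<dots> \<le> s * norm u + t * norm v"
      using norm_triangle_ineq[of "s *\<^sub>R u" "t *\<^sub>R v"] that by simp
    also have "\<dots> \<le> h * norm u + h * norm v" using that by (intro add_mono mult_right_mono) auto
    also have "\<dots> < d" using h by (simp add: c_def algebra_simps)
    finally show ?thesis .
  qed
  have in_S: "x + s *\<^sub>R u + t *\<^sub>R v \<in> S" if "0 \<le> s" "s \<le> h" "0 \<le> t" "t \<le> h" for s t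
    using close[OF that] d1 by (simp add: d_def)
  obtain s t where st: "0 \<le> s" "s \<le> h" "0 \<le> t" "t \<le> h"
    "f (x + h *\<^sub>R u + h *\<^sub>R v) - f (x + h *\<^sub>R u) - f (x + h *\<^sub>R v) + f x
      = h * h * f'' (x + s *\<^sub>R u + t *\<^sub>R v) u v"
    by (rule second_difference_mean_value[OF h(1), of f f' x u v "\<lambda>y. f'' y u"])
      (auto intro!: f f' in_S)
  obtain t' s' where st': "0 \<le> t'" "t' \<le> h" "0 \<le> s'" "s' \<le> h"
    "f (x + h *\<^sub>R v + h *\<^sub>R u) - f (x + h *\<^sub>R v) - f (x + h *\<^sub>R u) + f x
      = h * h * f'' (x + t' *\<^sub>R v + s' *\<^sub>R u) v u"
  proof (rule second_difference_mean_value[OF h(1), of f f' x v u "\<lambda>y. f'' y v"])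
    fix t s assume "0 \<le> t" "t \<le> h" "0 \<le> s" "s \<le> h"
    then have "x + t *\<^sub>R v + s *\<^sub>R u \<in> S" using in_S[of s t] by (simp add: add_ac)
    then show "(f has_derivative f' (x + t *\<^sub>R v + s *\<^sub>R u)) (at (x + t *\<^sub>R v + s *\<^sub>R u))"
      "((\<lambda>y. f' y v) has_derivative f'' (x + t *\<^sub>R v + s *\<^sub>R u) v) (at (x + t *\<^sub>R v + s *\<^sub>R u))"
      by (auto intro: f f')
  qed
  define a where "a = f'' (x + s *\<^sub>R u + t *\<^sub>R v) u v"
  have "h * h * a = h * h * f'' (x + s' *\<^sub>R u + t' *\<^sub>R v) v u"
    using st(5) st'(5) unfolding a_def
    by (simp add: add.commute add.left_commute) (simp add: algebra_simps)
  then have a: "a = f'' (x + s' *\<^sub>R u + t' *\<^sub>R v) v u" using h by simp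
  have "\<bar>a - f'' x u v\<bar> < \<epsilon>" using d1(2) close[OF st(1-4)] by (simp add: a_def d_def)
  moreover have "\<bar>a - f'' x v u\<bar> < \<epsilon>" using d2(2) close[of s' t'] st' by (simp add: a d_def)
  ultimately show False unfolding \<epsilon>_def by (simp add: abs_if split: if_splits)
qed

lemma second_derivative_linear_left:
  fixes f :: "'a::real_normed_vector \<Rightarrow> 'b::real_normed_vector"
  assumes S: "open S" "x \<in> S"
    and f: "\<And>y. y \<in> S \<Longrightarrow> (f has_derivative f' y) (at y)"
    and f': "\<And>y w. y \<in> S \<Longrightarrow> ((\<lambda>y. f' y w) has_derivative f'' y w) (at y)"
  shows "linear (\<lambda>w. f'' x w z)"
proof -
  have lin: "linear (f' y)" if "y \<in> S" for y using f[OF that] has_derivative_linear by blast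
  show ?thesis
  proof (rule linearI)
    fix a b
    have "((\<lambda>y. f' y a + f' y b) has_derivative (\<lambda>z. f'' x a z + f'' x b z)) (at x)"
      by (intro has_derivative_add f' S)
    then have "((\<lambda>y. f' y (a + b)) has_derivative (\<lambda>z. f'' x a z + f'' x b z)) (at x)"
      by (rule has_derivative_transform_within_open[OF _ S]) (simp add: linear_add[OF lin])
    from has_derivative_unique[OF this f'[OF S(2)]]
    show "f'' x (a + b) z = f'' x a z + f'' x b z" by metis
  next
    fix r :: real and a
    have "((\<lambda>y. r *\<^sub>R f' y a) has_derivative (\<lambda>z. r *\<^sub>R f'' x a z)) (at x)"
      by (intro has_derivative_scaleR_right f' S)
    then have "((\<lambda>y. f' y (r *\<^sub>R a)) has_derivative (\<lambda>z. r *\<^sub>R f'' x a z)) (at x)"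
      by (rule has_derivative_transform_within_open[OF _ S]) (simp add: linear_scale[OF lin])
    from has_derivative_unique[OF this f'[OF S(2)]]
    show "f'' x (r *\<^sub>R a) z = r *\<^sub>R f'' x a z" by metis
  qed
qed

lemma symmetric_second_derivative_vec:
  fixes T :: "real^'n \<Rightarrow> real^'n"
  assumes S: "open S" "x \<in> S"
    and T: "\<And>y. y \<in> S \<Longrightarrow> (T has_derivative T1 y) (at y)"
      "\<And>y w. y \<in> S \<Longrightarrow> ((\<lambda>y. T1 y w) has_derivative T2 y w) (at y)"
      "\<And>w z. continuous_on S (\<lambda>y. T2 y w z)"
  shows "T2 x u v = T2 x v u"
proof -
  have "T2 x u v $ a = T2 x v u $ a" for a
    by (rule symmetric_second_derivative[OF S, of "\<lambda>y. T y $ a" "\<lambda>y u. T1 y u $ a" "\<lambda>y u v. T2 y u v $ a"])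
      (auto intro!: T bounded_linear.has_derivative[OF bounded_linear_vec_nth] continuous_intros)
  then show ?thesis by (simp add: vec_eq_iff)
qed

section \<open>Covariant Hessians under changes of coordinates\<close>

text \<open>The covariant Hessian as a bilinear form: \<open>f2 Z Y\<close> is the second derivative of the function, \<open>g1 Y\<close>
  the derivative of the metric in direction \<open>Y\<close>, and \<open>X\<close> the gradient of the function.\<close>

definition cov_hess :: "(real^'n \<Rightarrow> real^'n \<Rightarrow> real) \<Rightarrow> (real^'n \<Rightarrow> real^'n^'n) \<Rightarrow> real^'n
    \<Rightarrow> real^'n \<Rightarrow> real^'n \<Rightarrow> real" where
  "cov_hess f2 g1 X Y Z
    = f2 Z Y - (1/2) * (X \<bullet> (g1 Y *v Z) + X \<bullet> (g1 Z *v Y) - Y \<bullet> (g1 X *v Z))"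

lemma bounded_bilinear_matrix_vector: "bounded_bilinear (\<lambda>(A::real^'n^'m) x. A *v x)"
  unfolding bilinear_conv_bounded_bilinear[symmetric] bilinear_def
  by (auto intro!: linearI simp: matrix_vector_mult_add_rdistrib matrix_vector_right_distrib
    matrix_vector_mult_scaleR scaleR_matrix_vector_assoc)

lemmas has_derivative_matrix_vector = bounded_bilinear.FDERIV[OF bounded_bilinear_matrix_vector]

text \<open>The derivative of \<open>fd\<close> is represented by the vector \<open>grad\<close> of its partial derivatives, to which the
  product rule for the inner product applies.\<close>

lemma chain_second_derivative:
  fixes T :: "real^'n \<Rightarrow> real^'n" and fd :: "real^'n \<Rightarrow> real"
  assumes V: "open V" "y \<in> V" and W: "open W" "T ` V \<subseteq> W"
    and T: "\<And>z. z \<in> V \<Longrightarrow> (T has_derivative T1 z) (at z)"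
      "\<And>z u. z \<in> V \<Longrightarrow> ((\<lambda>z. T1 z u) has_derivative T2 z u) (at z)"
    and fd: "\<And>z. z \<in> W \<Longrightarrow> (fd has_derivative f1 z) (at z)"
      "\<And>z u. z \<in> W \<Longrightarrow> ((\<lambda>z. f1 z u) has_derivative f2 z u) (at z)"
    and fc: "\<And>z. z \<in> V \<Longrightarrow> fc z = fd (T z)"
      "\<And>z. z \<in> V \<Longrightarrow> (fc has_derivative fc1 z) (at z)"
      "\<And>z u. z \<in> V \<Longrightarrow> ((\<lambda>z. fc1 z u) has_derivative fc2 z u) (at z)"
  shows "fc1 y Y = f1 (T y) (T1 y Y)"
    and "fc2 y Z Y = f2 (T y) (T1 y Z) (T1 y Y) + f1 (T y) (T2 y Z Y)"
proof -
  have first: "fc1 z u = f1 (T z) (T1 z u)" if z: "z \<in> V" for z u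
  proof -
    have Tz: "T z \<in> W" using W(2) z by blast
    have "((\<lambda>z. fd (T z)) has_derivative (\<lambda>u. f1 (T z) (T1 z u))) (at z)"
      by (rule has_derivative_compose[OF T(1)[OF z] fd(1)[OF Tz]])
    then have "(fc has_derivative (\<lambda>u. f1 (T z) (T1 z u))) (at z)"
      by (rule has_derivative_transform_within_open[OF _ V(1) z]) (simp add: fc(1))
    from has_derivative_unique[OF this fc(2)[OF z]] show ?thesis by metis
  qed
  then show "fc1 y Y = f1 (T y) (T1 y Y)" using V by blast
  define grad where "grad w = (\<chi> b. f1 w (axis b 1))" for w
  have lin1: "linear (f1 w)" if "w \<in> W" for w using fd(1)[OF that] has_derivative_linear by blast
  have axis_sum: "v = (\<Sum>b\<in>UNIV. v $ b *\<^sub>R axis b 1)" for v :: "real^'n"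
    using basis_expansion[of v] by (simp add: scalar_mult_eq_scaleR)
  have grad: "f1 w v = grad w \<bullet> v" if "w \<in> W" for w v
  proof -
    have "f1 w v = (\<Sum>b\<in>UNIV. v $ b * f1 w (axis b 1))"
      by (subst axis_sum[of v]) (simp add: linear_sum[OF lin1[OF that]] linear_scale[OF lin1[OF that]])
    then show ?thesis by (simp add: grad_def inner_vec_def mult.commute)
  qed
  have Ty: "T y \<in> W" using W(2) V(2) by blast
  have dgrad: "(grad has_derivative (\<lambda>u. \<chi> b. f2 (T y) (axis b 1) u)) (at (T y))"
  proof -
    have der: "((\<lambda>w. \<Sum>b\<in>UNIV. f1 w (axis b 1) *\<^sub>R (axis b 1 :: real^'n))
        has_derivative (\<lambda>u. \<Sum>b\<in>UNIV. f2 (T y) (axis b 1) u *\<^sub>R axis b 1)) (at (T y))"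
      by (intro has_derivative_sum has_derivative_scaleR_left fd(2) Ty)
    have expand: "(\<Sum>b\<in>UNIV. c b *\<^sub>R axis b 1) = (\<chi> b. c b)" for c :: "'n \<Rightarrow> real"
      using axis_sum[of "\<chi> b. c b", symmetric] by (simp only: vec_lambda_beta)
    show ?thesis using der unfolding expand grad_def[abs_def] .
  qed
  have lin2: "linear (\<lambda>w. f2 (T y) w u)" for u
    using second_derivative_linear_left[OF W(1) Ty fd] by blast
  have f2_grad: "(\<chi> b. f2 (T y) (axis b 1) u) \<bullet> v = f2 (T y) v u" for u v
  proof -
    have "f2 (T y) v u = (\<Sum>b\<in>UNIV. v $ b * f2 (T y) (axis b 1) u)"
      by (subst axis_sum[of v]) (simp add: linear_sum[OF lin2] linear_scale[OF lin2])
    then show ?thesis by (simp add: inner_vec_def mult.commute)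
  qed
  have "((\<lambda>z. grad (T z) \<bullet> T1 z Z) has_derivative
      (\<lambda>u. grad (T y) \<bullet> T2 y Z u + (\<chi> b. f2 (T y) (axis b 1) (T1 y u)) \<bullet> T1 y Z)) (at y)"
    by (intro has_derivative_inner has_derivative_compose[OF T(1)[OF V(2)] dgrad] T(2) V(2))
  then have "((\<lambda>z. fc1 z Z) has_derivative
      (\<lambda>u. grad (T y) \<bullet> T2 y Z u + (\<chi> b. f2 (T y) (axis b 1) (T1 y u)) \<bullet> T1 y Z)) (at y)"
  proof (rule has_derivative_transform_within_open[OF _ V])
    show "grad (T z) \<bullet> T1 z Z = fc1 z Z" if "z \<in> V" for z
      using first[OF that, of Z] grad[of "T z" "T1 z Z"] W(2) that by auto
  qed
  from fun_cong[OF has_derivative_unique[OF fc(3)[OF V(2)] this], of Y]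
  have "fc2 y Z Y = grad (T y) \<bullet> T2 y Z Y + (\<chi> b. f2 (T y) (axis b 1) (T1 y Y)) \<bullet> T1 y Z" .
  then show "fc2 y Z Y = f2 (T y) (T1 y Z) (T1 y Y) + f1 (T y) (T2 y Z Y)"
    unfolding f2_grad grad[OF Ty] by simp
qed

lemma metric_derivative_transformation:
  fixes T :: "real^'n \<Rightarrow> real^'n"
  assumes V: "open V" "y \<in> V"
    and T: "(T has_derivative T1 y) (at y)" "\<And>u. ((\<lambda>z. T1 z u) has_derivative T2 u) (at y)"
    and gd: "(gd has_derivative gd1) (at (T y))" and gc: "(gc has_derivative gc1) (at y)"
    and g: "\<And>z X Z. z \<in> V \<Longrightarrow> X \<bullet> (gc z *v Z) = T1 z X \<bullet> (gd (T z) *v T1 z Z)"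
  shows "X \<bullet> (gc1 Y *v Z) = T2 X Y \<bullet> (gd (T y) *v T1 y Z) + T1 y X \<bullet> (gd1 (T1 y Y) *v T1 y Z)
    + T1 y X \<bullet> (gd (T y) *v T2 Z Y)"
proof -
  have "((\<lambda>z. T1 z X \<bullet> (gd (T z) *v T1 z Z)) has_derivative
      (\<lambda>u. T1 y X \<bullet> (gd (T y) *v T2 Z u + gd1 (T1 y u) *v T1 y Z) + T2 X u \<bullet> (gd (T y) *v T1 y Z))) (at y)"
    by (intro has_derivative_inner has_derivative_matrix_vector T has_derivative_compose[OF T(1) gd])
  then have "((\<lambda>z. X \<bullet> (gc z *v Z)) has_derivative
      (\<lambda>u. T1 y X \<bullet> (gd (T y) *v T2 Z u + gd1 (T1 y u) *v T1 y Z) + T2 X u \<bullet> (gd (T y) *v T1 y Z))) (at y)"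
    by (rule has_derivative_transform_within_open[OF _ V]) (simp add: g)
  moreover have "((\<lambda>z. X \<bullet> (gc z *v Z)) has_derivative (\<lambda>u. X \<bullet> (gc1 u *v Z))) (at y)"
    by (intro has_derivative_inner_right gc
      bounded_linear.has_derivative[OF bounded_bilinear.bounded_linear_left[OF bounded_bilinear_matrix_vector]])
  ultimately have eq: "(\<lambda>u. T1 y X \<bullet> (gd (T y) *v T2 Z u + gd1 (T1 y u) *v T1 y Z) + T2 X u \<bullet> (gd (T y) *v T1 y Z))
      = (\<lambda>u. X \<bullet> (gc1 u *v Z))"
    by (rule has_derivative_unique)
  from fun_cong[OF eq, of Y] have "T1 y X \<bullet> (gd (T y) *v T2 Z Y + gd1 (T1 y Y) *v T1 y Z) + T2 X Y \<bullet> (gd (T y) *v T1 y Z)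
      = X \<bullet> (gc1 Y *v Z)"
    .
  then show ?thesis by (simp add: inner_add_right)
qed

text \<open>The covariant Hessian is a tensor: the second derivative of the coordinate change that the chain
  rule produces is cancelled by the one from the derivative of the metric.\<close>

theorem cov_hess_transformation:
  fixes T2 :: "real^'n \<Rightarrow> real^'n \<Rightarrow> real^'n"
  assumes f2: "\<And>Y Z. fc2 Z Y = fd2 (J Z) (J Y) + f1 (T2 Z Y)"
    and g1: "\<And>X Y Z. X \<bullet> (gc1 Y *v Z) = T2 X Y \<bullet> (gd *v J Z) + J X \<bullet> (gd1 (J Y) *v J Z) + J X \<bullet> (gd *v T2 Z Y)"
    and T2: "\<And>u v. T2 u v = T2 v u" and gd: "transpose gd = gd"
    and X: "\<And>v. f1 v = J X \<bullet> (gd *v v)"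
  shows "cov_hess fc2 gc1 X Y Z = cov_hess fd2 gd1 (J X) (J Y) (J Z)"
proof -
  have sym: "a \<bullet> (gd *v b) = b \<bullet> (gd *v a)" for a b
    using inner_matrix_mult_left[of a gd b] gd by (simp add: inner_commute)
  show ?thesis
    unfolding cov_hess_def f2 g1 X
    using T2[of X Y] T2[of X Z] T2[of Y Z] sym[of "J Y" "T2 Z X"]
    by (simp add: field_simps)
qed

section \<open>Calculus in charts\<close>

lemma Ck_on_2D:
  assumes "Ck_on 2 S f"
  shows "\<And>x. x \<in> S \<Longrightarrow> (f has_derivative frechet_derivative f (at x)) (at x)"
    and "\<And>x v. x \<in> S \<Longrightarrow> ((\<lambda>y. frechet_derivative f (at y) v) has_derivative
      frechet_derivative (\<lambda>y. frechet_derivative f (at y) v) (at x)) (at x)"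
    and "\<And>v w. continuous_on S (\<lambda>x. frechet_derivative (\<lambda>y. frechet_derivative f (at y) v) (at x) w)"
  using assms by (auto simp: numeral_2_eq_2 frechet_derivative_works)

lemma smooth_on_imp_Ck: "smooth_on S f \<Longrightarrow> Ck_on k S f"
  by (simp add: smooth_on_def)

lemma has_derivative_imp_continuous_on:
  assumes "\<And>x. x \<in> S \<Longrightarrow> (f has_derivative f' x) (at x)"
  shows "continuous_on S f"
  using assms by (meson continuous_at_imp_continuous_on has_derivative_continuous)

lemma bilinear_form_matrix:
  fixes B :: "real^'n \<Rightarrow> real^'n \<Rightarrow> real"
  assumes "\<And>Z. linear (\<lambda>Y. B Y Z)" "\<And>Y. linear (B Y)"
  shows "Y \<bullet> ((\<chi> j k. B (axis j 1) (axis k 1)) *v Z) = B Y Z"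
proof -
  have axis_sum: "(\<Sum>b\<in>UNIV. v $ b *\<^sub>R axis b 1) = v" for v :: "real^'n"
    using basis_expansion[of v] by (simp add: scalar_mult_eq_scaleR)
  have "B Y Z = B (\<Sum>j\<in>UNIV. Y $ j *\<^sub>R axis j 1) (\<Sum>k\<in>UNIV. Z $ k *\<^sub>R axis k 1)"
    by (simp only: axis_sum)
  also have "\<dots> = (\<Sum>j\<in>UNIV. Y $ j * B (axis j 1) (\<Sum>k\<in>UNIV. Z $ k *\<^sub>R axis k 1))"
    by (simp only: linear_sum[OF assms(1)] linear_scale[OF assms(1)] real_scaleR_def)
  also have "\<dots> = (\<Sum>j\<in>UNIV. Y $ j * (\<Sum>k\<in>UNIV. Z $ k * B (axis j 1) (axis k 1)))"
    by (simp only: linear_sum[OF assms(2)] linear_scale[OF assms(2)] real_scaleR_def)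
  finally show ?thesis by (simp add: inner_vec_def matrix_vector_mult_def mult.commute)
qed

lemma pos_def_inverse:
  fixes G :: "'n::{finite,linorder} rmat"
  assumes "pos_def G"
  shows "G ** matrix_inv G = mat 1" "matrix_inv G ** G = mat 1" "transpose (matrix_inv G) = matrix_inv G"
proof -
  obtain Q where Q: "pullback Q G = mat 1" using orthonormal_frame_exists[OF assms] .
  show "G ** matrix_inv G = mat 1" unfolding frame_inverse(2)[OF Q] by (rule frame_inverse(3)[OF Q])
  then show "matrix_inv G ** G = mat 1" using matrix_left_right_inverse by blast
  show "transpose (matrix_inv G) = matrix_inv G"
    unfolding frame_inverse(2)[OF Q] by (simp add: matrix_transpose_mul)
qed

definition coord_d2 :: "('m, 'n::finite) chart \<Rightarrow> ('m \<Rightarrow> real) \<Rightarrow> real^'n \<Rightarrow> real^'n \<Rightarrow> real^'n \<Rightarrow> real" where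
  "coord_d2 c u y Z = frechet_derivative (\<lambda>z. frechet_derivative (u \<circ> chart_inv c) (at z) Z) (at y)"

definition metric_d1 :: "('m, 'n::finite) field2 \<Rightarrow> ('m, 'n) chart \<Rightarrow> real^'n \<Rightarrow> real^'n \<Rightarrow> real^'n^'n" where
  "metric_d1 g c y = frechet_derivative (\<lambda>z. g c (chart_inv c z)) (at y)"

locale riemannian_atlas =
  fixes \<A> :: "('m::{t2_space,second_countable_topology}, 'n::{finite,linorder}) chart set"
    and g :: "('m, 'n) field2"
  assumes atlas: "smooth_atlas \<A>" and metric: "riemannian_metric \<A> g"
begin

lemma chart:
  assumes "c \<in> \<A>"
  shows "open (chart_dom c)" "open (chart_img c)"
    "homeomorphism (chart_dom c) (chart_img c) (chart_map c) (chart_inv c)"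
  using assms atlas unfolding smooth_atlas_def by (fast, fast, fast)

lemma chart_inv_map: "c \<in> \<A> \<Longrightarrow> x \<in> chart_dom c \<Longrightarrow> chart_inv c (chart_map c x) = x"
  using chart(3) by (meson homeomorphism_apply1)

lemma chart_map_inv: "c \<in> \<A> \<Longrightarrow> y \<in> chart_img c \<Longrightarrow> chart_map c (chart_inv c y) = y"
  using chart(3) by (meson homeomorphism_apply2)

lemma chart_inv_in: "y \<in> chart_img c \<Longrightarrow> chart_inv c y \<in> chart_dom c"
  by (rule inv_into_into)

lemma metric_pos_def: "c \<in> \<A> \<Longrightarrow> x \<in> chart_dom c \<Longrightarrow> pos_def (g c x)"
  using metric unfolding riemannian_metric_def pos_def_def by blast

lemma metric_transformation:
  "c \<in> \<A> \<Longrightarrow> d \<in> \<A> \<Longrightarrow> x \<in> chart_dom c \<Longrightarrow> x \<in> chart_dom d \<Longrightarrow>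
    g c x = transpose (jac c d x) ** g d x ** jac c d x"
  using metric unfolding riemannian_metric_def by blast

lemma metric_form_transformation:
  assumes "c \<in> \<A>" "d \<in> \<A>" "x \<in> chart_dom c" "x \<in> chart_dom d"
  shows "X \<bullet> (g c x *v Z) = (jac c d x *v X) \<bullet> (g d x *v (jac c d x *v Z))"
proof -
  have "X \<bullet> (g c x *v Z) = X \<bullet> (transpose (jac c d x) *v (g d x *v (jac c d x *v Z)))"
    by (simp only: metric_transformation[OF assms] matrix_vector_mul_assoc matrix_mul_assoc)
  then show ?thesis by (simp only: inner_matrix_mult_left[of X "transpose (jac c d x)"] transpose_transpose)
qed

lemma metric_has_derivative:
  assumes "c \<in> \<A>" "y \<in> chart_img c"
  shows "((\<lambda>z. g c (chart_inv c z)) has_derivative metric_d1 g c y) (at y)"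
  unfolding metric_d1_def using assms metric
  by (intro Ck_on_2D(1)[OF smooth_on_imp_Ck]) (auto simp: riemannian_metric_def)

lemma coord_derivatives:
  assumes "c \<in> \<A>" "C2_fun \<A> u" "y \<in> chart_img c"
  shows "((u \<circ> chart_inv c) has_derivative frechet_derivative (u \<circ> chart_inv c) (at y)) (at y)"
    and "((\<lambda>z. frechet_derivative (u \<circ> chart_inv c) (at z) Z) has_derivative coord_d2 c u y Z) (at y)"
  unfolding coord_d2_def using assms Ck_on_2D[of "chart_img c" "u \<circ> chart_inv c"]
  by (auto simp: C2_fun_def)

lemma coord_d2_continuous:
  assumes "c \<in> \<A>" "C2_fun \<A> u"
  shows "continuous_on (chart_img c) (\<lambda>y. coord_d2 c u y Z Y)"
  unfolding coord_d2_def using assms Ck_on_2D(3)[of "chart_img c" "u \<circ> chart_inv c"]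
  by (auto simp: C2_fun_def)

lemma coord_d2_properties:
  assumes "c \<in> \<A>" "C2_fun \<A> u" "y \<in> chart_img c"
  shows "coord_d2 c u y Y Z = coord_d2 c u y Z Y" "linear (coord_d2 c u y Z)" "linear (\<lambda>Y. coord_d2 c u y Y Z)"
proof -
  show "coord_d2 c u y Y Z = coord_d2 c u y Z Y"
    by (rule symmetric_second_derivative[OF chart(2)[OF assms(1)] assms(3)
      coord_derivatives[OF assms(1,2)] coord_d2_continuous[OF assms(1,2)]])
  show "linear (coord_d2 c u y Z)"
    using coord_derivatives(2)[OF assms] has_derivative_linear by blast
  show "linear (\<lambda>Y. coord_d2 c u y Y Z)"
    by (rule second_derivative_linear_left[OF chart(2)[OF assms(1)] assms(3)
      coord_derivatives[OF assms(1,2)]])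
qed

lemma diff_form_inner:
  assumes "c \<in> \<A>" "C2_fun \<A> u" "x \<in> chart_dom c"
  shows "diff_form c u x \<bullet> Y = frechet_derivative (u \<circ> chart_inv c) (at (chart_map c x)) Y"
proof -
  let ?D = "frechet_derivative (u \<circ> chart_inv c) (at (chart_map c x))"
  have lin: "linear ?D"
    using coord_derivatives(1)[OF assms(1,2)] assms(3) has_derivative_linear by blast
  have "?D Y = ?D (\<Sum>b\<in>UNIV. Y $ b *\<^sub>R axis b 1)"
    using basis_expansion[of Y] by (simp add: scalar_mult_eq_scaleR)
  then show ?thesis
    by (simp add: linear_sum[OF lin] linear_scale[OF lin] diff_form_def pd_def inner_vec_def mult.commute)
qed

definition grad :: "('m, 'n) chart \<Rightarrow> ('m \<Rightarrow> real) \<Rightarrow> 'm \<Rightarrow> 'n rvec" where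
  "grad c u x = matrix_inv (g c x) *v diff_form c u x"

lemma metric_mult_grad:
  assumes "c \<in> \<A>" "x \<in> chart_dom c"
  shows "g c x *v grad c u x = diff_form c u x"
  using pos_def_inverse(1)[OF metric_pos_def[OF assms]] by (simp add: grad_def matrix_vector_mul_assoc)

text \<open>The definition of \<open>hessian\<close> through Christoffel symbols, freed from indices.\<close>

lemma hessian_form:
  assumes "c \<in> \<A>" "C2_fun \<A> u" "x \<in> chart_dom c"
  shows "Y \<bullet> (hessian g c u x *v Z)
    = cov_hess (coord_d2 c u (chart_map c x)) (metric_d1 g c (chart_map c x)) (grad c u x) Y Z"
proof -
  define y where "y = chart_map c x"
  have y: "y \<in> chart_img c" using assms(3) by (simp add: y_def)
  define X where "X = grad c u x"
  let ?d2 = "coord_d2 c u y" and ?g1 = "metric_d1 g c y"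
  have lin_g: "linear ?g1" using metric_has_derivative[OF assms(1) y] has_derivative_linear by blast
  have lin_g': "linear (\<lambda>Y. Z \<bullet> (?g1 Y *v W))" for Z W
    by (rule linearI) (simp_all add: linear_add[OF lin_g] linear_scale[OF lin_g]
      matrix_vector_mult_add_rdistrib inner_add_right scaleR_matrix_vector_assoc[symmetric])
  have pdg: "pd i (\<lambda>z. g c (chart_inv c z) $ a $ b) y = ?g1 (axis i 1) $ a $ b" for i a b
  proof -
    have "bounded_linear (\<lambda>M :: 'n rmat. M $ a $ b)"
      by (intro bounded_linear_compose[OF bounded_linear_vec_nth bounded_linear_vec_nth])
    from bounded_linear.has_derivative[OF this metric_has_derivative[OF assms(1) y]]
    show ?thesis by (simp add: pd_def frechet_derivative_at[symmetric])
  qed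
  have pdu: "pd j (pd k (u \<circ> chart_inv c)) y = ?d2 (axis k 1) (axis j 1)" for j k
    by (simp add: pd_def[abs_def] coord_d2_def)
  have inv_sym: "matrix_inv (g c x) $ l $ m = matrix_inv (g c x) $ m $ l" for l m
  proof -
    have "transpose (matrix_inv (g c x)) $ m $ l = matrix_inv (g c x) $ m $ l"
      using pos_def_inverse(3)[OF metric_pos_def[OF assms(1,3)]] by simp
    then show ?thesis by (simp add: transpose_def)
  qed
  have X: "X $ m = (\<Sum>l\<in>UNIV. matrix_inv (g c x) $ l $ m * diff_form c u x $ l)" for m
    unfolding X_def grad_def matrix_vector_mult_def by (simp add: inv_sym[of m])
  have entry: "hessian g c u x $ j $ k = cov_hess ?d2 ?g1 X (axis j 1) (axis k 1)" for j k
  proof -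
    let ?dg = "\<lambda>i a b. ?g1 (axis i 1) $ a $ b"
    have "(\<Sum>l\<in>UNIV. christoffel g c x l j k * diff_form c u x $ l)
      = (\<Sum>l\<in>UNIV. \<Sum>m\<in>UNIV. (1/2) * (matrix_inv (g c x) $ l $ m * (?dg j m k + ?dg k m j - ?dg m j k)
          * diff_form c u x $ l))"
      unfolding christoffel_def Let_def y_def[symmetric] pdg
      by (simp add: sum_distrib_left sum_distrib_right mult_ac)
    also have "\<dots> = (\<Sum>m\<in>UNIV. \<Sum>l\<in>UNIV. (1/2) * (matrix_inv (g c x) $ l $ m * (?dg j m k + ?dg k m j - ?dg m j k)
          * diff_form c u x $ l))"
      by (rule sum.swap)
    also have "\<dots> = (1/2) * (\<Sum>m\<in>UNIV. X $ m * (?dg j m k + ?dg k m j - ?dg m j k))"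
      by (simp add: X sum_distrib_left sum_distrib_right mult_ac)
    also have "(\<Sum>m\<in>UNIV. X $ m * (?dg j m k + ?dg k m j - ?dg m j k))
      = X \<bullet> (?g1 (axis j 1) *v axis k 1) + X \<bullet> (?g1 (axis k 1) *v axis j 1)
        - (\<Sum>m\<in>UNIV. X $ m * ?dg m j k)"
      by (simp add: inner_vec_def matrix_vector_mult_basis column_def sum.distrib sum_subtractf distrib_left right_diff_distrib)
    also have "(\<Sum>m\<in>UNIV. X $ m * ?dg m j k) = axis j 1 \<bullet> (?g1 X *v axis k 1)"
    proof -
      have "?g1 X = ?g1 (\<Sum>m\<in>UNIV. X $ m *\<^sub>R axis m 1)"
        using basis_expansion[of X] by (simp add: scalar_mult_eq_scaleR)
      also have "\<dots> = (\<Sum>m\<in>UNIV. X $ m *\<^sub>R ?g1 (axis m 1))"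
        by (simp add: linear_sum[OF lin_g] linear_scale[OF lin_g])
      finally show ?thesis
        by (simp add: matrix_vector_mult_basis column_def inner_axis' sum_component)
    qed
    finally show ?thesis
      by (simp add: hessian_def y_def[symmetric] pdu cov_hess_def)
  qed
  have lin1: "linear (\<lambda>Y. cov_hess ?d2 ?g1 X Y Z)" for Z
    unfolding cov_hess_def
    by (rule linearI) (simp_all add: linear_add[OF coord_d2_properties(2)[OF assms(1,2) y]]
      linear_scale[OF coord_d2_properties(2)[OF assms(1,2) y]] linear_add[OF lin_g] linear_scale[OF lin_g]
      matrix_vector_mult_add_rdistrib matrix_vector_right_distrib matrix_vector_mult_scaleR
      scaleR_matrix_vector_assoc[symmetric] inner_add_right inner_add_left algebra_simps)
  have lin2: "linear (cov_hess ?d2 ?g1 X Y)" for Y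
    unfolding cov_hess_def[abs_def]
    by (rule linearI) (simp_all add: linear_add[OF coord_d2_properties(3)[OF assms(1,2) y]]
      linear_scale[OF coord_d2_properties(3)[OF assms(1,2) y]] linear_add[OF lin_g] linear_scale[OF lin_g]
      matrix_vector_mult_add_rdistrib matrix_vector_right_distrib matrix_vector_mult_scaleR
      scaleR_matrix_vector_assoc[symmetric] inner_add_right inner_add_left algebra_simps)
  have "hessian g c u x = (\<chi> j k. cov_hess ?d2 ?g1 X (axis j 1) (axis k 1))"
    by (simp add: vec_eq_iff entry)
  then show ?thesis
    using bilinear_form_matrix[OF lin1 lin2] by (simp add: X_def y_def)
qed

lemma metric_d1_symmetric:
  assumes "c \<in> \<A>" "y \<in> chart_img c"
  shows "X \<bullet> (metric_d1 g c y Z *v Y) = Y \<bullet> (metric_d1 g c y Z *v X)"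
proof -
  have der: "((\<lambda>z. a \<bullet> (g c (chart_inv c z) *v b)) has_derivative (\<lambda>u. a \<bullet> (metric_d1 g c y u *v b))) (at y)" for a b
    by (intro has_derivative_inner_right metric_has_derivative assms
      bounded_linear.has_derivative[OF bounded_bilinear.bounded_linear_left[OF bounded_bilinear_matrix_vector]])
  have "X \<bullet> (g c (chart_inv c z) *v Y) = Y \<bullet> (g c (chart_inv c z) *v X)" if "z \<in> chart_img c" for z
    using metric_pos_def[OF assms(1) chart_inv_in[OF that]] inner_matrix_mult_left[of X "g c (chart_inv c z)" Y]
    by (simp add: pos_def_def inner_commute)
  then have "((\<lambda>z. Y \<bullet> (g c (chart_inv c z) *v X)) has_derivative (\<lambda>u. X \<bullet> (metric_d1 g c y u *v Y))) (at y)"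
    by (intro has_derivative_transform_within_open[OF der chart(2)[OF assms(1)] assms(2)])
  from fun_cong[OF has_derivative_unique[OF this der], of Z] show ?thesis .
qed

lemma hessian_symmetric:
  assumes "c \<in> \<A>" "C2_fun \<A> u" "x \<in> chart_dom c"
  shows "transpose (hessian g c u x) = hessian g c u x"
proof -
  have y: "chart_map c x \<in> chart_img c" using assms(3) by simp
  have "Y \<bullet> (hessian g c u x *v Z) = Z \<bullet> (hessian g c u x *v Y)" for Y Z
    unfolding hessian_form[OF assms] cov_hess_def
    using metric_d1_symmetric[OF assms(1) y] coord_d2_properties(1)[OF assms(1,2) y, of Y Z] by simp
  from this[of "axis j 1" "axis k 1" for j k]
  show ?thesis
    by (simp add: transpose_def vec_eq_iff matrix_vector_mult_basis column_def inner_axis')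
qed

end

lemma continuous_on_det:
  fixes M :: "'t::topological_space \<Rightarrow> real^'k^'k"
  assumes "\<And>i j. continuous_on S (\<lambda>x. M x $ i $ j)"
  shows "continuous_on S (\<lambda>x. det (M x))"
  unfolding det_def by (intro continuous_intros assms)

text \<open>Cramer's rule, which exhibits the entries of the inverse as continuous functions of the matrix.\<close>

lemma matrix_inv_cramer:
  fixes G :: "real^'n^'n"
  assumes "G ** matrix_inv G = mat 1"
  shows "matrix_inv G $ k $ l = det (\<chi> i j. if j = k then axis l 1 $ i else G $ i $ j) / det G"
proof -
  have "det G \<noteq> 0" using assms by (metis invertible_det_nz invertible_right_inverse)
  moreover have "G *v (matrix_inv G *v axis l 1) = axis l 1"
    by (simp add: matrix_vector_mul_assoc assms)
  ultimately have "matrix_inv G *v axis l 1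
      = (\<chi> k. det (\<chi> i j. if j = k then axis l 1 $ i else G $ i $ j) / det G)"
    using cramer by blast
  then have "(matrix_inv G *v axis l 1) $ k = det (\<chi> i j. if j = k then axis l 1 $ i else G $ i $ j) / det G"
    by simp
  then show ?thesis by (simp add: matrix_vector_mult_basis column_def)
qed

section \<open>Changes of charts\<close>

context riemannian_atlas
begin

lemma metric_sym: "c \<in> \<A> \<Longrightarrow> x \<in> chart_dom c \<Longrightarrow> X \<bullet> (g c x *v Z) = Z \<bullet> (g c x *v X)"
  using metric_pos_def[of c x] inner_matrix_mult_left[of X "g c x" Z]
  by (simp add: pos_def_def inner_commute)

lemma jac_surj:
  assumes "c \<in> \<A>" "d \<in> \<A>" "x \<in> chart_dom c" "x \<in> chart_dom d"
  shows "surj (\<lambda>v. jac c d x *v v)"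
proof -
  have "v = 0" if "jac c d x *v v = 0" for v
  proof (rule ccontr)
    assume "v \<noteq> 0"
    then have "v \<bullet> (g c x *v v) > 0" using metric_pos_def[OF assms(1,3)] by (simp add: pos_def_def)
    then show False using metric_form_transformation[OF assms, of v v] that by simp
  qed
  then have "inj (\<lambda>v. jac c d x *v v)"
    by (simp add: linear_injective_0)
  then show ?thesis by (intro linear_injective_imp_surjective) auto
qed

text \<open>Bounds in finitely many charts hold in all charts only because the quantities bounded are tensors.  For
  the Hessian, the contribution of the Christoffel symbols is essential here.\<close>

proposition change_of_chart:
  assumes c: "c \<in> \<A>" and d: "d \<in> \<A>" and x: "x \<in> chart_dom c" "x \<in> chart_dom d"
    and u: "C2_fun \<A> u"
  shows "diff_form c u x = transpose (jac c d x) *v diff_form d u x"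
    and "grad d u x = jac c d x *v grad c u x"
    and "Y \<bullet> (hessian g c u x *v Z) = (jac c d x *v Y) \<bullet> (hessian g d u x *v (jac c d x *v Z))"
proof -
  define V where "V = chart_map c ` (chart_dom c \<inter> chart_dom d)"
  define T where "T = chart_map d \<circ> chart_inv c"
  define y where "y = chart_map c x"
  define T1 where "T1 z = frechet_derivative T (at z)" for z
  define T2 where "T2 z Z = frechet_derivative (\<lambda>w. T1 w Z) (at z)" for z Z
  have V_iff: "z \<in> V \<longleftrightarrow> z \<in> chart_img c \<and> chart_inv c z \<in> chart_dom d" for z
    unfolding V_def using chart_inv_map[OF c] chart_map_inv[OF c] chart_inv_in[of z c] by (auto simp: image_iff)
  have Vc: "V \<subseteq> chart_img c" by (auto simp: V_def)
  have "V = chart_img c \<inter> chart_inv c -` chart_dom d" using V_iff by blast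
  then have V: "open V"
    using continuous_open_preimage[OF homeomorphism_cont2[OF chart(3)[OF c]] chart(2)[OF c] chart(1)[OF d]]
    by simp
  have yV: "y \<in> V" using x by (auto simp: V_def y_def)
  have yc: "y \<in> chart_img c" using yV Vc by blast
  have inv_y: "chart_inv c y = x" unfolding y_def by (rule chart_inv_map[OF c x(1)])
  have Ty: "T y = chart_map d x" by (simp add: T_def inv_y)
  have TV: "T ` V \<subseteq> chart_img d" using V_iff by (auto simp: T_def)
  have Tyd: "T y \<in> chart_img d" using TV yV by blast
  have inv_T: "chart_inv d (T z) = chart_inv c z" if "z \<in> V" for z
    using that V_iff chart_inv_map[OF d] by (simp add: T_def)
  have smooth: "smooth_on V T"
    using atlas c d unfolding smooth_atlas_def V_def T_def by blast
  note TC2 = Ck_on_2D[OF smooth_on_imp_Ck[OF smooth]]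
  have T1: "(T has_derivative T1 z) (at z)" if "z \<in> V" for z unfolding T1_def by (rule TC2(1)[OF that])
  have T2: "((\<lambda>w. T1 w Z) has_derivative T2 z Z) (at z)" if "z \<in> V" for z Z
    unfolding T1_def T2_def by (rule TC2(2)[OF that])
  have T2_cont: "continuous_on V (\<lambda>z. T2 z Z Y)" for Z Y
    unfolding T1_def T2_def by (rule TC2(3))
  have T2_sym: "T2 y Z Y = T2 y Y Z" for Z Y
    by (rule symmetric_second_derivative_vec[OF V yV T1 T2 T2_cont])
  have jac: "jac c d (chart_inv c z) *v v = T1 z v" if "z \<in> V" for z v
  proof -
    have "jac c d (chart_inv c z) = matrix (T1 z)"
      unfolding jac_def T1_def T_def using chart_map_inv[OF c] that Vc by auto
    then show ?thesis
      using matrix_works[of "T1 z"] has_derivative_linear[OF T1[OF that]]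
      by (simp add: linear_matrix_vector_mul_eq[symmetric])
  qed
  have jac_y: "jac c d x *v v = T1 y v" for v using jac[OF yV] by (simp add: inv_y)
  have surj: "\<exists>v. b = T1 y v" for b
    using jac_surj[OF c d x] unfolding jac_y surj_def by blast
  have fc: "(u \<circ> chart_inv c) z = (u \<circ> chart_inv d) (T z)" if "z \<in> V" for z
    using inv_T[OF that] by simp
  have chain: "frechet_derivative (u \<circ> chart_inv c) (at y) Y
      = frechet_derivative (u \<circ> chart_inv d) (at (T y)) (T1 y Y)"
    "coord_d2 c u y Z Y = coord_d2 d u (T y) (T1 y Z) (T1 y Y)
      + frechet_derivative (u \<circ> chart_inv d) (at (T y)) (T2 y Z Y)" for Y Z
    using chain_second_derivative[OF V yV chart(2)[OF d] TV T1 T2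
      coord_derivatives[OF d u] fc
      coord_derivatives(1)[OF c u subsetD[OF Vc]]
      coord_derivatives(2)[OF c u subsetD[OF Vc]]]
    by blast+
  have df: "diff_form c u x \<bullet> Y = diff_form d u x \<bullet> T1 y Y" for Y
    using diff_form_inner[OF c u x(1)] diff_form_inner[OF d u x(2)] chain(1)
    by (simp add: Ty y_def[symmetric])
  show 1: "diff_form c u x = transpose (jac c d x) *v diff_form d u x"
  proof (rule vector_eq_ldot[THEN iffD1, rule_format])
    fix Y
    show "Y \<bullet> diff_form c u x = Y \<bullet> (transpose (jac c d x) *v diff_form d u x)"
      using df[of Y] inner_matrix_mult_left[of Y "transpose (jac c d x)" "diff_form d u x"]
      by (simp only: transpose_transpose jac_y inner_commute)
  qed
  have gm: "X \<bullet> (g c (chart_inv c z) *v Z) = T1 z X \<bullet> (g d (chart_inv d (T z)) *v T1 z Z)" if "z \<in> V" for z X Z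
  proof -
    have "chart_inv c z \<in> chart_dom c" "chart_inv c z \<in> chart_dom d"
      by (rule chart_inv_in[OF conjunct1[OF that[unfolded V_iff]]],
        rule conjunct2[OF that[unfolded V_iff]])
    from metric_form_transformation[OF c d this, of X Z]
    show ?thesis by (simp only: jac[OF that] inv_T[OF that])
  qed
  have gJX: "g d x *v T1 y (grad c u x) = diff_form d u x"
  proof (rule vector_eq_ldot[THEN iffD1, rule_format])
    fix b
    obtain Y where Y: "b = T1 y Y" using surj by blast
    have "b \<bullet> (g d x *v T1 y (grad c u x)) = Y \<bullet> (g c x *v grad c u x)"
      using metric_form_transformation[OF c d x, of Y "grad c u x"] by (simp only: jac_y Y)
    also have "\<dots> = b \<bullet> diff_form d u x"
      using df[of Y] metric_mult_grad[OF c x(1)] by (simp only: Y inner_commute)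
    finally show "b \<bullet> (g d x *v T1 y (grad c u x)) = b \<bullet> diff_form d u x" .
  qed
  show 2: "grad d u x = jac c d x *v grad c u x"
  proof -
    have "grad d u x = (matrix_inv (g d x) ** g d x) *v T1 y (grad c u x)"
      unfolding grad_def[of d] gJX[symmetric] by (simp only: matrix_vector_mul_assoc)
    then show ?thesis using pos_def_inverse(2)[OF metric_pos_def[OF d x(2)]] by (simp add: jac_y)
  qed
  have dm: "X \<bullet> (metric_d1 g c y Y *v Z) = T2 y X Y \<bullet> (g d x *v T1 y Z)
      + T1 y X \<bullet> (metric_d1 g d (T y) (T1 y Y) *v T1 y Z) + T1 y X \<bullet> (g d x *v T2 y Z Y)" for X Y Z
    using metric_derivative_transformation[OF V yV T1[OF yV] T2[OF yV]
      metric_has_derivative[OF d Tyd] metric_has_derivative[OF c yc] gm, of X Y Z]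
    by (simp only: inv_T[OF yV] inv_y)
  have "cov_hess (coord_d2 c u y) (metric_d1 g c y) (grad c u x) Y Z
      = cov_hess (coord_d2 d u (T y)) (metric_d1 g d (T y)) (T1 y (grad c u x)) (T1 y Y) (T1 y Z)"
  proof (rule cov_hess_transformation[where J = "T1 y" and gd = "g d x" and ?T2.0 = "T2 y" and
        ?f1.0 = "frechet_derivative (u \<circ> chart_inv d) (at (T y))", OF chain(2) dm T2_sym])
    show "transpose (g d x) = g d x" using metric_pos_def[OF d x(2)] by (simp add: pos_def_def)
    fix v
    have "frechet_derivative (u \<circ> chart_inv d) (at (T y)) v = diff_form d u x \<bullet> v"
      using diff_form_inner[OF d u x(2)] by (simp add: Ty)
    also have "\<dots> = v \<bullet> (g d x *v T1 y (grad c u x))" by (simp only: gJX inner_commute)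
    also have "\<dots> = T1 y (grad c u x) \<bullet> (g d x *v v)" by (rule metric_sym[OF d x(2)])
    finally show "frechet_derivative (u \<circ> chart_inv d) (at (T y)) v = T1 y (grad c u x) \<bullet> (g d x *v v)" .
  qed
  then show "Y \<bullet> (hessian g c u x *v Z) = (jac c d x *v Y) \<bullet> (hessian g d u x *v (jac c d x *v Z))"
    unfolding hessian_form[OF c u x(1)] hessian_form[OF d u x(2)] jac_y 2
    by (simp only: Ty[symmetric] y_def[symmetric])
qed

section \<open>Continuity in charts\<close>

lemma chart_metric_continuous:
  assumes "c \<in> \<A>"
  shows "continuous_on (chart_img c) (\<lambda>y. g c (chart_inv c y))"
  by (rule has_derivative_imp_continuous_on) (rule metric_has_derivative[OF assms])

lemma chart_metric_inv_continuous:
  assumes c: "c \<in> \<A>"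
  shows "continuous_on (chart_img c) (\<lambda>y. matrix_inv (g c (chart_inv c y)) $ k $ l)"
proof -
  let ?G = "\<lambda>y. g c (chart_inv c y)"
  have inv: "?G y ** matrix_inv (?G y) = mat 1" if "y \<in> chart_img c" for y
    using pos_def_inverse(1)[OF metric_pos_def[OF c chart_inv_in[OF that]]] .
  have entry: "continuous_on (chart_img c) (\<lambda>y. ?G y $ i $ j)" for i j
    by (intro continuous_intros chart_metric_continuous[OF c])
  have "continuous_on (chart_img c)
      (\<lambda>y. det (\<chi> i j. if j = k then axis l 1 $ i else ?G y $ i $ j) / det (?G y))"
  proof (intro continuous_on_divide continuous_on_det entry)
    show "continuous_on (chart_img c) (\<lambda>y. (\<chi> i j. if j = k then axis l 1 $ i else ?G y $ i $ j) $ i $ j)" for i j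
      by (cases "j = k") (auto intro!: entry)
    show "\<forall>y\<in>chart_img c. det (?G y) \<noteq> 0"
      using inv by (metis invertible_det_nz invertible_right_inverse)
  qed
  then show ?thesis
    by (rule continuous_on_eq) (simp add: matrix_inv_cramer[OF inv])
qed

lemma chart_diff_form_continuous:
  assumes "c \<in> \<A>" "C2_fun \<A> u"
  shows "continuous_on (chart_img c) (\<lambda>y. diff_form c u (chart_inv c y))"
proof (rule continuous_on_vec_lambda[of _ "\<lambda>j y. diff_form c u (chart_inv c y) $ j", simplified])
  fix j
  have "continuous_on (chart_img c) (\<lambda>y. frechet_derivative (u \<circ> chart_inv c) (at y) (axis j 1))"
    by (rule has_derivative_imp_continuous_on) (rule coord_derivatives(2)[OF assms])
  then show "continuous_on (chart_img c) (\<lambda>y. diff_form c u (chart_inv c y) $ j)"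
    by (rule continuous_on_eq) (simp add: diff_form_def pd_def chart_map_inv[OF assms(1)])
qed

lemma metric_d1_continuous:
  assumes "c \<in> \<A>"
  shows "continuous_on (chart_img c) (\<lambda>y. metric_d1 g c y Y)"
proof -
  have "Ck_on 1 (chart_img c) (\<lambda>y. g c (chart_inv c y))"
    using metric assms smooth_on_imp_Ck unfolding riemannian_metric_def by blast
  then show ?thesis by (simp add: metric_d1_def)
qed

lemma chart_hessian_continuous:
  assumes c: "c \<in> \<A>" and u: "C2_fun \<A> u"
  shows "continuous_on (chart_img c) (\<lambda>y. hessian g c u (chart_inv c y))"
proof (intro continuous_on_vec_lambda[of _ "\<lambda>j y. hessian g c u (chart_inv c y) $ j", simplified]
    continuous_on_vec_lambda[of _ "\<lambda>k y. hessian g c u (chart_inv c y) $ j $ k" for j, simplified])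
  fix j k
  have grad: "continuous_on (chart_img c) (\<lambda>y. grad c u (chart_inv c y))"
    unfolding grad_def matrix_vector_mult_def
    by (intro continuous_on_vec_lambda continuous_intros chart_metric_inv_continuous[OF c]
      chart_diff_form_continuous[OF c u])
  have lin: "linear (metric_d1 g c y)" if "y \<in> chart_img c" for y
    using metric_has_derivative[OF c that] has_derivative_linear by blast
  have "continuous_on (chart_img c) (\<lambda>y. \<Sum>m\<in>UNIV. grad c u (chart_inv c y) $ m *\<^sub>R metric_d1 g c y (axis m 1))"
    by (intro continuous_intros grad metric_d1_continuous[OF c])
  moreover have "(\<Sum>m\<in>UNIV. X $ m *\<^sub>R metric_d1 g c y (axis m 1)) = metric_d1 g c y X"
    if "y \<in> chart_img c" for y X
  proof -
    have "metric_d1 g c y X = metric_d1 g c y (\<Sum>m\<in>UNIV. X $ m *\<^sub>R axis m 1)"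
      using basis_expansion[of X] by (simp add: scalar_mult_eq_scaleR)
    then show ?thesis by (simp add: linear_sum[OF lin[OF that]] linear_scale[OF lin[OF that]])
  qed
  ultimately have dX: "continuous_on (chart_img c) (\<lambda>y. metric_d1 g c y (grad c u (chart_inv c y)))"
    by (auto intro: continuous_on_eq)
  have "continuous_on (chart_img c) (\<lambda>y. cov_hess (coord_d2 c u y) (metric_d1 g c y)
      (grad c u (chart_inv c y)) (axis j 1) (axis k 1))"
    unfolding cov_hess_def
    by (intro continuous_intros coord_d2_continuous[OF c u] grad dX metric_d1_continuous[OF c]
      bounded_bilinear.continuous_on[OF bounded_bilinear_matrix_vector])
  then show "continuous_on (chart_img c) (\<lambda>y. hessian g c u (chart_inv c y) $ j $ k)"
  proof (rule continuous_on_eq)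
    fix y assume y: "y \<in> chart_img c"
    have "axis j 1 \<bullet> (hessian g c u (chart_inv c y) *v axis k 1) = hessian g c u (chart_inv c y) $ j $ k"
      by (simp add: matrix_vector_mult_basis column_def inner_axis')
    then show "cov_hess (coord_d2 c u y) (metric_d1 g c y) (grad c u (chart_inv c y)) (axis j 1) (axis k 1)
      = hessian g c u (chart_inv c y) $ j $ k"
      using hessian_form[OF c u chart_inv_in[OF y]] chart_map_inv[OF c y] by simp
  qed
qed

end

section \<open>Differences of functions\<close>

lemma Ck_on_cong:
  assumes "open S" "\<And>x. x \<in> S \<Longrightarrow> f x = h x" "Ck_on k S f"
  shows "Ck_on k S h"
  using assms(2,3)
proof (induction k arbitrary: f h)
  case 0
  then show ?case by (simp cong: continuous_on_cong)
next
  case (Suc k)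
  have der: "(h has_derivative frechet_derivative f (at x)) (at x)" if "x \<in> S" for x
  proof -
    have "(f has_derivative frechet_derivative f (at x)) (at x)"
      using Suc.prems(2) that by (intro iffD1[OF frechet_derivative_works]) simp
    then show ?thesis
      by (rule has_derivative_transform_within_open[OF _ assms(1) that]) (rule Suc.prems(1))
  qed
  have eq: "frechet_derivative f (at x) v = frechet_derivative h (at x) v" if "x \<in> S" for x v
    by (rule fun_cong[OF frechet_derivative_at[OF der[OF that]]])
  have "Ck_on k S (\<lambda>x. frechet_derivative h (at x) v)" for v
  proof (rule Suc.IH[OF eq])
    show "Ck_on k S (\<lambda>x. frechet_derivative f (at x) v)" using Suc.prems(2) by simp
  qed
  moreover have "h differentiable (at x)" if "x \<in> S" for x
    using der[OF that] by (rule differentiableI)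
  ultimately show ?case by simp
qed

lemma Ck_on_diff:
  assumes "open S" "Ck_on k S f" "Ck_on k S h"
  shows "Ck_on k S (\<lambda>x. f x - h x)"
  using assms(2,3)
proof (induction k arbitrary: f h)
  case 0
  then show ?case by (auto intro: continuous_intros)
next
  case (Suc k)
  have der: "((\<lambda>x. f x - h x) has_derivative
      (\<lambda>v. frechet_derivative f (at x) v - frechet_derivative h (at x) v)) (at x)" if "x \<in> S" for x
    using Suc.prems that by (intro has_derivative_diff iffD1[OF frechet_derivative_works]) simp_all
  have "Ck_on k S (\<lambda>x. frechet_derivative (\<lambda>x. f x - h x) (at x) v)" for v
  proof (rule Ck_on_cong[OF assms(1)])
    show "Ck_on k S (\<lambda>x. frechet_derivative f (at x) v - frechet_derivative h (at x) v)"
      using Suc.prems by (intro Suc.IH) simp_all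
    show "frechet_derivative f (at x) v - frechet_derivative h (at x) v
        = frechet_derivative (\<lambda>x. f x - h x) (at x) v" if "x \<in> S" for x
      by (rule fun_cong[OF frechet_derivative_at[OF der[OF that]]])
  qed
  moreover have "(\<lambda>x. f x - h x) differentiable (at x)" if "x \<in> S" for x
    using der[OF that] by (rule differentiableI)
  ultimately show ?case by simp
qed

section \<open>Compactness\<close>

text \<open>The sum of the absolute values of the constants that belong to a finite subcover serves everywhere.\<close>

lemma compact_uniform_bound:
  fixes Q :: "real \<Rightarrow> 'a::topological_space \<Rightarrow> bool"
  assumes "compact (UNIV :: 'a set)" and mono: "\<And>L L' x. L \<le> L' \<Longrightarrow> Q L x \<Longrightarrow> Q L' x"
    and local: "\<And>x0. \<exists>U L. open U \<and> x0 \<in> U \<and> (\<forall>x\<in>U. Q L x)"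
  shows "\<exists>L\<ge>0. \<forall>x. Q L x"
proof -
  have "\<forall>x0. \<exists>UL. open (fst UL) \<and> x0 \<in> fst UL \<and> (\<forall>x\<in>fst UL. Q (snd UL) x)"
    using local by fastforce
  then obtain UL where UL: "\<forall>x0. open (fst (UL x0)) \<and> x0 \<in> fst (UL x0) \<and> (\<forall>x\<in>fst (UL x0). Q (snd (UL x0)) x)"
    by (rule choice[THEN exE])
  define U where "U x0 = fst (UL x0)" for x0
  define L where "L x0 = snd (UL x0)" for x0
  have U: "open (U x0)" "x0 \<in> U x0" "x \<in> U x0 \<Longrightarrow> Q (L x0) x" for x x0
    using UL by (simp_all add: U_def L_def)
  obtain D where D: "finite D" "UNIV \<subseteq> (\<Union>x\<in>D. U x)"
  proof (rule compactE_image[OF assms(1), of UNIV U])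
    show "UNIV \<subseteq> (\<Union>x\<in>UNIV. U x)" using U(2) by blast
  qed (use U(1) in auto)
  show ?thesis
  proof (intro exI[of _ "\<Sum>x\<in>D. \<bar>L x\<bar>"] conjI allI)
    show "0 \<le> (\<Sum>x\<in>D. \<bar>L x\<bar>)" by (simp add: sum_nonneg)
    fix x
    obtain x0 where x0: "x0 \<in> D" "x \<in> U x0" using D by auto
    have "L x0 \<le> \<bar>L x0\<bar>" by simp
    also have "\<dots> \<le> (\<Sum>x\<in>D. \<bar>L x\<bar>)" using D x0 by (intro member_le_sum) auto
    finally have "L x0 \<le> (\<Sum>x\<in>D. \<bar>L x\<bar>)" .
    then show "Q (\<Sum>x\<in>D. \<bar>L x\<bar>) x" by (rule mono[OF _ U(3)[OF x0(2)]])
  qed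
qed

lemma continuous_on_quadratic_form:
  fixes M :: "'t::topological_space \<Rightarrow> real^'n^'n" and v :: "'t \<Rightarrow> real^'n"
  assumes "continuous_on S M" "continuous_on S v"
  shows "continuous_on S (\<lambda>z. v z \<bullet> (M z *v v z))"
  by (intro continuous_on_inner assms bounded_bilinear.continuous_on[OF bounded_bilinear_matrix_vector])

lemma quadratic_form_nonneg_if_on_sphere:
  fixes M :: "real^'n^'n"
  assumes "\<And>v. norm v = 1 \<Longrightarrow> 0 \<le> v \<bullet> (M *v v)"
  shows "0 \<le> x \<bullet> (M *v x)"
proof (cases "x = 0")
  case False
  have "x \<bullet> (M *v x) = (norm x)\<^sup>2 * ((x /\<^sub>R norm x) \<bullet> (M *v (x /\<^sub>R norm x)))"
    using False by (simp add: matrix_vector_mult_scaleR power2_eq_square field_simps)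
  then show ?thesis using assms[of "x /\<^sub>R norm x"] False by simp
qed simp

context riemannian_atlas
begin

lemma C2_fun_diff:
  assumes "C2_fun \<A> u" "C2_fun \<A> v"
  shows "C2_fun \<A> (\<lambda>z. u z - v z)"
  unfolding C2_fun_def
proof
  fix c assume c: "c \<in> \<A>"
  have "(\<lambda>z. u z - v z) \<circ> chart_inv c = (\<lambda>y. (u \<circ> chart_inv c) y - (v \<circ> chart_inv c) y)" by auto
  then show "Ck_on 2 (chart_img c) ((\<lambda>z. u z - v z) \<circ> chart_inv c)"
    using Ck_on_diff[OF chart(2)[OF c] bspec[OF assms(1)[unfolded C2_fun_def] c]
      bspec[OF assms(2)[unfolded C2_fun_def] c]] by (simp only:)
qed

lemma derivatives_diff:
  assumes c: "c \<in> \<A>" and x: "x \<in> chart_dom c" and u: "C2_fun \<A> u" and v: "C2_fun \<A> v"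
  shows "diff_form c (\<lambda>z. u z - v z) x = diff_form c u x - diff_form c v x"
    and "hessian g c (\<lambda>z. u z - v z) x = hessian g c u x - hessian g c v x"
proof -
  let ?d = "\<lambda>z. u z - v z"
  have d: "C2_fun \<A> ?d" by (rule C2_fun_diff[OF u v])
  have eq: "?d \<circ> chart_inv c = (\<lambda>y. (u \<circ> chart_inv c) y - (v \<circ> chart_inv c) y)" by auto
  have first: "frechet_derivative (?d \<circ> chart_inv c) (at y) Y
      = frechet_derivative (u \<circ> chart_inv c) (at y) Y - frechet_derivative (v \<circ> chart_inv c) (at y) Y"
    if "y \<in> chart_img c" for y Y
  proof -
    have "((?d \<circ> chart_inv c) has_derivative (\<lambda>Y. frechet_derivative (u \<circ> chart_inv c) (at y) Y
        - frechet_derivative (v \<circ> chart_inv c) (at y) Y)) (at y)"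
      unfolding eq by (intro has_derivative_diff coord_derivatives(1)[OF c] u v that)
    from fun_cong[OF frechet_derivative_at[OF this], of Y] show ?thesis by simp
  qed
  have y: "chart_map c x \<in> chart_img c" using x by simp
  have second: "coord_d2 c ?d (chart_map c x) Z Y
      = coord_d2 c u (chart_map c x) Z Y - coord_d2 c v (chart_map c x) Z Y" for Y Z
  proof -
    have "((\<lambda>z. frechet_derivative (u \<circ> chart_inv c) (at z) Z - frechet_derivative (v \<circ> chart_inv c) (at z) Z)
      has_derivative (\<lambda>Y. coord_d2 c u (chart_map c x) Z Y - coord_d2 c v (chart_map c x) Z Y)) (at (chart_map c x))"
      by (intro has_derivative_diff coord_derivatives(2)[OF c] u v y)
    then have "((\<lambda>z. frechet_derivative (?d \<circ> chart_inv c) (at z) Z)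
      has_derivative (\<lambda>Y. coord_d2 c u (chart_map c x) Z Y - coord_d2 c v (chart_map c x) Z Y)) (at (chart_map c x))"
      by (rule has_derivative_transform_within_open[OF _ chart(2)[OF c] y]) (simp add: first)
    from fun_cong[OF has_derivative_unique[OF coord_derivatives(2)[OF c d y] this], of Y] show ?thesis .
  qed
  show df: "diff_form c ?d x = diff_form c u x - diff_form c v x"
    using first[OF y] by (simp add: diff_form_def pd_def vec_eq_iff)
  have grad: "grad c ?d x = grad c u x - grad c v x"
    by (simp add: grad_def df matrix_vector_mult_diff_distrib)
  have lin_g: "linear (metric_d1 g c (chart_map c x))"
    using metric_has_derivative[OF c y] has_derivative_linear by blast
  have "Y \<bullet> (hessian g c ?d x *v Z) = Y \<bullet> ((hessian g c u x - hessian g c v x) *v Z)" for Y Z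
    unfolding matrix_vector_mult_diff_rdistrib inner_diff_right
      hessian_form[OF c d x] hessian_form[OF c u x] hessian_form[OF c v x] cov_hess_def second grad
    by (simp add: linear_diff[OF lin_g] matrix_vector_mult_diff_rdistrib inner_diff_left inner_diff_right
      algebra_simps)
  from this[of "axis j 1" "axis k 1" for j k]
  show "hessian g c ?d x = hessian g c u x - hessian g c v x"
    by (simp add: vec_eq_iff matrix_vector_mult_basis column_def inner_axis')
qed

lemma conorm_diff_form:
  assumes "c \<in> \<A>" "x \<in> chart_dom c"
  shows "conorm g c x (diff_form c u x) = sqrt (grad c u x \<bullet> (g c x *v grad c u x))"
proof -
  have "(\<Sum>j\<in>UNIV. \<Sum>k\<in>UNIV. matrix_inv (g c x) $ j $ k * diff_form c u x $ j * diff_form c u x $ k)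
    = diff_form c u x \<bullet> grad c u x"
    by (simp add: grad_def inner_vec_def matrix_vector_mult_def sum_distrib_left mult_ac)
  then show ?thesis using metric_mult_grad[OF assms] by (simp add: conorm_def inner_commute)
qed

lemma chart_neighbourhood:
  obtains d U K where "d \<in> \<A>" "x0 \<in> U" "open U" "U \<subseteq> chart_dom d" "compact K" "K \<subseteq> chart_img d"
    "\<And>x. x \<in> U \<Longrightarrow> chart_map d x \<in> K"
proof -
  have "x0 \<in> (\<Union>c\<in>\<A>. chart_dom c)" using atlas by (simp add: smooth_atlas_def)
  then obtain d where d: "d \<in> \<A>" "x0 \<in> chart_dom d" by blast
  then have "chart_map d x0 \<in> chart_img d" by simp
  then obtain r where r: "r > 0" "cball (chart_map d x0) r \<subseteq> chart_img d"
    using chart(2)[OF d(1)] open_contains_cball by blast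
  define U where "U = chart_dom d \<inter> chart_map d -` ball (chart_map d x0) r"
  have "open U" unfolding U_def
    by (rule continuous_open_preimage[OF homeomorphism_cont1[OF chart(3)[OF d(1)]] chart(1)[OF d(1)] open_ball])
  moreover have "x0 \<in> U" using d r by (simp add: U_def)
  moreover have "chart_map d x \<in> cball (chart_map d x0) r" if "x \<in> U" for x
    using that by (auto simp: U_def)
  moreover have "U \<subseteq> chart_dom d" by (simp add: U_def)
  ultimately show ?thesis
    by (intro that[of d U "cball (chart_map d x0) r"] d(1) r(2) compact_cball)
qed

lemma A_form_transformation:
  assumes A: "smooth_sym_bilin \<A> A" and cd: "c \<in> \<A>" "d \<in> \<A>" "x \<in> chart_dom c" "x \<in> chart_dom d"
  shows "Y \<bullet> (A c x (transpose (jac c d x) *v \<xi>) t *v Z)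
    = (jac c d x *v Y) \<bullet> (A d x \<xi> t *v (jac c d x *v Z))"
proof -
  have "A c x (transpose (jac c d x) *v \<xi>) t = transpose (jac c d x) ** A d x \<xi> t ** jac c d x"
    using A cd unfolding smooth_sym_bilin_def by blast
  then have "Y \<bullet> (A c x (transpose (jac c d x) *v \<xi>) t *v Z)
      = Y \<bullet> (transpose (jac c d x) *v (A d x \<xi> t *v (jac c d x *v Z)))"
    by (simp only: matrix_vector_mul_assoc matrix_mul_assoc)
  then show ?thesis by (simp only: inner_matrix_mult_left[of Y "transpose (jac c d x)"] transpose_transpose)
qed

lemma continuous_on_A:
  fixes f :: "'t::topological_space \<Rightarrow> 'n rvec"
  assumes A: "smooth_sym_bilin \<A> A" and c: "c \<in> \<A>"
    and f: "continuous_on S f" "f ` S \<subseteq> chart_img c" and h: "continuous_on S h" and t: "continuous_on S t"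
  shows "continuous_on S (\<lambda>z. A c (chart_inv c (f z)) (h z) (t z))"
proof -
  have "smooth_on (chart_img c \<times> UNIV \<times> UNIV) (\<lambda>(y, \<xi>, t). A c (chart_inv c y) \<xi> t)"
    using A c unfolding smooth_sym_bilin_def by blast
  from smooth_on_imp_Ck[OF this, of 0]
  have joint: "continuous_on (chart_img c \<times> UNIV \<times> UNIV) (\<lambda>(y, \<xi>, t). A c (chart_inv c y) \<xi> t)" by simp
  have "continuous_on S (\<lambda>z. (f z, h z, t z))" by (intro continuous_on_Pair f h t)
  moreover have "(\<lambda>z. (f z, h z, t z)) ` S \<subseteq> chart_img c \<times> UNIV \<times> UNIV" using f(2) by auto
  ultimately show ?thesis using continuous_on_compose2[OF joint] by fastforce
qed

lemma continuous_on_chart_function: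
  assumes "c \<in> \<A>" "C2_fun \<A> u"
  shows "continuous_on (chart_img c) (\<lambda>y. u (chart_inv c y))"
  using has_derivative_imp_continuous_on[OF coord_derivatives(1)[OF assms]] by (simp add: o_def)

lemma Ahess_form_transformation:
  assumes A: "smooth_sym_bilin \<A> A" and u: "C2_fun \<A> u"
    and cd: "c \<in> \<A>" "d \<in> \<A>" "x \<in> chart_dom c" "x \<in> chart_dom d"
  shows "Y \<bullet> (Ahess g A c u x *v Z) = (jac c d x *v Y) \<bullet> (Ahess g A d u x *v (jac c d x *v Z))"
  unfolding Ahess_def matrix_vector_mult_add_rdistrib inner_add_right
  using change_of_chart(1,3)[OF cd u] A_form_transformation[OF A cd] by metis

text \<open>The minimum of the metric over the unit vectors at the points of \<open>K\<close>.\<close>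

lemma metric_coercive:
  assumes d: "d \<in> \<A>" and K: "compact K" "K \<subseteq> chart_img d"
  obtains \<gamma> where "\<gamma> > 0" "\<And>y v. y \<in> K \<Longrightarrow> \<gamma> * (v \<bullet> v) \<le> v \<bullet> (g d (chart_inv d y) *v v)"
proof (cases "K = {}")
  case False
  define q where "q z = snd z \<bullet> (g d (chart_inv d (fst z)) *v snd z)" for z :: "'n rvec \<times> 'n rvec"
  have "continuous_on (K \<times> sphere 0 1) (\<lambda>z. g d (chart_inv d (fst z)))"
    by (rule continuous_on_compose2[OF chart_metric_continuous[OF d]]) (use K in \<open>auto intro!: continuous_intros\<close>)
  then have "continuous_on (K \<times> sphere 0 1) q"
    unfolding q_def by (intro continuous_on_quadratic_form continuous_intros)
  moreover have "compact (K \<times> sphere (0::'n rvec) 1)" using K by (intro compact_Times) auto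
  moreover obtain a :: "'n rvec" where "norm a = 1" using vector_choose_size[of 1] by auto
  then have "K \<times> sphere (0::'n rvec) 1 \<noteq> {}" using False by auto
  ultimately obtain z0 where z0: "z0 \<in> K \<times> sphere 0 1" "\<And>z. z \<in> K \<times> sphere 0 1 \<Longrightarrow> q z0 \<le> q z"
    using continuous_attains_inf by metis
  define \<gamma> where "\<gamma> = q z0"
  have "snd z0 \<noteq> 0" using z0(1) by auto
  moreover have "pos_def (g d (chart_inv d (fst z0)))"
    using z0(1) K(2) by (intro metric_pos_def[OF d] chart_inv_in) auto
  ultimately have "\<gamma> > 0" by (simp add: \<gamma>_def q_def pos_def_def)
  moreover have "\<gamma> * (v \<bullet> v) \<le> v \<bullet> (g d (chart_inv d y) *v v)" if "y \<in> K" for y v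
  proof -
    have "0 \<le> v \<bullet> ((g d (chart_inv d y) - mat \<gamma>) *v v)"
    proof (rule quadratic_form_nonneg_if_on_sphere)
      fix v :: "'n rvec" assume v: "norm v = 1"
      then have "v \<bullet> v = 1" by (simp add: norm_eq_1)
      then show "0 \<le> v \<bullet> ((g d (chart_inv d y) - mat \<gamma>) *v v)"
        using z0(2)[of "(y, v)"] that v
        by (simp add: \<gamma>_def q_def matrix_vector_mult_diff_rdistrib mat_mult_vec inner_diff_right)
    qed
    then show ?thesis by (simp add: matrix_vector_mult_diff_rdistrib mat_mult_vec inner_diff_right)
  qed
  ultimately show ?thesis using that by blast
qed (use that[of 1] in simp)

text \<open>By compactness it is enough to bound the form near a single point in a single chart; in every other chart
  both forms take the same values on corresponding vectors.\<close>

proposition Ahess_bounded_below: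
  assumes comp: "compact (UNIV :: 'm set)" and A: "smooth_sym_bilin \<A> A" and w: "C2_fun \<A> w"
  obtains L where "L \<ge> 0" "\<And>c x Y. c \<in> \<A> \<Longrightarrow> x \<in> chart_dom c \<Longrightarrow>
    - L * (Y \<bullet> (g c x *v Y)) \<le> Y \<bullet> (Ahess g A c w x *v Y)"
proof -
  define Q where "Q L x \<longleftrightarrow> (\<forall>c\<in>\<A>. x \<in> chart_dom c \<longrightarrow>
    (\<forall>Y. - L * (Y \<bullet> (g c x *v Y)) \<le> Y \<bullet> (Ahess g A c w x *v Y)))" for L x
  have gpos: "0 \<le> Y \<bullet> (g c x *v Y)" if "c \<in> \<A>" "x \<in> chart_dom c" for c x Y
    using metric_pos_def[OF that] by (cases "Y = 0") (auto simp: pos_def_def less_imp_le)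
  have "\<exists>L\<ge>0. \<forall>x. Q L x"
  proof (rule compact_uniform_bound[OF comp])
    fix L L' x assume "L \<le> L'" "Q L x"
    show "Q L' x" unfolding Q_def
    proof (intro ballI impI allI)
      fix c Y assume c: "c \<in> \<A>" "x \<in> chart_dom c"
      have "L * (Y \<bullet> (g c x *v Y)) \<le> L' * (Y \<bullet> (g c x *v Y))"
        by (intro mult_right_mono \<open>L \<le> L'\<close> gpos c)
      then show "- L' * (Y \<bullet> (g c x *v Y)) \<le> Y \<bullet> (Ahess g A c w x *v Y)"
        using \<open>Q L x\<close> c unfolding Q_def by (smt (verit) mult_minus_left)
    qed
  next
    fix x0
    obtain d U K where d: "d \<in> \<A>" and U: "x0 \<in> U" "open U" "U \<subseteq> chart_dom d"
      and K: "compact K" "K \<subseteq> chart_img d" "\<And>x. x \<in> U \<Longrightarrow> chart_map d x \<in> K"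
      using chart_neighbourhood[of x0] by metis
    obtain \<gamma> where \<gamma>: "\<gamma> > 0" "\<And>y v. y \<in> K \<Longrightarrow> \<gamma> * (v \<bullet> v) \<le> v \<bullet> (g d (chart_inv d y) *v v)"
      using metric_coercive[OF d K(1,2)] by blast
    define q where "q z = snd z \<bullet> (Ahess g A d w (chart_inv d (fst z)) *v snd z)" for z :: "'n rvec \<times> 'n rvec"
    have "continuous_on (chart_img d) (\<lambda>y. Ahess g A d w (chart_inv d y))"
      unfolding Ahess_def
      by (intro continuous_intros chart_hessian_continuous[OF d w] continuous_on_A[OF A d]
        chart_diff_form_continuous[OF d w] continuous_on_chart_function[OF d w]) auto
    then have "continuous_on (K \<times> sphere 0 1) (\<lambda>z. Ahess g A d w (chart_inv d (fst z)))"
      by (rule continuous_on_compose2) (use K in \<open>auto intro!: continuous_intros\<close>)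
    then have "continuous_on (K \<times> sphere 0 1) q"
      unfolding q_def by (intro continuous_on_quadratic_form continuous_intros)
    then have "bounded (q ` (K \<times> sphere 0 1))"
      using K by (intro compact_imp_bounded compact_continuous_image compact_Times) auto
    then obtain b where b: "\<And>z. z \<in> K \<times> sphere 0 1 \<Longrightarrow> \<bar>q z\<bar> \<le> b" by (auto simp: bounded_iff)
    have "Q (\<bar>b\<bar> / \<gamma>) x" if x: "x \<in> U" for x
      unfolding Q_def
    proof (intro ballI impI allI)
      fix c Y assume c: "c \<in> \<A>" "x \<in> chart_dom c"
      have xd: "x \<in> chart_dom d" using x U by blast
      have inv: "chart_inv d (chart_map d x) = x" by (rule chart_inv_map[OF d xd])
      let ?L = "\<bar>b\<bar> / \<gamma>"
      have "0 \<le> Z \<bullet> ((?L *\<^sub>R g d x + Ahess g A d w x) *v Z)" for Z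
      proof (rule quadratic_form_nonneg_if_on_sphere)
        fix v :: "'n rvec" assume v: "norm v = 1"
        then have "v \<bullet> v = 1" by (simp add: norm_eq_1)
        then have "\<gamma> \<le> v \<bullet> (g d x *v v)" using \<gamma>(2)[OF K(3)[OF x], of v] by (simp add: inv)
        then have "?L * \<gamma> \<le> ?L * (v \<bullet> (g d x *v v))" using \<gamma>(1) by (intro mult_left_mono) auto
        moreover have "- \<bar>b\<bar> \<le> v \<bullet> (Ahess g A d w x *v v)"
          using b[of "(chart_map d x, v)"] K(3)[OF x] v by (simp add: q_def inv)
        ultimately show "0 \<le> v \<bullet> ((?L *\<^sub>R g d x + Ahess g A d w x) *v v)"
          using \<gamma>(1) by (simp add: matrix_vector_mult_add_rdistrib scaleR_matrix_vector_assoc[symmetric] inner_add_right)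
      qed
      from this[of "jac c d x *v Y"]
      have "- ?L * ((jac c d x *v Y) \<bullet> (g d x *v (jac c d x *v Y)))
          \<le> (jac c d x *v Y) \<bullet> (Ahess g A d w x *v (jac c d x *v Y))"
        by (simp add: matrix_vector_mult_add_rdistrib scaleR_matrix_vector_assoc[symmetric] inner_add_right)
      then show "- ?L * (Y \<bullet> (g c x *v Y)) \<le> Y \<bullet> (Ahess g A c w x *v Y)"
        by (simp only: metric_form_transformation[OF c(1) d c(2) xd]
          Ahess_form_transformation[OF A w c(1) d c(2) xd])
    qed
    then show "\<exists>U L. open U \<and> x0 \<in> U \<and> (\<forall>x\<in>U. Q L x)" using U by blast
  qed
  then obtain L where L: "L \<ge> 0" "\<forall>x. Q L x" by blast
  show ?thesis by (rule that[OF L(1)]) (use L(2) in \<open>simp add: Q_def\<close>)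
qed

text \<open>\<open>A\<close> is uniformly continuous in the covector variable near the differential of \<open>w\<close>.  In a chart the
  perturbation is written as \<open>g d x *v \<zeta>\<close>, so that its length is measured by the metric itself.\<close>

proposition A_perturbation_bound:
  assumes comp: "compact (UNIV :: 'm set)" and A: "smooth_sym_bilin \<A> A" and w: "C2_fun \<A> w"
    and \<epsilon>: "\<epsilon> > 0"
  obtains \<rho> where "\<rho> > 0" "\<And>c x u Y. c \<in> \<A> \<Longrightarrow> x \<in> chart_dom c \<Longrightarrow> C2_fun \<A> u \<Longrightarrow>
    conorm g c x (diff_form c (\<lambda>z. u z - w z) x) \<le> \<rho> \<Longrightarrow>
    - \<epsilon> * (Y \<bullet> (g c x *v Y)) \<le> Y \<bullet> ((A c x (diff_form c u x) t - A c x (diff_form c w x) t) *v Y)"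
proof -
  define P where "P \<rho> x \<longleftrightarrow> (\<forall>c\<in>\<A>. x \<in> chart_dom c \<longrightarrow> (\<forall>u. C2_fun \<A> u \<longrightarrow>
    conorm g c x (diff_form c (\<lambda>z. u z - w z) x) \<le> \<rho> \<longrightarrow> (\<forall>Y.
    - \<epsilon> * (Y \<bullet> (g c x *v Y)) \<le> Y \<bullet> ((A c x (diff_form c u x) t - A c x (diff_form c w x) t) *v Y))))" for \<rho> x
  \<comment> \<open>a small radius is encoded as \<open>exp (- L)\<close>, for which smaller radii mean larger constants\<close>
  have "\<exists>L\<ge>0. \<forall>x. P (exp (- L)) x"
  proof (rule compact_uniform_bound[OF comp])
    fix L L' x assume "L \<le> L'" "P (exp (- L)) x"
    moreover have "exp (- L') \<le> exp (- L)" using \<open>L \<le> L'\<close> by simp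
    ultimately show "P (exp (- L')) x" unfolding P_def by (meson order_trans)
  next
    fix x0
    obtain d U K where d: "d \<in> \<A>" and U: "x0 \<in> U" "open U" "U \<subseteq> chart_dom d"
      and K: "compact K" "K \<subseteq> chart_img d" "\<And>x. x \<in> U \<Longrightarrow> chart_map d x \<in> K"
      using chart_neighbourhood[of x0] by metis
    obtain \<gamma> where \<gamma>: "\<gamma> > 0" "\<And>y v. y \<in> K \<Longrightarrow> \<gamma> * (v \<bullet> v) \<le> v \<bullet> (g d (chart_inv d y) *v v)"
      using metric_coercive[OF d K(1,2)] by blast
    define B where "B y \<zeta> = A d (chart_inv d y) (diff_form d w (chart_inv d y) + g d (chart_inv d y) *v \<zeta>) t
      - A d (chart_inv d y) (diff_form d w (chart_inv d y)) t" for y \<zeta>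
    define S where "S = K \<times> cball (0::'n rvec) 1 \<times> sphere (0::'n rvec) 1"
    define q where "q z = snd (snd z) \<bullet> (B (fst z) (fst (snd z)) *v snd (snd z))" for z
    have S: "compact S" unfolding S_def using K by (intro compact_Times) auto
    have fstS: "continuous_on S fst" "fst ` S \<subseteq> chart_img d" using K by (auto simp: S_def intro!: continuous_intros)
    have dw: "continuous_on S (\<lambda>z. diff_form d w (chart_inv d (fst z)))"
      by (rule continuous_on_compose2[OF chart_diff_form_continuous[OF d w] fstS])
    have gS: "continuous_on S (\<lambda>z. g d (chart_inv d (fst z)))"
      by (rule continuous_on_compose2[OF chart_metric_continuous[OF d] fstS])
    have "continuous_on S (\<lambda>z. B (fst z) (fst (snd z)))"
      unfolding B_def
      by (intro continuous_on_diff continuous_on_A[OF A d fstS] continuous_on_add dw continuous_on_const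
        bounded_bilinear.continuous_on[OF bounded_bilinear_matrix_vector] gS continuous_intros)
    then have "continuous_on S q"
      unfolding q_def by (intro continuous_on_quadratic_form continuous_intros)
    then have "uniformly_continuous_on S q" by (rule compact_uniformly_continuous[OF _ S])
    moreover have "\<epsilon> * \<gamma> > 0" using \<epsilon> \<gamma> by simp
    ultimately obtain \<eta> where \<eta>: "\<eta> > 0"
      "\<And>z z'. z \<in> S \<Longrightarrow> z' \<in> S \<Longrightarrow> dist z' z < \<eta> \<Longrightarrow> dist (q z') (q z) < \<epsilon> * \<gamma>"
      unfolding uniformly_continuous_on_def by metis
    define r where "r = min \<eta> 1 / 2"
    have r: "r > 0" "r < \<eta>" "r \<le> 1" using \<eta>(1) by (auto simp: r_def min_def)
    define \<rho> where "\<rho> = sqrt \<gamma> * r"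
    have \<rho>: "\<rho> > 0" using \<gamma> r by (simp add: \<rho>_def)
    have "P \<rho> x" if x: "x \<in> U" for x
      unfolding P_def
    proof (intro ballI impI allI)
      fix c u Y
      assume c: "c \<in> \<A>" "x \<in> chart_dom c" and u: "C2_fun \<A> u"
        and con: "conorm g c x (diff_form c (\<lambda>z. u z - w z) x) \<le> \<rho>"
      have xd: "x \<in> chart_dom d" using x U by blast
      note tr = c(1) d c(2) xd
      have inv: "chart_inv d (chart_map d x) = x" by (rule chart_inv_map[OF d xd])
      let ?v = "\<lambda>z. u z - w z"
      have v: "C2_fun \<A> ?v" by (rule C2_fun_diff[OF u w])
      define \<zeta> where "\<zeta> = grad d ?v x"
      have "\<zeta> \<bullet> (g d x *v \<zeta>) = grad c ?v x \<bullet> (g c x *v grad c ?v x)"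
        unfolding \<zeta>_def metric_form_transformation[OF tr] change_of_chart(2)[OF tr v] ..
      then have "sqrt (\<zeta> \<bullet> (g d x *v \<zeta>)) \<le> sqrt \<gamma> * r"
        using con by (simp add: conorm_diff_form[OF c] \<rho>_def)
      moreover have "sqrt (\<gamma> * (\<zeta> \<bullet> \<zeta>)) \<le> sqrt (\<zeta> \<bullet> (g d x *v \<zeta>))"
        using \<gamma>(2)[OF K(3)[OF x], of \<zeta>] by (simp add: inv)
      ultimately have "sqrt \<gamma> * norm \<zeta> \<le> sqrt \<gamma> * r"
        by (simp add: real_sqrt_mult norm_eq_sqrt_inner)
      then have \<zeta>: "norm \<zeta> \<le> r" using \<gamma>(1) by simp
      have Bd: "A d x (diff_form d u x) t - A d x (diff_form d w x) t = B (chart_map d x) \<zeta>"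
        unfolding B_def inv \<zeta>_def metric_mult_grad[OF d xd] derivatives_diff(1)[OF d xd u w] by simp
      have "0 \<le> Z \<bullet> ((\<epsilon> *\<^sub>R g d x + B (chart_map d x) \<zeta>) *v Z)" for Z
      proof (rule quadratic_form_nonneg_if_on_sphere)
        fix a :: "'n rvec" assume a: "norm a = 1"
        have "dist (q (chart_map d x, \<zeta>, a)) (q (chart_map d x, 0, a)) < \<epsilon> * \<gamma>"
          using \<zeta> r a K(3)[OF x] by (intro \<eta>(2)) (auto simp: S_def dist_Pair_Pair)
        moreover have "q (chart_map d x, 0, a) = 0" by (simp add: q_def B_def)
        ultimately have "- (\<epsilon> * \<gamma>) \<le> a \<bullet> (B (chart_map d x) \<zeta> *v a)" by (simp add: q_def dist_real_def)
        moreover have "\<epsilon> * \<gamma> \<le> \<epsilon> * (a \<bullet> (g d x *v a))"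
        proof -
          have "a \<bullet> a = 1" using a by (simp add: norm_eq_1)
          then show ?thesis using \<gamma>(2)[OF K(3)[OF x], of a] \<epsilon> by (intro mult_left_mono) (simp_all add: inv)
        qed
        ultimately show "0 \<le> a \<bullet> ((\<epsilon> *\<^sub>R g d x + B (chart_map d x) \<zeta>) *v a)"
          by (simp add: matrix_vector_mult_add_rdistrib scaleR_matrix_vector_assoc[symmetric] inner_add_right)
      qed
      from this[of "jac c d x *v Y"]
      have "- \<epsilon> * ((jac c d x *v Y) \<bullet> (g d x *v (jac c d x *v Y)))
          \<le> (jac c d x *v Y) \<bullet> ((A d x (diff_form d u x) t - A d x (diff_form d w x) t) *v (jac c d x *v Y))"
        by (simp add: Bd matrix_vector_mult_add_rdistrib scaleR_matrix_vector_assoc[symmetric] inner_add_right)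
      then show "- \<epsilon> * (Y \<bullet> (g c x *v Y))
          \<le> Y \<bullet> ((A c x (diff_form c u x) t - A c x (diff_form c w x) t) *v Y)"
        by (simp only: matrix_vector_mult_diff_rdistrib inner_diff_right
          metric_form_transformation[OF tr] change_of_chart(1)[OF tr u] change_of_chart(1)[OF tr w]
          A_form_transformation[OF A tr])
    qed
    then have "\<forall>x\<in>U. P (exp (- (- ln \<rho>))) x" using \<rho> by simp
    then show "\<exists>U L. open U \<and> x0 \<in> U \<and> (\<forall>x\<in>U. P (exp (- L)) x)" using U by blast
  qed
  then obtain L where L: "\<forall>x. P (exp (- L)) x" by blast
  show ?thesis by (rule that[of "exp (- L)"]) (use L in \<open>simp_all add: P_def\<close>)
qed

end

section \<open>Concavity of \<open>A\<close> in the covector\<close>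

lemma concave_below_tangent:
  fixes \<psi> :: "'a::real_normed_vector \<Rightarrow> real"
  assumes \<psi>: "\<And>\<xi>. (\<psi> has_derivative \<psi>1 \<xi>) (at \<xi>)"
    and \<psi>1: "\<And>\<xi> w. ((\<lambda>\<xi>. \<psi>1 \<xi> w) has_derivative \<psi>2 \<xi> w) (at \<xi>)"
    and neg: "\<And>\<xi>. \<psi>2 \<xi> \<beta> \<beta> \<le> 0"
  shows "\<psi> (\<alpha> + \<beta>) \<le> \<psi> \<alpha> + \<psi>1 \<alpha> \<beta>"
proof -
  have d1: "DERIV (\<lambda>s. \<psi> (\<alpha> + s *\<^sub>R \<beta>)) s :> \<psi>1 (\<alpha> + s *\<^sub>R \<beta>) \<beta>" for s
    by (rule DERIV_along_line[OF \<psi>])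
  have d2: "DERIV (\<lambda>s. \<psi>1 (\<alpha> + s *\<^sub>R \<beta>) \<beta>) s :> \<psi>2 (\<alpha> + s *\<^sub>R \<beta>) \<beta> \<beta>" for s
    by (rule DERIV_along_line[OF \<psi>1])
  obtain z where z: "0 < z" "\<psi> (\<alpha> + 1 *\<^sub>R \<beta>) - \<psi> (\<alpha> + 0 *\<^sub>R \<beta>) = (1 - 0) * \<psi>1 (\<alpha> + z *\<^sub>R \<beta>) \<beta>"
    using MVT2[of 0 1, OF _ d1] by auto
  obtain z' where "\<psi>1 (\<alpha> + z *\<^sub>R \<beta>) \<beta> - \<psi>1 (\<alpha> + 0 *\<^sub>R \<beta>) \<beta> = (z - 0) * \<psi>2 (\<alpha> + z' *\<^sub>R \<beta>) \<beta> \<beta>"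
    using MVT2[of 0 z, OF z(1) d2] by auto
  moreover have "z * \<psi>2 (\<alpha> + z' *\<^sub>R \<beta>) \<beta> \<beta> \<le> 0"
    using z(1) neg by (simp add: mult_nonneg_nonpos)
  ultimately show ?thesis using z(2) by simp
qed

lemma partial_derivatives_middle:
  fixes F :: "'a::euclidean_space \<times> 'b::euclidean_space \<times> 'c::euclidean_space \<Rightarrow> 'd::real_normed_vector"
  assumes F: "Ck_on 2 (S \<times> UNIV \<times> UNIV) F" and y: "y \<in> S"
  shows "((\<lambda>\<xi>. F (y, \<xi>, t)) has_derivative (\<lambda>\<beta>. frechet_derivative F (at (y, \<xi>, t)) (0, \<beta>, 0))) (at \<xi>)"
    and "((\<lambda>\<xi>. frechet_derivative F (at (y, \<xi>, t)) (0, \<beta>, 0)) has_derivative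
      (\<lambda>\<gamma>. frechet_derivative (\<lambda>z. frechet_derivative F (at z) (0, \<beta>, 0)) (at (y, \<xi>, t)) (0, \<gamma>, 0))) (at \<xi>)"
proof -
  have in_dom: "(y, \<xi>, t) \<in> S \<times> UNIV \<times> UNIV" using y by simp
  have emb: "((\<lambda>\<xi>. (y, \<xi>, t)) has_derivative (\<lambda>\<gamma>. (0, \<gamma>, 0))) (at \<xi>)"
    by (intro has_derivative_Pair has_derivative_const has_derivative_ident)
  show "((\<lambda>\<xi>. F (y, \<xi>, t)) has_derivative (\<lambda>\<beta>. frechet_derivative F (at (y, \<xi>, t)) (0, \<beta>, 0))) (at \<xi>)"
    by (rule has_derivative_compose[OF emb Ck_on_2D(1)[OF F in_dom]])
  show "((\<lambda>\<xi>. frechet_derivative F (at (y, \<xi>, t)) (0, \<beta>, 0)) has_derivative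
      (\<lambda>\<gamma>. frechet_derivative (\<lambda>z. frechet_derivative F (at z) (0, \<beta>, 0)) (at (y, \<xi>, t)) (0, \<gamma>, 0))) (at \<xi>)"
    by (rule has_derivative_compose[OF emb Ck_on_2D(2)[OF F in_dom]])
qed

context riemannian_atlas
begin

text \<open>Replacing \<open>A\<close> at the differential of \<open>w\<close> by its linearisation at that of \<open>u\<close> changes the form by this
  defect.  For fixed \<open>v\<close> it is the distance of a concave function from its tangent.\<close>

proposition tangent_defect_nonneg:
  assumes A: "smooth_sym_bilin \<A> A" and c: "c \<in> \<A>" "x \<in> chart_dom c"
    and conc: "\<And>\<alpha> \<beta> v. D2 (\<lambda>\<xi>. v \<bullet> (A c x \<xi> t *v v)) \<alpha> \<beta> \<beta> \<le> 0"
  defines "DA \<equiv> \<lambda>\<alpha> \<beta>. (\<chi> j k. frechet_derivative (\<lambda>\<xi>. A c x \<xi> t $ j $ k) (at \<alpha>) \<beta>)"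
  shows "transpose (A c x \<alpha> t + DA \<alpha> \<beta> - A c x (\<alpha> + \<beta>) t) = A c x \<alpha> t + DA \<alpha> \<beta> - A c x (\<alpha> + \<beta>) t"
    and "0 \<le> v \<bullet> ((A c x \<alpha> t + DA \<alpha> \<beta> - A c x (\<alpha> + \<beta>) t) *v v)"
proof -
  define F where "F = (\<lambda>(y, \<xi>, t). A c (chart_inv c y) \<xi> t)"
  define y where "y = chart_map c x"
  have inv: "chart_inv c y = x" unfolding y_def by (rule chart_inv_map[OF c])
  have F: "F (y, \<xi>, t) = A c x \<xi> t" for \<xi> by (simp add: F_def inv)
  have "smooth_on (chart_img c \<times> UNIV \<times> UNIV) F"
    using A c by (simp only: smooth_sym_bilin_def F_def)
  then have F2: "Ck_on 2 (chart_img c \<times> UNIV \<times> UNIV) F" by (rule smooth_on_imp_Ck)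
  have y: "y \<in> chart_img c" using c(2) by (simp add: y_def)
  define a1 where "a1 \<xi> \<beta> = frechet_derivative F (at (y, \<xi>, t)) (0, \<beta>, 0)" for \<xi> \<beta>
  define a2 where "a2 \<xi> \<beta> \<gamma> = frechet_derivative (\<lambda>z. frechet_derivative F (at z) (0, \<beta>, 0)) (at (y, \<xi>, t)) (0, \<gamma>, 0)" for \<xi> \<beta> \<gamma>
  have d1: "((\<lambda>\<xi>. A c x \<xi> t) has_derivative a1 \<xi>) (at \<xi>)" for \<xi>
    using partial_derivatives_middle(1)[OF F2 y, of t \<xi>] by (simp add: F a1_def[abs_def])
  have d2: "((\<lambda>\<xi>. a1 \<xi> \<beta>) has_derivative a2 \<xi> \<beta>) (at \<xi>)" for \<xi> \<beta>
    using partial_derivatives_middle(2)[OF F2 y, of t \<beta> \<xi>] by (simp add: a1_def[abs_def] a2_def[abs_def])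
  have A_sym: "transpose (A c x \<xi> t) = A c x \<xi> t" for \<xi>
    using A c by (simp add: smooth_sym_bilin_def)
  have DA: "DA \<alpha> \<beta> = a1 \<alpha> \<beta>" for \<alpha> \<beta>
  proof -
    have "frechet_derivative (\<lambda>\<xi>. A c x \<xi> t $ j $ k) (at \<alpha>) \<beta> = a1 \<alpha> \<beta> $ j $ k" for j k
    proof -
      have "bounded_linear (\<lambda>M :: 'n rmat. M $ j $ k)"
        by (intro bounded_linear_compose[OF bounded_linear_vec_nth bounded_linear_vec_nth])
      from fun_cong[OF frechet_derivative_at[OF bounded_linear.has_derivative[OF this d1[of \<alpha>]]], of \<beta>]
      show ?thesis by (rule sym)
    qed
    then show ?thesis by (simp add: DA_def vec_eq_iff)
  qed
  have sym_DA: "transpose (DA \<alpha> \<beta>) = DA \<alpha> \<beta>"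
  proof -
    have "A c x \<xi> t $ j $ k = A c x \<xi> t $ k $ j" for \<xi> j k
    proof -
      have "A c x \<xi> t $ j $ k = transpose (A c x \<xi> t) $ k $ j" by (simp add: transpose_def)
      then show ?thesis by (simp only: A_sym)
    qed
    then show ?thesis by (simp add: DA_def transpose_def vec_eq_iff)
  qed
  show "transpose (A c x \<alpha> t + DA \<alpha> \<beta> - A c x (\<alpha> + \<beta>) t) = A c x \<alpha> t + DA \<alpha> \<beta> - A c x (\<alpha> + \<beta>) t"
    by (simp add: transpose_add_diff A_sym sym_DA)
  have quad: "bounded_linear (\<lambda>M :: 'n rmat. v \<bullet> (M *v v))" for v
    by (intro bounded_linear_compose[OF bounded_linear_inner_right]
      bounded_bilinear.bounded_linear_left[OF bounded_bilinear_matrix_vector])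
  have q1: "((\<lambda>\<xi>. v \<bullet> (A c x \<xi> t *v v)) has_derivative (\<lambda>\<beta>. v \<bullet> (a1 \<xi> \<beta> *v v))) (at \<xi>)" for \<xi>
    by (rule bounded_linear.has_derivative[OF quad d1])
  have q2: "((\<lambda>\<xi>. v \<bullet> (a1 \<xi> \<beta> *v v)) has_derivative (\<lambda>\<gamma>. v \<bullet> (a2 \<xi> \<beta> \<gamma> *v v))) (at \<xi>)" for \<xi> \<beta>
    by (rule bounded_linear.has_derivative[OF quad d2])
  have first: "frechet_derivative (\<lambda>\<xi>. v \<bullet> (A c x \<xi> t *v v)) (at \<xi>) = (\<lambda>\<beta>. v \<bullet> (a1 \<xi> \<beta> *v v))" for \<xi>
    using frechet_derivative_at[OF q1] by simp
  have second: "frechet_derivative (\<lambda>\<xi>. v \<bullet> (a1 \<xi> \<beta> *v v)) (at \<xi>) = (\<lambda>\<gamma>. v \<bullet> (a2 \<xi> \<beta> \<gamma> *v v))" for \<xi> \<beta>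
    using frechet_derivative_at[OF q2] by simp
  have "v \<bullet> (a2 \<xi> \<beta> \<beta> *v v) \<le> 0" for \<xi>
    using conc[of v \<xi> \<beta>] by (simp add: D2_def first second)
  from concave_below_tangent[OF q1 q2 this, of \<alpha>]
  show "0 \<le> v \<bullet> ((A c x \<alpha> t + DA \<alpha> \<beta> - A c x (\<alpha> + \<beta>) t) *v v)"
    by (simp add: DA matrix_vector_mult_add_rdistrib matrix_vector_mult_diff_rdistrib inner_add_right inner_diff_right)
qed

lemma Ahess_symmetric:
  assumes "smooth_sym_bilin \<A> A" "c \<in> \<A>" "C2_fun \<A> u" "x \<in> chart_dom c"
  shows "transpose (Ahess g A c u x) = Ahess g A c u x"
  unfolding Ahess_def transpose_add_diff hessian_symmetric[OF assms(2-4)]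
  using assms by (simp add: smooth_sym_bilin_def)

end

section \<open>\<open>\<C>\<close>-subsolutions are pseudo-solutions\<close>

lemma Fmat_eq_lin_op: "Fmat g p A c u x = lin_op (g c x) p (Ahess g A c u x)"
  by (simp add: Fmat_def lin_op_def)

theorem proposition3p7:
  fixes \<A> :: "('m::{t2_space,second_countable_topology}, 'n::{finite,linorder}) chart set"
    and g :: "('m, 'n) field2"
    and p :: nat
    and A :: "('m, 'n) bilin_data"
    and \<phi> :: "('m, 'n) scalar_data"
    and \<phi>\<^sub>0 :: "'m \<Rightarrow> real"
    and w :: "'m \<Rightarrow> real"
  assumes "closed_connected_riemannian_manifold \<A> g"
    and "p \<in> {1..CARD('n)}"
    and "smooth_sym_bilin \<A> A"
    and "smooth_pos_scalar \<A> \<phi>"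
    and "smooth_fun \<A> \<phi>\<^sub>0" and "\<forall>x. \<phi>\<^sub>0 x > 0"
    and "\<forall>c\<in>\<A>. \<forall>x\<in>chart_dom c. \<forall>\<xi> t. \<phi> c x \<xi> t = \<phi>\<^sub>0 x"
    and "\<forall>c\<in>\<A>. \<forall>x\<in>chart_dom c. \<forall>\<xi> s t. A c x \<xi> s = A c x \<xi> t"
    and "\<forall>c\<in>\<A>. \<forall>x\<in>chart_dom c. \<forall>t \<alpha> \<beta> v.
           D2 (\<lambda>\<xi>. v \<bullet> (A c x \<xi> t *v v)) \<alpha> \<beta> \<beta> \<le> 0"
    and "C_subsolution \<A> g p A \<phi>\<^sub>0 w"
  shows "pseudo_solution \<A> g p A \<phi> w"
proof -
  interpret riemannian_atlas \<A> g
    using assms(1) by unfold_locales (auto simp: closed_connected_riemannian_manifold_def)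
  have comp: "compact (UNIV :: 'm set)"
    using assms(1) by (simp add: closed_connected_riemannian_manifold_def)
  note p = assms(2) and A = assms(3)
  have \<phi>: "\<phi> c x \<xi> t = \<phi>\<^sub>0 x" if "c \<in> \<A>" "x \<in> chart_dom c" for c x \<xi> t
    using assms(7) that by blast
  have A_t: "A c x \<xi> s = A c x \<xi> t" if "c \<in> \<A>" "x \<in> chart_dom c" for c x \<xi> s t
    using assms(8) that by blast
  have conc: "D2 (\<lambda>\<xi>. v \<bullet> (A c x \<xi> t *v v)) \<alpha> \<beta> \<beta> \<le> 0" if "c \<in> \<A>" "x \<in> chart_dom c" for c x t \<alpha> \<beta> v
    using assms(9) that by blast
  have w: "C2_fun \<A> w" using assms(10) by (simp add: C_subsolution_def)
  from assms(10) obtain \<delta> R where \<delta>: "\<delta> > 0" and R: "R > 0"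
    and sub: "\<And>c x. c \<in> \<A> \<Longrightarrow> x \<in> chart_dom c \<Longrightarrow>
        {\<mu>. \<mu> \<in> Gamma_cone p \<and> root p (esym p \<mu>) = \<phi>\<^sub>0 x}
          \<inter> ({eigvals (matrix_inv (g c x) ** Ahess g A c w x) - \<delta> *\<^sub>R (\<chi> i. 1)} + Gamma_cone CARD('n))
        \<subseteq> ball 0 R"
    unfolding C_subsolution_def lam_def by blast
  obtain L where L: "L \<ge> 0" "\<And>c x Y. c \<in> \<A> \<Longrightarrow> x \<in> chart_dom c \<Longrightarrow>
      - L * (Y \<bullet> (g c x *v Y)) \<le> Y \<bullet> (Ahess g A c w x *v Y)"
    using Ahess_bounded_below[OF comp A w] by blast
  have sol: "C2_fun \<A> u" "c \<in> \<A> \<Longrightarrow> x \<in> chart_dom c \<Longrightarrow>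
      eigvals (matrix_inv (g c x) ** Ahess g A c u x) \<in> Gamma_cone p"
      "c \<in> \<A> \<Longrightarrow> x \<in> chart_dom c \<Longrightarrow>
      root p (esym p (eigvals (matrix_inv (g c x) ** Ahess g A c u x))) = \<phi>\<^sub>0 x"
    if "solution \<A> g p A \<phi> u" for u c x
    using that \<phi> by (auto simp: solution_def lam_def)
  have "pseudo_subsolution_cond \<A> g p A \<phi> w"
    unfolding pseudo_subsolution_cond_def
  proof (intro allI impI)
    fix C :: real
    define N where "N = R + L + \<delta>"
    have N: "N \<ge> 0" using R L(1) \<delta> by (simp add: N_def)
    show "\<exists>\<delta>\<^sub>1>0. \<exists>M\<^sub>1\<ge>0. \<forall>u. solution \<A> g p A \<phi> u \<and> C1_size \<A> g u \<le> C \<longrightarrow>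
        (\<forall>c\<in>\<A>. \<forall>x\<in>chart_dom c.
           contract (Fmat g p A c u x) (hessian g c (\<lambda>z. w z - u z) x)
           + contract (Fmat g p A c u x)
               (\<chi> j k. frechet_derivative (\<lambda>\<xi>. A c x \<xi> (u x) $ j $ k) (at (diff_form c u x))
                          (diff_form c (\<lambda>z. w z - u z) x))
           \<ge> \<delta>\<^sub>1 * contract (Fmat g p A c u x) (g c x)
              - M\<^sub>1 * min_eigval (Fmat g p A c u x ** g c x) - M\<^sub>1)"
    proof (rule exI[of _ "\<delta> / 2"], rule conjI, use \<delta> in simp, rule exI[of _ N], rule conjI[OF N],
        intro allI impI ballI)
      fix u c x
      assume "solution \<A> g p A \<phi> u \<and> C1_size \<A> g u \<le> C" and c: "c \<in> \<A>" and x: "x \<in> chart_dom c"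
      then have s: "solution \<A> g p A \<phi> u" by simp
      note u = sol(1)[OF s] and cone = sol(2)[OF s c x] and val = sol(3)[OF s c x]
      note Bu = Ahess_symmetric[OF A c u x] and Bw = Ahess_symmetric[OF A c w x]
      let ?F = "lin_op (g c x) p (Ahess g A c u x)"
      let ?du = "diff_form c u x" and ?\<beta> = "diff_form c (\<lambda>z. w z - u z) x"
      define DA where "DA = (\<chi> j k. frechet_derivative (\<lambda>\<xi>. A c x \<xi> (u x) $ j $ k) (at ?du) ?\<beta>)"
      define K where "K = A c x ?du (u x) + DA - A c x (?du + ?\<beta>) (u x)"
      have dw: "?du + ?\<beta> = diff_form c w x" by (simp add: derivatives_diff(1)[OF c x w u])
      have K: "transpose K = K" "0 \<le> v \<bullet> (K *v v)" for v
        unfolding K_def DA_def by (rule tangent_defect_nonneg[OF A c x conc[OF c x]])+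
      have "hessian g c (\<lambda>z. w z - u z) x + DA = (Ahess g A c w x - Ahess g A c u x) + K"
        by (simp add: K_def dw Ahess_def derivatives_diff(2)[OF c x w u] A_t[OF c x, of _ "w x" "u x"])
      then have "contract ?F (hessian g c (\<lambda>z. w z - u z) x) + contract ?F DA
          = contract ?F (Ahess g A c w x - Ahess g A c u x) + contract ?F K"
        unfolding contract_linear(1)[symmetric] by (rule arg_cong)
      moreover have "0 \<le> contract ?F K"
        by (rule pointwise_linearised_monotone[OF metric_pos_def[OF c x] p Bu cone K])
      moreover have "\<delta> / 2 * contract ?F (g c x) - N * min_eigval (?F ** g c x)
          \<le> contract ?F (Ahess g A c w x - Ahess g A c u x)"
        by (rule pointwise_subsolution_inequality[OF metric_pos_def[OF c x] p Bu cone val Bw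
          L(2)[OF c x] \<delta> N_def N sub[OF c x]])
      ultimately show "contract (Fmat g p A c u x) (hessian g c (\<lambda>z. w z - u z) x)
          + contract (Fmat g p A c u x)
              (\<chi> j k. frechet_derivative (\<lambda>\<xi>. A c x \<xi> (u x) $ j $ k) (at ?du) ?\<beta>)
          \<ge> \<delta> / 2 * contract (Fmat g p A c u x) (g c x) - N * min_eigval (Fmat g p A c u x ** g c x) - N"
        unfolding Fmat_eq_lin_op DA_def[symmetric] using N by linarith
    qed
  qed
  moreover have "pseudo_supersolution_cond \<A> g p A \<phi> w"
    unfolding pseudo_supersolution_cond_def
  proof -
    have "\<delta> / 4 > 0" using \<delta> by simp
    then obtain \<rho> where \<rho>: "\<rho> > 0" "\<And>c x u Y. c \<in> \<A> \<Longrightarrow> x \<in> chart_dom c \<Longrightarrow> C2_fun \<A> u \<Longrightarrow>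
      conorm g c x (diff_form c (\<lambda>z. u z - w z) x) \<le> \<rho> \<Longrightarrow>
      - (\<delta> / 4) * (Y \<bullet> (g c x *v Y)) \<le> Y \<bullet> ((A c x (diff_form c u x) 0 - A c x (diff_form c w x) 0) *v Y)"
      using A_perturbation_bound[OF comp A w, of "\<delta> / 4" 0] by blast
    \<comment> \<open>the change of \<open>A\<close> and the lower bound of the Hessian each cost at most \<open>\<delta> / 4\<close>\<close>
    define \<delta>\<^sub>2 where "\<delta>\<^sub>2 = min \<rho> (\<delta> / 4)"
    have \<delta>\<^sub>2: "\<delta>\<^sub>2 > 0" "\<delta>\<^sub>2 \<le> \<rho>" "\<delta> / 4 + \<delta>\<^sub>2 < \<delta>" using \<rho>(1) \<delta> by (auto simp: \<delta>\<^sub>2_def min_def)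
    define M where "M = \<bar>R + L + \<delta> / 4 + \<delta>\<^sub>2\<bar> ^ CARD('n)"
    have M: "M \<ge> 0" by (simp add: M_def)
    show "\<exists>\<delta>\<^sub>2>0. \<exists>M\<^sub>2\<ge>0. \<forall>u. solution \<A> g p A \<phi> u \<longrightarrow>
        (\<forall>c\<in>\<A>. \<forall>x\<in>chart_dom c.
           lam g c x (hessian g c (\<lambda>z. u z - w z) x) + \<delta>\<^sub>2 *\<^sub>R (\<chi> i. 1) \<in> closure (Gamma_cone CARD('n)) \<and>
           conorm g c x (diff_form c (\<lambda>z. u z - w z) x) \<le> \<delta>\<^sub>2 \<longrightarrow>
           esym CARD('n) (lam g c x (\<delta>\<^sub>2 *\<^sub>R g c x + hessian g c (\<lambda>z. u z - w z) x)) \<le> M\<^sub>2)"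
    proof (rule exI[of _ \<delta>\<^sub>2], rule conjI[OF \<delta>\<^sub>2(1)], rule exI[of _ M], rule conjI[OF M],
        intro allI impI ballI)
      fix u c x
      assume s: "solution \<A> g p A \<phi> u" and c: "c \<in> \<A>" and x: "x \<in> chart_dom c"
        and *: "lam g c x (hessian g c (\<lambda>z. u z - w z) x) + \<delta>\<^sub>2 *\<^sub>R (\<chi> i. 1) \<in> closure (Gamma_cone CARD('n)) \<and>
           conorm g c x (diff_form c (\<lambda>z. u z - w z) x) \<le> \<delta>\<^sub>2"
      note u = sol(1)[OF s] and cone = sol(2)[OF s c x] and val = sol(3)[OF s c x]
      define E where "E = A c x (diff_form c u x) 0 - A c x (diff_form c w x) 0"
      define H where "H = hessian g c (\<lambda>z. u z - w z) x"
      have E: "transpose E = E"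
        unfolding E_def transpose_add_diff using A c x by (simp add: smooth_sym_bilin_def)
      have Hsym: "transpose H = H"
        unfolding H_def by (rule hessian_symmetric[OF c C2_fun_diff[OF u w] x])
      have Bu: "Ahess g A c u x = Ahess g A c w x + E + H"
        unfolding Ahess_def E_def H_def derivatives_diff(2)[OF c x u w]
          A_t[OF c x, of _ "w x" 0] A_t[OF c x, of _ "u x" 0] by simp
      have E_ge: "- (\<delta> / 4) * (Y \<bullet> (g c x *v Y)) \<le> Y \<bullet> (E *v Y)" for Y
        unfolding E_def using * \<delta>\<^sub>2(2) by (intro \<rho>(2)[OF c x u]) simp
      have "esym CARD('n) (eigvals (matrix_inv (g c x) ** (\<delta>\<^sub>2 *\<^sub>R g c x + H))) \<le> M"
        unfolding M_def
        by (rule pointwise_supersolution_bound[OF metric_pos_def[OF c x] p Bu cone val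
          Ahess_symmetric[OF A c w x] E Hsym L(2)[OF c x] E_ge \<delta>\<^sub>2(3) sub[OF c x]])
          (use * in \<open>simp add: lam_def H_def\<close>)
      then show "esym CARD('n) (lam g c x (\<delta>\<^sub>2 *\<^sub>R g c x + hessian g c (\<lambda>z. u z - w z) x)) \<le> M"
        by (simp add: lam_def H_def)
    qed
  qed
  ultimately show ?thesis using w by (simp add: pseudo_solution_def)
qed

end
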